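(* Let $0<t_0<T$. For $i\in\{1,2\}$ let $p_i$ be the law on $\mathbb{R}^D$ of $x=A_iz_i+\varepsilon_i$, where $A_i\in\mathbb{R}^{D\times d_i}$ satisfies $A_i^\top A_i=I_{d_i}$, $z_i\sim p_{i,z}$ is a random vector in $\mathbb{R}^{d_i}$, and $\varepsilon_i\sim\mathcal{N}(0,\sigma_i^2I_D)$ is independent of $z_i$, with $\sigma_i>0$. Assume, for $i=1,2$: (i) the map $f_i^*(z,t):=\widetilde h_i(t)\nabla\log p_{i,t}^{\rm LD}(z)+z$ is $\beta_i$-Lipschitz in $z\in\mathbb{R}^{d_i}$, uniformly over $t\in[0,T]$; (ii) the density $p_{i,z}>0$ is twice continuously differentiable, and there are constants $B_i,C_{1,i},C_{2,i}>0$ with $p_{i,z}(z)\le(2\pi)^{-d_i/2}C_{1,i}\exp\{-C_{2,i}\|z\|_2^2/2\}$ for all $\|z\|_2\ge B_i$; (iii) $\sup_{t\in[t_0,T]}\|g_i(0,t)\|_2<\infty$, and $g_i$ is differentiable in $t$ with $\sup_{t\in[t_0,T],\,\|y\|_2\le R}\|\partial_tg_i(y,t)\|_2<\infty$ for every $R>0$, where $g_i(y,t):=h(t)\nabla\log p_{i,t}^{\rm LD}(y)+y$. Let $\omega_1,\omega_2>0$ with $\omega_1+\omega_2=1$, let $p_{\rm mix}=\omega_1p_1+\omega_2p_2$, let $V_1\in\mathbb{R}^{D\times d_1}$ satisfy $V_1^\top V_1=I_{d_1}$, and for $k\in\{\max(d_1,d_2),\dots,D\}$ let $W_k\in\mathbb{R}^{D\times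 k}$ have orthonormal columns spanning a top-$k$ eigenspace of $M_{\rm mix}=\sum_{i=1}^2\omega_i\bar c_iA_iA_i^\top$ (equivalently, $W_k$ minimizes $\sum_i\omega_i\bar c_i\|P_W^\perp A_i\|_F^2$ over $W\in\mathbb{R}^{D\times k}$ with $W^\top W=I_k$). Then, for $U\in\{V_1,W_k\}$ (with $m$ denoting the number of columns of $U$) and any $\eta>0$, $$\mathcal{B}_{\rm mix}(U)\le(1+\eta)\Bigg[\Gamma(U)+\sum_{i=1}^2\omega_i\bar n_i\operatorname{Tr}(P_U^\perp P_i^\perp)+2\sum_{i=1}^2\omega_i\mathfrak{R}_i(U)+2\mathfrak{P}(U)\Bigg]+\Big(1+\frac1\eta\Big)\inf_{f_\theta\in\mathcal{F}_{\rm ReLU}^{(m)}}\mathcal{A}_{\rm mix}(f_\theta;U),$$ with all quantities as defined in the context.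
   Context: Forward process: $\alpha(t)=e^{-t/2}$, $h(t)=1-e^{-t}$, $X_t\mid X_0\sim\mathcal{N}(\alpha(t)X_0,h(t)I_D)$; $p_{i,t}$ and $p_{{\rm mix},t}=\omega_1p_{1,t}+\omega_2p_{2,t}$ are the densities of $X_t$ when $X_0\sim p_i$ and $X_0\sim p_{\rm mix}$. $\widetilde h_i(t)=\alpha^2(t)\sigma_i^2+h(t)$; $p_{i,t}^{\rm LD}(y)=\int_{\mathbb{R}^{d_i}}\phi_{i,t}(y\mid z)p_{i,z}(z)\,\mathrm{d}z$ with $\phi_{i,t}(\cdot\mid z)$ the density of $\mathcal{N}(\alpha(t)z,\widetilde h_i(t)I_{d_i})$. Projections: $P_i=A_iA_i^\top$, $P_i^\perp=I_D-P_i$, $P_U=UU^\top$, $P_U^\perp=I_D-P_U$. Constants: $\lambda_{g,i}^{\max}(t)=\lambda_{\max}\big(\mathbb{E}_{X_t\sim p_{i,t}}[g_i(A_i^\top X_t,t)g_i(A_i^\top X_t,t)^\top]\big)$, $$\bar c_i=\frac{1}{T-t_0}\int_{t_0}^T\frac{\lambda_{g,i}^{\max}(t)}{h^2(t)}\,\mathrm{d}t,\qquad\bar n_i=\frac{1}{T-t_0}\int_{t_0}^T\frac{\alpha^4(t)\sigma_i^4}{h^2(t)\widetilde h_i(t)}\,\mathrm{d}t,\qquad\Gamma(U)=\sum_{i=1}^2\omega_i\bar c_i\|P_U^\perp A_i\|_F^2.$$ ReLU class: $\mathcal{F}_{\rm ReLU}^{(m)}=\mathcal{F}_{\rm ReLU}^{(m)}(L,M,J,K,\kappa,\gamma,\gamma_t)$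 is the set of functions $f(z,t)=W_L\sigma(\cdots\sigma(W_1[z^\top,t]^\top+b_1)\cdots)+b_L$ from $\mathbb{R}^m\times[0,T]$ to $\mathbb{R}^m$ (here $W_\ell,b_\ell$ are network weights), $\sigma$ the entrywise ReLU, with width at most $M$, $\sup_{z,t}\|f(z,t)\|_2\le K$, all entries of weights and biases bounded by $\kappa$ in absolute value, at most $J$ nonzero weights and biases in total, $\|f(z_1,t)-f(z_2,t)\|_2\le\gamma\|z_1-z_2\|_2$ for all $t\in[0,T]$, and $\|f(z,t_1)-f(z,t_2)\|_2\le\gamma_t|t_1-t_2|$ for all $z$. Oracle risk: $\mathcal{S}_{\rm mix}(U)=\{\frac{1}{h(t)}Uf_\theta(U^\top x,t)-\frac{1}{h(t)}x:\ f_\theta\in\mathcal{F}_{\rm ReLU}^{(m)}\}$, $\mathcal{L}_{\rm mix}(s)=\frac{1}{T-t_0}\int_{t_0}^T\mathbb{E}_{X_t\sim p_{{\rm mix},t}}\|s(X_t,t)-\nabla\log p_{{\rm mix},t}(X_t)\|_2^2\,\mathrm{d}t$, and $\mathcal{B}_{\rm mix}(U)=\inf_{s\in\mathcal{S}_{\rm mix}(U)}\mathcal{L}_{\rm mix}(s)$. Comparators: $\rho_i(t)=\alpha^2(t)\sigma_i^2/\widetilde h_i(t)$; $G_{i,t}(x)=A_ig_i(A_i^\top x,t)+\rho_i(t)P_i^\perp x$; $\pi_i(x,t)=\omega_ip_{i,t}(x)/p_{{\rm mix},t}(x)$; $q_{i,U,t}$ is the density of $U^\top X_t$ for $X_t\sim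 p_{i,t}$; $\pi_i^U(z,t)=\omega_iq_{i,U,t}(z)/(\omega_1q_{1,U,t}(z)+\omega_2q_{2,U,t}(z))$; $H_i(U)=U^\top A_i$; $\psi_{i,U}(z,t)=H_i(U)\,g_i(H_i(U)^\dagger z,t)$ with $\dagger$ the Moore–Penrose pseudoinverse; $f_{{\rm mix},U}^{\rm comp}(z,t)=\pi_1^U(z,t)\psi_{1,U}(z,t)+\pi_2^U(z,t)\psi_{2,U}(z,t)$. Error terms: $$\mathcal{A}_{\rm mix}(f_\theta;U)=\frac{1}{T-t_0}\int_{t_0}^T\frac{1}{h^2(t)}\mathbb{E}_{X_t\sim p_{{\rm mix},t}}\|f_\theta(U^\top X_t,t)-f_{{\rm mix},U}^{\rm comp}(U^\top X_t,t)\|_2^2\,\mathrm{d}t,$$ $$\mathfrak{R}_i(U)=\frac{1}{T-t_0}\int_{t_0}^T\frac{1}{h^2(t)}\mathbb{E}_{X_t\sim p_{i,t}}\|\psi_{i,U}(U^\top X_t,t)-U^\top G_{i,t}(X_t)\|_2^2\,\mathrm{d}t,$$ $$\mathfrak{P}(U)=\frac{1}{T-t_0}\int_{t_0}^T\frac{1}{h^2(t)}\mathbb{E}_{X_t\sim p_{{\rm mix},t}}\Big[(\pi_1^U(U^\top X_t,t)-\pi_1(X_t,t))^2\|\psi_{1,U}(U^\top X_t,t)-\psi_{2,U}(U^\top X_t,t)\|_2^2\Big]\mathrm{d}t.$$ *)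

theory Defs
  imports "HOL-Probability.Probability"
begin

section \<open>Linear algebra\<close>

definition grad :: "('a::real_inner \<Rightarrow> real) \<Rightarrow> 'a \<Rightarrow> 'a" where
  "grad f x = (THE D. GDERIV f x :> D)"

definition orthonormal_columns :: "real^'m^'n \<Rightarrow> bool" where
  "orthonormal_columns U \<longleftrightarrow> transpose U ** U = mat 1"

definition proj :: "real^'m^'n \<Rightarrow> real^'n^'n" where
  "proj A = A ** transpose A"

definition proj_perp :: "real^'m^'n \<Rightarrow> real^'n^'n" where
  "proj_perp A = mat 1 - proj A"

definition lambda_max :: "real^'n^'n \<Rightarrow> real" where
  "lambda_max M = Max {l. \<exists>v. v \<noteq> 0 \<and> M *v v = l *\<^sub>R v}"

definition pinv :: "real^'n^'m \<Rightarrow> real^'m^'n" where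
  "pinv A = (THE X. A ** X ** A = A \<and> X ** A ** X = X \<and>
     transpose (A ** X) = A ** X \<and> transpose (X ** A) = X ** A)"

text \<open>The span of the first \<open>k\<close> members of an orthonormal eigenbasis whose eigenvalues are
  listed in decreasing order; such a subspace need not be unique when eigenvalues coincide.\<close>

definition top_eigenspace :: "nat \<Rightarrow> real^'n^'n \<Rightarrow> (real^'n) set \<Rightarrow> bool" where
  "top_eigenspace k M S \<longleftrightarrow> k \<le> CARD('n) \<and>
     (\<exists>(v :: nat \<Rightarrow> real^'n) (l :: nat \<Rightarrow> real).
        (\<forall>i<CARD('n). \<forall>j<CARD('n). v i \<bullet> v j = (if i = j then 1 else 0)) \<and>
        (\<forall>i<CARD('n). M *v v i = l i *\<^sub>R v i) \<and>
        (\<forall>i j. i \<le> j \<longrightarrow> j < CARD('n) \<longrightarrow> l j \<le> l i) \<and>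
        S = span (v ` {..<k}))"

definition twice_cont_differentiable :: "('a::real_normed_vector \<Rightarrow> real) \<Rightarrow> bool" where
  "twice_cont_differentiable f \<longleftrightarrow>
     (\<exists>(f' :: 'a \<Rightarrow> 'a \<Rightarrow>\<^sub>L real) (f'' :: 'a \<Rightarrow> 'a \<Rightarrow>\<^sub>L ('a \<Rightarrow>\<^sub>L real)).
        (\<forall>x. (f has_derivative blinfun_apply (f' x)) (at x)) \<and>
        (\<forall>x. (f' has_derivative blinfun_apply (f'' x)) (at x)) \<and>
        continuous_on UNIV f'')"


section \<open>Gaussian densities and the forward process\<close>

text \<open>Density at \<open>x\<close> of the normal distribution with mean \<open>\<mu>\<close> and covariance \<open>v\<close> times the
  identity (so \<open>v\<close> is a variance, not a standard deviation).\<close>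

definition gauss :: "'a::euclidean_space \<Rightarrow> real \<Rightarrow> 'a \<Rightarrow> real" where
  "gauss \<mu> v x = (2 * pi * v) powr (- real DIM('a) / 2) * exp (- (norm (x - \<mu>))\<^sup>2 / (2 * v))"

definition alpha :: "real \<Rightarrow> real" where
  "alpha t = exp (- t / 2)"

definition hvar :: "real \<Rightarrow> real" where
  "hvar t = 1 - exp (- t)"

text \<open>For \<open>X\<^sub>0 \<sim> p\<close>, this is the everywhere defined version of the density of \<open>X\<^sub>t\<close> (\<open>t > 0\<close>)
  obtained by averaging the transition density over \<open>X\<^sub>0\<close>; a pointwise version is needed
  because its gradient is taken.\<close>

definition fwd_dens :: "'a::euclidean_space measure \<Rightarrow> real \<Rightarrow> 'a \<Rightarrow> real" where
  "fwd_dens p t x = (\<integral>x0. gauss (alpha t *\<^sub>R x0) (hvar t) x \<partial>p)"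

definition fwd_law :: "'a::euclidean_space measure \<Rightarrow> real \<Rightarrow> 'a measure" where
  "fwd_law p t = density lborel (\<lambda>x. ennreal (fwd_dens p t x))"

definition mixture :: "real \<Rightarrow> real \<Rightarrow> 'a::euclidean_space measure \<Rightarrow> 'a measure \<Rightarrow> 'a measure" where
  "mixture w1 w2 p1 p2 = measure_of UNIV (sets borel)
     (\<lambda>B. ennreal w1 * emeasure p1 B + ennreal w2 * emeasure p2 B)"

lemma space_mixture [simp]: "space (mixture w1 w2 p1 p2) = UNIV"
  by (simp add: mixture_def space_measure_of_conv)

lemma sets_mixture [simp, measurable_cong]: "sets (mixture w1 w2 p1 p2) = sets borel"
  using sets.sigma_sets_eq[of borel]
  by (simp add: mixture_def)

lemma emeasure_mixture:
  assumes [simp]: "sets p1 = sets borel" "sets p2 = sets borel" and B: "B \<in> sets borel"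
  shows "emeasure (mixture w1 w2 p1 p2) B = ennreal w1 * emeasure p1 B + ennreal w2 * emeasure p2 B"
proof (rule emeasure_measure_of[OF mixture_def])
  show "positive (sets (mixture w1 w2 p1 p2)) (\<lambda>B. ennreal w1 * emeasure p1 B + ennreal w2 * emeasure p2 B)"
    by (simp add: positive_def)
  show "countably_additive (sets (mixture w1 w2 p1 p2)) (\<lambda>B. ennreal w1 * emeasure p1 B + ennreal w2 * emeasure p2 B)"
  proof (rule countably_additiveI)
    fix A :: "nat \<Rightarrow> 'a set"
    assume A: "range A \<subseteq> sets (mixture w1 w2 p1 p2)" "disjoint_family A"
    have "(\<Sum>i. ennreal w1 * emeasure p1 (A i) + ennreal w2 * emeasure p2 (A i))
        = ennreal w1 * (\<Sum>i. emeasure p1 (A i)) + ennreal w2 * (\<Sum>i. emeasure p2 (A i))"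
      by (simp add: suminf_add[symmetric])
    then show "(\<Sum>i. ennreal w1 * emeasure p1 (A i) + ennreal w2 * emeasure p2 (A i))
        = ennreal w1 * emeasure p1 (\<Union>i. A i) + ennreal w2 * emeasure p2 (\<Union>i. A i)"
      using A by (simp add: suminf_emeasure)
  qed
qed (use B in auto)

lemma nn_integral_mixture:
  assumes [simp]: "sets p1 = sets borel" "sets p2 = sets borel" and f: "f \<in> borel_measurable borel"
  shows "(\<integral>\<^sup>+x. f x \<partial>mixture w1 w2 p1 p2)
       = ennreal w1 * (\<integral>\<^sup>+x. f x \<partial>p1) + ennreal w2 * (\<integral>\<^sup>+x. f x \<partial>p2)"
proof -
  note [measurable_cong] = assms(1,2)
  have sp [simp]: "space p1 = UNIV" "space p2 = UNIV"
    using assms(1,2)[THEN sets_eq_imp_space_eq] by auto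
  from f show ?thesis
  proof (induction rule: borel_measurable_induct)
    case (cong f g)
    then show ?case by (simp cong: nn_integral_cong)
  next
    case (set A)
    then show ?case by (simp add: emeasure_mixture)
  next
    case (mult u c)
    have [measurable]: "u \<in> borel_measurable borel" by fact
    show ?case
      by (subst (1 2 3) nn_integral_cmult) (auto simp: mult.IH distrib_left ac_simps)
  next
    case (add u v)
    have [measurable]: "u \<in> borel_measurable borel" "v \<in> borel_measurable borel" by fact+
    show ?case
      by (subst (1 2 3) nn_integral_add) (auto simp: add.IH distrib_left ac_simps)
  next
    case (seq U)
    have [measurable]: "\<And>i. U i \<in> borel_measurable borel" by fact
    have m: "\<And>p. incseq (\<lambda>i. (\<integral>\<^sup>+x. U i x \<partial>p))" 
      using seq by (auto simp: incseq_def le_fun_def intro!: nn_integral_mono)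
    have e: "(SUP i. U i) = (\<lambda>x. SUP i. U i x)" by (auto simp: fun_eq_iff image_image)
    show ?case unfolding e
      by (subst (1 2 3) nn_integral_monotone_convergence_SUP)
         (use seq m in \<open>auto simp: SUP_mult_left_ennreal ennreal_SUP_add incseq_def mult_left_mono\<close>)
  qed
qed

lemma gauss_nonneg: "0 \<le> gauss \<mu> v x"
  by (simp add: gauss_def)

lemma gauss_le: "0 < v \<Longrightarrow> gauss \<mu> v x \<le> (2 * pi * v) powr (- real DIM('a) / 2)"
  for x :: "'a::euclidean_space"
  by (simp add: gauss_def mult_left_le)

lemma fwd_dens_mixture:
  fixes p1 p2 :: "'a::euclidean_space measure"
  assumes p: "prob_space p1" "prob_space p2" "sets p1 = sets borel" "sets p2 = sets borel"
    and w: "0 \<le> w1" "0 \<le> w2" and t: "0 < t"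
  shows "fwd_dens (mixture w1 w2 p1 p2) t x = w1 * fwd_dens p1 t x + w2 * fwd_dens p2 t x"
proof -
  let ?f = "\<lambda>x0. gauss (alpha t *\<^sub>R x0) (hvar t) x"
  have h: "0 < hvar t" using t by (simp add: hvar_def)
  have [measurable]: "?f \<in> borel_measurable borel"
    unfolding gauss_def by measurable
  have fin: "(\<integral>\<^sup>+x0. ennreal (?f x0) \<partial>p) = ennreal (fwd_dens p t x)"
    if "prob_space p" and s: "sets p = sets borel" for p
  proof -
    interpret prob_space p by fact
    note [measurable_cong] = s
    have "integrable p ?f"
      by (rule integrable_const_bound[where B="(2 * pi * hvar t) powr (- real DIM('a) / 2)"])
         (use gauss_le[OF h] in \<open>auto simp: gauss_nonneg\<close>)
    then show ?thesis
      unfolding fwd_dens_def by (intro nn_integral_eq_integral) (auto simp: gauss_nonneg)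
  qed
  have nn: "0 \<le> fwd_dens p t x" for p
    unfolding fwd_dens_def by (intro integral_nonneg_AE) (auto simp: gauss_nonneg)
  have "fwd_dens (mixture w1 w2 p1 p2) t x = enn2real (\<integral>\<^sup>+x0. ennreal (?f x0) \<partial>mixture w1 w2 p1 p2)"
    unfolding fwd_dens_def by (intro integral_eq_nn_integral) (auto simp: gauss_nonneg)
  also have "\<dots> = enn2real (ennreal (w1 * fwd_dens p1 t x + w2 * fwd_dens p2 t x))"
    using w nn by (subst nn_integral_mixture) (auto simp: p fin ennreal_plus ennreal_mult)
  finally show ?thesis using w nn by (simp del: ennreal_plus)
qed


section \<open>Components\<close>

record ('n, 'd) component =
  basis :: "real^'d^'n"
  latent :: "real^'d \<Rightarrow> real"
  noise :: real

text \<open>Law of \<open>A z + \<epsilon>\<close>, where \<open>z\<close> has density \<open>latent c\<close> and \<open>\<epsilon>\<close> is an independent centred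
  Gaussian vector with standard deviation \<open>noise c\<close> in every coordinate.\<close>

definition data_law :: "('n::finite, 'd::finite) component \<Rightarrow> (real^'n) measure" where
  "data_law c = distr
     (density lborel (\<lambda>z. ennreal (latent c z)) \<Otimes>\<^sub>M density lborel (\<lambda>e. ennreal (gauss 0 ((noise c)\<^sup>2) e)))
     borel (\<lambda>(z, e). basis c *v z + e)"

definition htil :: "('n::finite, 'd::finite) component \<Rightarrow> real \<Rightarrow> real" where
  "htil c t = (alpha t)\<^sup>2 * (noise c)\<^sup>2 + hvar t"

definition ld_dens :: "('n::finite, 'd::finite) component \<Rightarrow> real \<Rightarrow> real^'d \<Rightarrow> real" where
  "ld_dens c t y = (\<integral>z. gauss (alpha t *\<^sub>R z) (htil c t) y * latent c z \<partial>lborel)"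

definition fstar :: "('n::finite, 'd::finite) component \<Rightarrow> real^'d \<Rightarrow> real \<Rightarrow> real^'d" where
  "fstar c z t = htil c t *\<^sub>R grad (\<lambda>y. ln (ld_dens c t y)) z + z"

definition gfun :: "('n::finite, 'd::finite) component \<Rightarrow> real^'d \<Rightarrow> real \<Rightarrow> real^'d" where
  "gfun c y t = hvar t *\<^sub>R grad (\<lambda>y. ln (ld_dens c t y)) y + y"

definition rho :: "('n::finite, 'd::finite) component \<Rightarrow> real \<Rightarrow> real" where
  "rho c t = (alpha t)\<^sup>2 * (noise c)\<^sup>2 / htil c t"

definition Gfun :: "('n::finite, 'd::finite) component \<Rightarrow> real \<Rightarrow> real^'n \<Rightarrow> real^'n" where
  "Gfun c t x = basis c *v gfun c (transpose (basis c) *v x) t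
     + rho c t *\<^sub>R (proj_perp (basis c) *v x)"

definition well_formed_component :: "('n::finite, 'd::finite) component \<Rightarrow> bool" where
  "well_formed_component c \<longleftrightarrow>
     orthonormal_columns (basis c) \<and> noise c > 0 \<and>
     latent c \<in> borel_measurable borel \<and> (\<forall>z. 0 \<le> latent c z) \<and>
     prob_space (density lborel (\<lambda>z. ennreal (latent c z)))"

definition latent_lipschitz :: "real \<Rightarrow> real \<Rightarrow> ('n::finite, 'd::finite) component \<Rightarrow> bool" where
  "latent_lipschitz T \<beta> c \<longleftrightarrow> (\<forall>t\<in>{0..T}. \<beta>-lipschitz_on UNIV (\<lambda>z. fstar c z t))"

definition latent_smooth_tail :: "('n::finite, 'd::finite) component \<Rightarrow> bool" where
  "latent_smooth_tail c \<longleftrightarrow>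
     (\<forall>z. latent c z > 0) \<and> twice_cont_differentiable (latent c) \<and>
     (\<exists>B C1 C2. B > 0 \<and> C1 > 0 \<and> C2 > 0 \<and>
        (\<forall>z. norm z \<ge> B \<longrightarrow>
           latent c z \<le> (2 * pi) powr (- real CARD('d) / 2) * C1 * exp (- C2 * (norm z)\<^sup>2 / 2)))"

definition gfun_time_regular :: "real \<Rightarrow> real \<Rightarrow> ('n::finite, 'd::finite) component \<Rightarrow> bool" where
  "gfun_time_regular t0 T c \<longleftrightarrow>
     bdd_above ((\<lambda>t. norm (gfun c 0 t)) ` {t0..T}) \<and>
     (\<forall>y. \<forall>t\<in>{t0..T}. (\<lambda>s. gfun c y s) differentiable (at t within {t0..T})) \<and>
     (\<forall>R>0. bdd_above ((\<lambda>(y, t). norm (vector_derivative (\<lambda>s. gfun c y s) (at t within {t0..T})))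
        ` (cball 0 R \<times> {t0..T})))"


section \<open>Constants\<close>

definition second_moment_g :: "('n::finite, 'd::finite) component \<Rightarrow> real \<Rightarrow> real^'d^'d" where
  "second_moment_g c t = (\<chi> a b. \<integral>x. gfun c (transpose (basis c) *v x) t $ a *
       gfun c (transpose (basis c) *v x) t $ b \<partial>fwd_law (data_law c) t)"

definition cbar :: "real \<Rightarrow> real \<Rightarrow> ('n::finite, 'd::finite) component \<Rightarrow> real" where
  "cbar t0 T c = 1 / (T - t0) *
     (LINT t:{t0..T}|lborel. lambda_max (second_moment_g c t) / (hvar t)\<^sup>2)"

definition nbar :: "real \<Rightarrow> real \<Rightarrow> ('n::finite, 'd::finite) component \<Rightarrow> real" where
  "nbar t0 T c = 1 / (T - t0) *
     (LINT t:{t0..T}|lborel. (alpha t) ^ 4 * (noise c) ^ 4 / ((hvar t)\<^sup>2 * htil c t))"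

text \<open>The norm on \<open>real^'d^'n\<close> is the Frobenius norm.\<close>

definition Gamma_term :: "real \<Rightarrow> real \<Rightarrow> real \<Rightarrow> real \<Rightarrow> ('n::finite, 'd1::finite) component \<Rightarrow>
    ('n, 'd2::finite) component \<Rightarrow> real^'m^'n \<Rightarrow> real" where
  "Gamma_term t0 T w1 w2 c1 c2 U =
     w1 * cbar t0 T c1 * (norm (proj_perp U ** basis c1))\<^sup>2 +
     w2 * cbar t0 T c2 * (norm (proj_perp U ** basis c2))\<^sup>2"

definition M_mix :: "real \<Rightarrow> real \<Rightarrow> real \<Rightarrow> real \<Rightarrow> ('n::finite, 'd1::finite) component \<Rightarrow>
    ('n, 'd2::finite) component \<Rightarrow> real^'n^'n" where
  "M_mix t0 T w1 w2 c1 c2 =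
     (w1 * cbar t0 T c1) *\<^sub>R (basis c1 ** transpose (basis c1)) +
     (w2 * cbar t0 T c2) *\<^sub>R (basis c2 ** transpose (basis c2))"


section \<open>ReLU networks\<close>

text \<open>Layer \<open>l\<close> maps \<open>n (l - 1)\<close> units to \<open>n l\<close> units by the weights \<open>W l j k\<close> (row \<open>j\<close>,
  column \<open>k\<close>) and biases \<open>b l j\<close>, indices starting at 0; only entries with \<open>j < n l\<close> and
  \<open>k < n (l - 1)\<close> are meaningful.\<close>

definition affine_layer :: "(nat \<Rightarrow> nat) \<Rightarrow> (nat \<Rightarrow> nat \<Rightarrow> nat \<Rightarrow> real) \<Rightarrow> (nat \<Rightarrow> nat \<Rightarrow> real) \<Rightarrow>
    nat \<Rightarrow> (nat \<Rightarrow> real) \<Rightarrow> nat \<Rightarrow> real" where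
  "affine_layer n W b l x j = (\<Sum>k<n (l - 1). W l j k * x k) + b l j"

primrec hidden :: "(nat \<Rightarrow> nat) \<Rightarrow> (nat \<Rightarrow> nat \<Rightarrow> nat \<Rightarrow> real) \<Rightarrow> (nat \<Rightarrow> nat \<Rightarrow> real) \<Rightarrow>
    nat \<Rightarrow> (nat \<Rightarrow> real) \<Rightarrow> nat \<Rightarrow> real" where
  "hidden n W b 0 x = x"
| "hidden n W b (Suc l) x = (\<lambda>j. max 0 (affine_layer n W b (Suc l) (hidden n W b l x) j))"

text \<open>The input \<open>[z, t]\<close> is \<open>z\<close> listed along the enumeration \<open>from_nat_into UNIV\<close> of the
  coordinates, with \<open>t\<close> in position \<open>CARD('m)\<close>; outputs are read back through the same
  enumeration. The class below does not depend on the choice of enumeration.\<close>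

definition net_input :: "real^'m \<Rightarrow> real \<Rightarrow> nat \<Rightarrow> real" where
  "net_input z t k = (if k < CARD('m) then z $ from_nat_into UNIV k else t)"

definition relu_net :: "nat \<Rightarrow> (nat \<Rightarrow> nat) \<Rightarrow> (nat \<Rightarrow> nat \<Rightarrow> nat \<Rightarrow> real) \<Rightarrow> (nat \<Rightarrow> nat \<Rightarrow> real) \<Rightarrow>
    real^'m \<Rightarrow> real \<Rightarrow> real^'m" where
  "relu_net L n W b z t =
     (\<chi> i. affine_layer n W b L (hidden n W b (L - 1) (net_input z t)) (to_nat_on UNIV i))"

definition relu_class :: "real \<Rightarrow> nat \<Rightarrow> nat \<Rightarrow> nat \<Rightarrow> real \<Rightarrow> real \<Rightarrow> real \<Rightarrow> real \<Rightarrow>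
    (real^'m \<Rightarrow> real \<Rightarrow> real^'m) set" where
  "relu_class T L M J K \<kappa> \<gamma> \<gamma>\<^sub>t = {f. \<exists>n W b.
      1 \<le> L \<and> n 0 = CARD('m) + 1 \<and> n L = CARD('m) \<and> (\<forall>l\<in>{1..<L}. n l \<in> {1..M}) \<and>
      f = relu_net L n W b \<and>
      (\<forall>l\<in>{1..L}. \<forall>j<n l. \<bar>b l j\<bar> \<le> \<kappa> \<and> (\<forall>k<n (l - 1). \<bar>W l j k\<bar> \<le> \<kappa>)) \<and>
      (\<Sum>l=1..L. card {(j, k). j < n l \<and> k < n (l - 1) \<and> W l j k \<noteq> 0} +
                 card {j. j < n l \<and> b l j \<noteq> 0}) \<le> J \<and>
      (\<forall>z. \<forall>t\<in>{0..T}. norm (f z t) \<le> K) \<and>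
      (\<forall>t\<in>{0..T}. \<forall>z1 z2. norm (f z1 t - f z2 t) \<le> \<gamma> * norm (z1 - z2)) \<and>
      (\<forall>z. \<forall>t1\<in>{0..T}. \<forall>t2\<in>{0..T}. norm (f z t1 - f z t2) \<le> \<gamma>\<^sub>t * \<bar>t1 - t2\<bar>)}"


section \<open>Risk, comparators and error terms\<close>

text \<open>Averages over \<open>[t\<^sub>0, T]\<close> of expectations of squares are taken in \<open>ennreal\<close>, so that they
  are meaningful without integrability side conditions.\<close>

definition time_avg :: "real \<Rightarrow> real \<Rightarrow> (real \<Rightarrow> ennreal) \<Rightarrow> ennreal" where
  "time_avg t0 T F = ennreal (1 / (T - t0)) * (\<integral>\<^sup>+t\<in>{t0..T}. F t \<partial>lborel)"

definition mix_law :: "real \<Rightarrow> real \<Rightarrow> ('n::finite, 'd1::finite) component \<Rightarrow>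
    ('n, 'd2::finite) component \<Rightarrow> (real^'n) measure" where
  "mix_law w1 w2 c1 c2 = mixture w1 w2 (data_law c1) (data_law c2)"

definition score_class :: "(real^'m \<Rightarrow> real \<Rightarrow> real^'m) set \<Rightarrow> real^'m^'n \<Rightarrow>
    (real^'n \<Rightarrow> real \<Rightarrow> real^'n) set" where
  "score_class \<F> U =
     (\<lambda>f x t. (1 / hvar t) *\<^sub>R (U *v f (transpose U *v x) t) - (1 / hvar t) *\<^sub>R x) ` \<F>"

definition L_mix :: "real \<Rightarrow> real \<Rightarrow> real \<Rightarrow> real \<Rightarrow> ('n::finite, 'd1::finite) component \<Rightarrow>
    ('n, 'd2::finite) component \<Rightarrow> (real^'n \<Rightarrow> real \<Rightarrow> real^'n) \<Rightarrow> ennreal" where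
  "L_mix t0 T w1 w2 c1 c2 s = time_avg t0 T (\<lambda>t.
     \<integral>\<^sup>+x. ennreal ((norm (s x t - grad (\<lambda>x. ln (fwd_dens (mix_law w1 w2 c1 c2) t x)) x))\<^sup>2)
       \<partial>fwd_law (mix_law w1 w2 c1 c2) t)"

definition B_mix :: "real \<Rightarrow> real \<Rightarrow> real \<Rightarrow> real \<Rightarrow> ('n::finite, 'd1::finite) component \<Rightarrow>
    ('n, 'd2::finite) component \<Rightarrow> (real^'m \<Rightarrow> real \<Rightarrow> real^'m) set \<Rightarrow> real^'m^'n \<Rightarrow> ennreal" where
  "B_mix t0 T w1 w2 c1 c2 \<F> U = (INF s\<in>score_class \<F> U. L_mix t0 T w1 w2 c1 c2 s)"

definition pi_fst :: "real \<Rightarrow> real \<Rightarrow> ('n::finite, 'd1::finite) component \<Rightarrow>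
    ('n, 'd2::finite) component \<Rightarrow> real^'n \<Rightarrow> real \<Rightarrow> real" where
  "pi_fst w1 w2 c1 c2 x t =
     w1 * fwd_dens (data_law c1) t x / fwd_dens (mix_law w1 w2 c1 c2) t x"

text \<open>The density of the projected process only enters under integrals against its own law, so
  any version may be used.\<close>

definition qdens :: "('n::finite, 'd::finite) component \<Rightarrow> real^'m^'n \<Rightarrow> real \<Rightarrow> real^'m \<Rightarrow> real" where
  "qdens c U t z = enn2real
     (RN_deriv lborel (distr (fwd_law (data_law c) t) borel (\<lambda>x. transpose U *v x)) z)"

definition piU_fst :: "real \<Rightarrow> real \<Rightarrow> ('n::finite, 'd1::finite) component \<Rightarrow>
    ('n, 'd2::finite) component \<Rightarrow> real^'m^'n \<Rightarrow> real^'m \<Rightarrow> real \<Rightarrow> real" where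
  "piU_fst w1 w2 c1 c2 U z t =
     w1 * qdens c1 U t z / (w1 * qdens c1 U t z + w2 * qdens c2 U t z)"

definition piU_snd :: "real \<Rightarrow> real \<Rightarrow> ('n::finite, 'd1::finite) component \<Rightarrow>
    ('n, 'd2::finite) component \<Rightarrow> real^'m^'n \<Rightarrow> real^'m \<Rightarrow> real \<Rightarrow> real" where
  "piU_snd w1 w2 c1 c2 U z t =
     w2 * qdens c2 U t z / (w1 * qdens c1 U t z + w2 * qdens c2 U t z)"

definition psi :: "('n::finite, 'd::finite) component \<Rightarrow> real^'m^'n \<Rightarrow> real^'m \<Rightarrow> real \<Rightarrow> real^'m" where
  "psi c U z t = (let H = transpose U ** basis c in H *v gfun c (pinv H *v z) t)"

definition f_comp :: "real \<Rightarrow> real \<Rightarrow> ('n::finite, 'd1::finite) component \<Rightarrow>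
    ('n, 'd2::finite) component \<Rightarrow> real^'m^'n \<Rightarrow> real^'m \<Rightarrow> real \<Rightarrow> real^'m" where
  "f_comp w1 w2 c1 c2 U z t =
     piU_fst w1 w2 c1 c2 U z t *\<^sub>R psi c1 U z t + piU_snd w1 w2 c1 c2 U z t *\<^sub>R psi c2 U z t"

definition A_mix :: "real \<Rightarrow> real \<Rightarrow> real \<Rightarrow> real \<Rightarrow> ('n::finite, 'd1::finite) component \<Rightarrow>
    ('n, 'd2::finite) component \<Rightarrow> (real^'m \<Rightarrow> real \<Rightarrow> real^'m) \<Rightarrow> real^'m^'n \<Rightarrow> ennreal" where
  "A_mix t0 T w1 w2 c1 c2 f U = time_avg t0 T (\<lambda>t. ennreal (1 / (hvar t)\<^sup>2) *
     (\<integral>\<^sup>+x. ennreal ((norm (f (transpose U *v x) t - f_comp w1 w2 c1 c2 U (transpose U *v x) t))\<^sup>2)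
        \<partial>fwd_law (mix_law w1 w2 c1 c2) t))"

definition R_term :: "real \<Rightarrow> real \<Rightarrow> ('n::finite, 'd::finite) component \<Rightarrow> real^'m^'n \<Rightarrow> ennreal" where
  "R_term t0 T c U = time_avg t0 T (\<lambda>t. ennreal (1 / (hvar t)\<^sup>2) *
     (\<integral>\<^sup>+x. ennreal ((norm (psi c U (transpose U *v x) t - transpose U *v Gfun c t x))\<^sup>2)
        \<partial>fwd_law (data_law c) t))"

definition P_term :: "real \<Rightarrow> real \<Rightarrow> real \<Rightarrow> real \<Rightarrow> ('n::finite, 'd1::finite) component \<Rightarrow>
    ('n, 'd2::finite) component \<Rightarrow> real^'m^'n \<Rightarrow> ennreal" where
  "P_term t0 T w1 w2 c1 c2 U = time_avg t0 T (\<lambda>t. ennreal (1 / (hvar t)\<^sup>2) *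
     (\<integral>\<^sup>+x. ennreal ((piU_fst w1 w2 c1 c2 U (transpose U *v x) t - pi_fst w1 w2 c1 c2 x t)\<^sup>2 *
            (norm (psi c1 U (transpose U *v x) t - psi c2 U (transpose U *v x) t))\<^sup>2)
        \<partial>fwd_law (mix_law w1 w2 c1 c2) t))"

end

theory Submission
  imports Defs
begin

text \<open>
  By Gaussian convolution the density of \<open>X\<^sub>t\<close> under the \<open>i\<close>-th component is a function of
  \<open>A\<^sub>i\<^sup>T x\<close> times a Gaussian in \<open>P\<^sub>i\<^sup>\<bottom> x\<close>, so its score is \<open>(G\<^sub>i(x) - x) / h\<close>, and Bayes' rule gives the
  mixture score \<open>(\<pi>\<^sub>1 G\<^sub>1 + \<pi>\<^sub>2 G\<^sub>2 - x) / h\<close>. The error of \<open>(U f(U\<^sup>T x) - x) / h\<close> then splits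
  orthogonally along the range of \<open>U\<close>. The part inside the range is compared with \<open>f\<^sup>c\<^sup>o\<^sup>m\<^sup>p\<close> by Young's
  inequality with parameter \<open>\<eta>\<close> and by convexity of the squared norm; the part outside is at most the \<open>\<pi>\<close>-average
  of \<open>\<parallel>P\<^sub>U\<^sup>\<bottom> G\<^sub>i\<parallel>\<^sup>2\<close>. Under the \<open>i\<close>-th component the two summands of \<open>P\<^sub>U\<^sup>\<bottom> G\<^sub>i\<close> are uncorrelated, and their second
  moments yield the \<open>\<Gamma>\<close> term and the trace term.
\<close>

text \<open>The comparator weighs the components by the posterior given \<open>U^T x\<close>, the
  score by the posterior given \<open>x\<close>. Since each pair of weights sums to 1, exchanging
  one pair for the other costs exactly (pi_1^U - pi_1)(psi_1 - psi_2): this is the origin of the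
  posterior term. The factors 2 come from separating this cost from the reconstruction errors by |a
  + b|^2 \<le> 2|a|^2 + 2|b|^2. Bayes' rule in the form p_mix pi_i = w_i p_i then turns pi-averages
  under the mixture into expectations under the single components. The obstacle is
  measure-theoretic. A time average of a sum splits only for integrands that are measurable in
  \<open>t\<close>, whereas the projected posteriors are built from Radon-Nikodym derivatives chosen
  separately at every time, and the denoisers from gradients given by a definite description.
  Moreover \<open>cbar\<close> is a Bochner integral, which would default to 0 on a non-integrable
  function and so void the bound, while all the error terms live in \<open>ennreal\<close>. Hence
  the largest eigenvalue has to be shown measurable and bounded in \<open>t\<close>.\<close>

declare transpose_matrix_vector [simp del]

section \<open>Adjoints and isometries\<close>

lemma inner_transpose_matrix: "(transpose A *v x) \<bullet> y = x \<bullet> (A *v y)"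
  for A :: "real^'m^'n"
  by (simp add: transpose_matrix_vector dot_lmul_matrix)

lemma transpose_orthonormal_columns:
  "orthonormal_columns U \<Longrightarrow> transpose U *v (U *v w) = w"
  by (simp add: orthonormal_columns_def matrix_vector_mul_assoc)

lemma norm_orthonormal_columns:
  assumes "orthonormal_columns U"
  shows "norm (U *v w) = norm w"
  using inner_transpose_matrix[of U "U *v w" w]
  by (simp add: norm_eq_sqrt_inner transpose_orthonormal_columns[OF assms])

section \<open>Gaussian integrals\<close>

lemma borel_measurable_matrix_vector_mult [measurable]:
  fixes A :: "real^'m^'n"
  assumes "f \<in> borel_measurable M"
  shows "(\<lambda>x. A *v f x) \<in> borel_measurable M"
  by (rule borel_measurable_continuous_on[OF _ assms])
    (intro linear_continuous_on linear_conv_bounded_linear[THEN iffD1] matrix_vector_mul_linear)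

lemma gauss_pos: "0 < v \<Longrightarrow> 0 < gauss \<mu> v x"
  by (simp add: gauss_def)

lemma borel_measurable_gauss [measurable]:
  fixes f g :: "'b \<Rightarrow> 'a::euclidean_space"
  assumes [measurable]: "f \<in> borel_measurable M" "v \<in> borel_measurable M" "g \<in> borel_measurable M"
  shows "(\<lambda>x. gauss (f x) (v x) (g x)) \<in> borel_measurable M"
  unfolding gauss_def by measurable

text \<open>Reduces mass and moments to one-dimensional normal integrals. The square root appears
  because \<open>gauss\<close> is parametrised by the variance and \<open>normal_density\<close> by
  the standard deviation.\<close>

lemma gauss_eq_prod_normal_density:
  fixes x :: "'a::euclidean_space"
  assumes v: "0 < v"
  shows "gauss \<mu> v x = (\<Prod>b\<in>Basis. normal_density (\<mu> \<bullet> b) (sqrt v) (x \<bullet> b))"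
proof -
  have n: "(norm (x - \<mu>))\<^sup>2 = (\<Sum>b\<in>Basis. (x \<bullet> b - \<mu> \<bullet> b)\<^sup>2)"
    unfolding power2_norm_eq_inner euclidean_inner[of "x - \<mu>" "x - \<mu>"]
    by (simp add: inner_diff_left power2_eq_square)
  have "(2 * pi * v) powr (- real DIM('a) / 2) = (1 / sqrt (2 * pi * v)) ^ DIM('a)"
    using v by (simp add: powr_minus powr_half_sqrt[symmetric] powr_realpow[symmetric] powr_powr
        power_one_over divide_simps)
  moreover have "exp (- (norm (x - \<mu>))\<^sup>2 / (2 * v)) = (\<Prod>b\<in>Basis. exp (- (x \<bullet> b - \<mu> \<bullet> b)\<^sup>2 / (2 * v)))"
    by (simp add: n exp_sum[symmetric] sum_divide_distrib[symmetric] sum_negf)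
  ultimately show ?thesis
    using v by (simp add: gauss_def normal_density_def prod.distrib prod_dividef prod_constant power_one_over
        del: prod_constant flip: prod_constant)
qed

lemma nn_integral_gauss:
  fixes \<mu> :: "'a::euclidean_space"
  assumes v: "0 < v"
  shows "(\<integral>\<^sup>+x. ennreal (gauss \<mu> v x) \<partial>lborel) = 1"
proof -
  have "(\<integral>\<^sup>+x. ennreal (gauss \<mu> v x) \<partial>lborel)
      = (\<integral>\<^sup>+x. (\<Prod>b\<in>Basis. ennreal (normal_density (\<mu> \<bullet> b) (sqrt v) (x \<bullet> b))) \<partial>lborel)"
    by (simp add: gauss_eq_prod_normal_density[OF v] prod_ennreal)
  also have "\<dots> = (\<Prod>b\<in>Basis. (\<integral>\<^sup>+x. ennreal (normal_density (\<mu> \<bullet> b) (sqrt v) x) \<partial>lborel))"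
    by (subst nn_integral_lborel_prod) auto
  also have "\<dots> = 1"
    using v by (simp add: nn_integral_eq_integral)
  finally show ?thesis .
qed

lemma nn_integral_lborel_translation:
  fixes c :: "'a::euclidean_space"
  assumes [measurable]: "f \<in> borel_measurable borel"
  shows "(\<integral>\<^sup>+x. f (x + c) \<partial>lborel) = (\<integral>\<^sup>+x. f x \<partial>lborel)"
proof -
  have "(\<integral>\<^sup>+x. f x \<partial>lborel) = (\<integral>\<^sup>+x. f x \<partial>distr lborel borel ((+) c))"
    by (simp add: lborel_distr_plus)
  also have "\<dots> = (\<integral>\<^sup>+x. f (x + c) \<partial>lborel)"
    by (subst nn_integral_distr) (auto simp: add.commute)
  finally show ?thesis by simp
qed

text \<open>Translation by \<open>Uw\<close> leaves Lebesgue measure invariant for each \<open>w\<close>; averaging the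
  translated integrals against a Gaussian weight in \<open>w\<close> produces a density of the image law.\<close>

lemma nn_integral_isometry_adjoint:
  fixes U :: "real^'m^'n" and F :: "real^'m \<Rightarrow> ennreal" and p :: "real^'n \<Rightarrow> ennreal"
  assumes U: "orthonormal_columns U"
    and [measurable]: "F \<in> borel_measurable borel" "p \<in> borel_measurable borel"
  shows "(\<integral>\<^sup>+x. p x * F (transpose U *v x) \<partial>lborel) =
    (\<integral>\<^sup>+w. F w * (\<integral>\<^sup>+x. p (proj_perp U *v x + U *v w) * ennreal (gauss 0 1 (w - transpose U *v x)) \<partial>lborel)
       \<partial>lborel)"
proof -
  let ?k = "\<lambda>w::real^'m. ennreal (gauss 0 1 w)"
  have UU: "transpose U *v (U *v w) = w" for w
    using U by (rule transpose_orthonormal_columns)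
  have pp: "proj_perp U *v x = x - U *v (transpose U *v x)" for x
    by (simp add: proj_perp_def proj_def matrix_vector_mult_diff_rdistrib matrix_vector_mul_assoc)
  have "(\<integral>\<^sup>+x. p x * F (transpose U *v x) \<partial>lborel)
      = (\<integral>\<^sup>+w. (\<integral>\<^sup>+x. p x * F (transpose U *v x) \<partial>lborel) * ?k w \<partial>(lborel :: (real^'m) measure))"
    by (simp add: nn_integral_cmult nn_integral_gauss)
  also have "\<dots> = (\<integral>\<^sup>+w. (\<integral>\<^sup>+x. p (x + U *v w) * F (transpose U *v x + w) * ?k w \<partial>lborel) \<partial>lborel)"
  proof (rule nn_integral_cong)
    fix w
    have "(\<integral>\<^sup>+x. p x * F (transpose U *v x) \<partial>lborel) = (\<integral>\<^sup>+x. p (x + U *v w) * F (transpose U *v (x + U *v w)) \<partial>lborel)"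
      by (subst nn_integral_lborel_translation[where c = "U *v w", symmetric]) simp_all
    also have "\<dots> = (\<integral>\<^sup>+x. p (x + U *v w) * F (transpose U *v x + w) \<partial>lborel)"
      by (simp add: matrix_vector_right_distrib UU)
    finally show "(\<integral>\<^sup>+x. p x * F (transpose U *v x) \<partial>lborel) * ?k w
        = (\<integral>\<^sup>+x. p (x + U *v w) * F (transpose U *v x + w) * ?k w \<partial>lborel)"
      by (simp add: nn_integral_multc)
  qed
  also have "\<dots> = (\<integral>\<^sup>+x. (\<integral>\<^sup>+w. p (x + U *v w) * F (transpose U *v x + w) * ?k w \<partial>lborel) \<partial>lborel)"
    by (rule lborel_pair.Fubini') measurable
  \<comment> \<open>Shifting \<open>w\<close> by \<open>- U^T x\<close> frees the argument of
    \<open>F\<close> from \<open>x\<close>, and \<open>x + U w\<close> becomes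
    \<open>P^perp x + U w\<close>.\<close>
  also have "\<dots> = (\<integral>\<^sup>+x. (\<integral>\<^sup>+w. p (proj_perp U *v x + U *v w) * F w * ?k (w - transpose U *v x) \<partial>lborel) \<partial>lborel)"
  proof (rule nn_integral_cong)
    fix x
    show "(\<integral>\<^sup>+w. p (x + U *v w) * F (transpose U *v x + w) * ?k w \<partial>lborel)
       = (\<integral>\<^sup>+w. p (proj_perp U *v x + U *v w) * F w * ?k (w - transpose U *v x) \<partial>lborel)"
      by (subst nn_integral_lborel_translation[where c = "- (transpose U *v x)", symmetric])
        (simp_all add: pp matrix_vector_mult_diff_distrib algebra_simps)
  qed
  also have "\<dots> = (\<integral>\<^sup>+w. (\<integral>\<^sup>+x. p (proj_perp U *v x + U *v w) * F w * ?k (w - transpose U *v x) \<partial>lborel) \<partial>lborel)"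
    by (rule lborel_pair.Fubini') measurable
  also have "\<dots> = (\<integral>\<^sup>+w. F w * (\<integral>\<^sup>+x. p (proj_perp U *v x + U *v w) * ?k (w - transpose U *v x) \<partial>lborel) \<partial>lborel)"
    by (subst nn_integral_cmult[symmetric]) (auto intro!: nn_integral_cong simp: ac_simps)
  finally show ?thesis .
qed

text \<open>Rotation invariance follows from the previous identity for
  \<open>U = transpose R\<close> with constant weight: the complementary projection is then 0, and
  the inner integral is that of a Gaussian density in \<open>x\<close>.\<close>

lemma nn_integral_orthogonal_matrix:
  fixes R :: "real^'n^'n"
  assumes R: "orthogonal_matrix R" and [measurable]: "F \<in> borel_measurable borel"
  shows "(\<integral>\<^sup>+x. F (R *v x) \<partial>lborel) = (\<integral>\<^sup>+x. F x \<partial>lborel)"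
proof -
  have oc: "orthonormal_columns (transpose R)"
    using R by (simp add: orthonormal_columns_def orthogonal_matrix_def)
  have p0: "proj_perp (transpose R) = 0"
    using R by (simp add: proj_perp_def proj_def orthogonal_matrix_def)
  have k: "gauss 0 1 (w - R *v x) = gauss (transpose R *v w) 1 x" for w x
  proof -
    have "norm (w - R *v x) = norm (R *v (transpose R *v w - x))"
      using R by (simp add: matrix_vector_mult_diff_distrib matrix_vector_mul_assoc orthogonal_matrix_def)
    also have "\<dots> = norm (x - transpose R *v w)"
      using R by (subst norm_orthonormal_columns)
        (simp_all add: orthonormal_columns_def orthogonal_matrix_def norm_minus_commute)
    finally show ?thesis by (simp add: gauss_def)
  qed
  have "(\<integral>\<^sup>+x. F (R *v x) \<partial>lborel) = (\<integral>\<^sup>+w. F w * (\<integral>\<^sup>+x. ennreal (gauss 0 1 (w - R *v x)) \<partial>lborel) \<partial>lborel)"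
    using nn_integral_isometry_adjoint[OF oc, of F "\<lambda>_. 1"] by (simp add: p0)
  also have "\<dots> = (\<integral>\<^sup>+x. F x \<partial>lborel)"
    by (simp add: k nn_integral_gauss)
  finally show ?thesis .
qed

lemma nn_integral_normal_second_moment:
  assumes "0 < v"
  shows "(\<integral>\<^sup>+x. ennreal (x\<^sup>2 * normal_density 0 (sqrt v) x) \<partial>lborel) = ennreal v"
proof -
  have "has_bochner_integral lborel (\<lambda>x. x\<^sup>2 * normal_density 0 (sqrt v) x) v"
    using normal_moment_even[of "sqrt v" 0 1] assms by (simp add: mult.commute)
  then show ?thesis
    by (intro nn_integral_eq_integral[THEN trans]) (auto simp: has_bochner_integral_iff)
qed

text \<open>A rotation carrying \<open>norm c\<close> times a basis vector \<open>e\<close> to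
  \<open>c\<close> leaves the centred Gaussian unchanged. The integrand then factors over the
  coordinates, with an extra square in the coordinate \<open>e\<close> only.\<close>

lemma nn_integral_gauss_inner_squared_centered:
  fixes c :: "real^'n"
  assumes v: "0 < v"
  shows "(\<integral>\<^sup>+x. ennreal ((c \<bullet> x)\<^sup>2 * gauss 0 v x) \<partial>lborel) = ennreal (v * (norm c)\<^sup>2)"
proof -
  define e where "e = (axis undefined 1 :: real^'n)"
  have e: "e \<in> Basis" "norm e = 1" by (auto simp: e_def axis_in_Basis_iff)
  have "norm (norm c *\<^sub>R e) = norm c" by (simp add: e)
  then obtain f where f: "orthogonal_transformation f" "f (norm c *\<^sub>R e) = c"
    using orthogonal_transformation_exists by metis
  define R where "R = matrix f"
  have R: "orthogonal_matrix R" "\<And>x. R *v x = f x"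
    using f(1) by (auto simp: R_def orthogonal_transformation_matrix matrix_works orthogonal_transformation_linear)
  have rot: "c \<bullet> f x = norm c * (x \<bullet> e)" for x
  proof -
    have "c \<bullet> f x = f (norm c *\<^sub>R e) \<bullet> f x" using f(2) by simp
    also have "\<dots> = (norm c *\<^sub>R e) \<bullet> x" using f(1) by (simp add: orthogonal_transformation_def)
    finally show ?thesis by (simp add: inner_commute)
  qed
  have nf: "norm (f x) = norm x" for x using f(1) by (rule orthogonal_transformation_norm)
  have "(\<integral>\<^sup>+x. ennreal ((c \<bullet> x)\<^sup>2 * gauss 0 v x) \<partial>lborel) = (\<integral>\<^sup>+x. ennreal ((c \<bullet> (R *v x))\<^sup>2 * gauss 0 v (R *v x)) \<partial>lborel)"
    by (subst nn_integral_orthogonal_matrix[OF R(1), symmetric]) auto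
  also have "\<dots> = (\<integral>\<^sup>+x. ennreal ((norm c)\<^sup>2) * ennreal ((x \<bullet> e)\<^sup>2 * gauss 0 v x) \<partial>lborel)"
    by (simp add: R rot gauss_def nf power_mult_distrib mult.assoc ennreal_mult'[symmetric])
  also have "\<dots> = ennreal ((norm c)\<^sup>2) * (\<integral>\<^sup>+x. ennreal ((x \<bullet> e)\<^sup>2 * gauss 0 v x) \<partial>lborel)"
    by (subst nn_integral_cmult) auto
  also have "(\<integral>\<^sup>+x. ennreal ((x \<bullet> e)\<^sup>2 * gauss 0 v x) \<partial>lborel) = (\<integral>\<^sup>+x. (\<Prod>b\<in>Basis.
       ennreal ((if b = e then (x \<bullet> b)\<^sup>2 else 1) * normal_density 0 (sqrt v) (x \<bullet> b))) \<partial>lborel)"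
  proof (rule nn_integral_cong)
    fix x :: "real^'n"
    have "(\<Prod>b\<in>Basis. (if b = e then (x \<bullet> b)\<^sup>2 else 1) * normal_density 0 (sqrt v) (x \<bullet> b)) = (x \<bullet> e)\<^sup>2 * gauss 0 v x"
      unfolding prod.distrib using e by (simp add: gauss_eq_prod_normal_density[OF v] prod.delta)
    then show "ennreal ((x \<bullet> e)\<^sup>2 * gauss 0 v x) =
        (\<Prod>b\<in>Basis. ennreal ((if b = e then (x \<bullet> b)\<^sup>2 else 1) * normal_density 0 (sqrt v) (x \<bullet> b)))"
      by (subst prod_ennreal) auto
  qed
  also have "\<dots> = (\<Prod>b\<in>(Basis::(real^'n) set). (\<integral>\<^sup>+x. ennreal ((if b = e then x\<^sup>2 else 1) * normal_density 0 (sqrt v) x) \<partial>lborel))"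
    by (subst nn_integral_lborel_prod[where f="\<lambda>b x. ennreal ((if b = e then x\<^sup>2 else 1) * normal_density 0 (sqrt v) x)"]) auto
  also have "\<dots> = (\<Prod>b\<in>(Basis::(real^'n) set). if b = e then ennreal v else 1)"
    using v by (intro prod.cong) (auto simp: nn_integral_normal_second_moment nn_integral_eq_integral)
  also have "\<dots> = ennreal v" using e by (simp add: prod.delta')
  finally show ?thesis using v by (simp add: ennreal_mult'[symmetric] mult.commute)
qed

text \<open>After centring, the cross term is odd. The reflection \<open>x\<close> to
  \<open>- x\<close> shows that the shifts by \<open>c . \<mu>\<close> and
  \<open>- (c . \<mu>)\<close> give the same integral, and adding the two cancels the cross term
  before integration, so nothing is subtracted in \<open>ennreal\<close>.\<close>

lemma nn_integral_gauss_inner_squared: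
  fixes c :: "real^'n"
  assumes v: "0 < v"
  shows "(\<integral>\<^sup>+x. ennreal ((c \<bullet> x)\<^sup>2 * gauss \<mu> v x) \<partial>lborel) = ennreal (v * (norm c)\<^sup>2 + (c \<bullet> \<mu>)\<^sup>2)"
proof -
  let ?I = "\<lambda>s::real. \<integral>\<^sup>+x. ennreal ((c \<bullet> x + s * (c \<bullet> \<mu>))\<^sup>2 * gauss 0 v x) \<partial>lborel"
  have mv: "(- mat 1) *v x = - x" for x :: "real^'n"
    using matrix_vector_mult_diff_rdistrib[of 0 "mat 1" x] by simp
  have om: "orthogonal_matrix (- mat 1 :: real^'n^'n)"
  proof -
    have "transpose (- mat 1 :: real^'n^'n) = - mat 1"
      by (auto simp: transpose_def mat_def vec_eq_iff)
    then show ?thesis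
      by (simp add: orthogonal_matrix matrix_eq mv flip: matrix_vector_mul_assoc)
  qed
  have sym: "?I (-1) = ?I 1"
    by (subst nn_integral_orthogonal_matrix[of "- mat 1", symmetric])
      (auto simp: om mv gauss_def power2_commute[of "c \<bullet> \<mu>"])
  have pt: "ennreal ((p + 1 * q)\<^sup>2 * g) + ennreal ((p + -1 * q)\<^sup>2 * g)
      = ennreal 2 * ennreal (p\<^sup>2 * g) + ennreal (2 * q\<^sup>2) * ennreal g" if "0 \<le> g" for p q g :: real
  proof -
    have "ennreal ((p + 1 * q)\<^sup>2 * g) + ennreal ((p + -1 * q)\<^sup>2 * g)
        = ennreal ((p + 1 * q)\<^sup>2 * g + (p + -1 * q)\<^sup>2 * g)"
      using that by (intro ennreal_plus[symmetric]) auto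
    also have "(p + 1 * q)\<^sup>2 * g + (p + -1 * q)\<^sup>2 * g = 2 * (p\<^sup>2 * g) + 2 * q\<^sup>2 * g"
      by (simp add: power2_eq_square algebra_simps)
    also have "ennreal \<dots> = ennreal 2 * ennreal (p\<^sup>2 * g) + ennreal (2 * q\<^sup>2) * ennreal g"
      using that by (subst ennreal_plus) (simp_all add: ennreal_mult)
    finally show ?thesis .
  qed
  have "?I 1 + ?I (-1) = (\<integral>\<^sup>+x. ennreal 2 * ennreal ((c \<bullet> x)\<^sup>2 * gauss 0 v x) + ennreal (2 * (c \<bullet> \<mu>)\<^sup>2) * ennreal (gauss 0 v x) \<partial>lborel)"
    by (subst nn_integral_add[symmetric])
      (auto intro!: nn_integral_cong pt[simplified] simp: gauss_nonneg)
  also have "\<dots> = ennreal 2 * ennreal (v * (norm c)\<^sup>2) + ennreal (2 * (c \<bullet> \<mu>)\<^sup>2)"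
    using v by (subst nn_integral_add)
       (auto simp: nn_integral_cmult nn_integral_gauss nn_integral_gauss_inner_squared_centered)
  also have "\<dots> = 2 * ennreal (v * (norm c)\<^sup>2 + (c \<bullet> \<mu>)\<^sup>2)"
    using v by (simp add: distrib_left ennreal_mult')
  finally have "2 * ?I 1 = 2 * ennreal (v * (norm c)\<^sup>2 + (c \<bullet> \<mu>)\<^sup>2)"
    unfolding sym mult_2[of "?I 1"] .
  then have "?I 1 = ennreal (v * (norm c)\<^sup>2 + (c \<bullet> \<mu>)\<^sup>2)"
    by (simp add: ennreal_mult_cancel_left)
  moreover have "(\<integral>\<^sup>+x. ennreal ((c \<bullet> x)\<^sup>2 * gauss \<mu> v x) \<partial>lborel) = ?I 1"
    by (subst nn_integral_lborel_translation[where c = \<mu>, symmetric])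
       (auto simp: inner_add_right gauss_def)
  ultimately show ?thesis by simp
qed

text \<open>Completing the square in \<open>e\<close> writes the joint density as the marginal
  density of \<open>x\<close> times the conditional density of \<open>e\<close>, and the latter
  integrates to 1.\<close>

lemma nn_integral_gauss_convolution:
  fixes x \<mu> :: "'a::euclidean_space"
  assumes h: "0 < h" and s: "0 < s"
  shows "(\<integral>\<^sup>+e. ennreal (gauss (a *\<^sub>R (\<mu> + e)) h x) * ennreal (gauss 0 s e) \<partial>lborel)
    = ennreal (gauss (a *\<^sub>R \<mu>) (a\<^sup>2 * s + h) x)"
proof -
  \<comment> \<open>\<open>H\<close> is the variance of the marginal; \<open>m\<close> and
    \<open>r\<close> are mean and variance of \<open>e\<close> conditionally on \<open>x\<close>, so
    that \<open>1 / r\<close> is the sum of the precisions \<open>a^2 / h\<close> and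
    \<open>1 / s\<close>.\<close>
  define H r m where "H = a\<^sup>2 * s + h" and "r = h * s / H" and "m = (a * s / H) *\<^sub>R (x - a *\<^sub>R \<mu>)"
  have H: "0 < H" and r: "0 < r" using h s by (auto simp: H_def r_def add_nonneg_pos)
  have "gauss (a *\<^sub>R (\<mu> + e)) h x * gauss 0 s e = gauss (a *\<^sub>R \<mu>) H x * gauss m r e" for e
  proof -
    define y where "y = x - a *\<^sub>R \<mu>"
    have 1: "(norm (x - a *\<^sub>R (\<mu> + e)))\<^sup>2 = y \<bullet> y - 2 * a * (y \<bullet> e) + a\<^sup>2 * (e \<bullet> e)"
      unfolding power2_norm_eq_inner by (simp add: y_def algebra_simps power2_eq_square inner_commute)
    have 2: "(norm (e - m))\<^sup>2 = e \<bullet> e - 2 * (a * s / H) * (y \<bullet> e) + (a * s / H)\<^sup>2 * (y \<bullet> y)"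
      unfolding power2_norm_eq_inner m_def y_def[symmetric] by (simp add: algebra_simps inner_commute power2_eq_square)
    have 3: "(norm (x - a *\<^sub>R \<mu>))\<^sup>2 = y \<bullet> y" by (simp add: y_def power2_norm_eq_inner)
    have r': "1 / r = a\<^sup>2 / h + 1 / s"
      using h s H by (simp add: r_def H_def field_simps)
    have c1: "2 * (a * s / H) / r = 2 * a / h" using h s H by (simp add: r_def)
    have c2: "1 / H + (a * s / H)\<^sup>2 / r = 1 / h"
    proof -
      have "(a * s / H)\<^sup>2 / r = (a\<^sup>2 * s) / (h * H)"
        using h s H by (simp add: r_def power2_eq_square mult_ac)
      also have "1 / H + \<dots> = 1 / h"
        using h H by (simp add: divide_simps) (simp add: H_def)
      finally show ?thesis .
    qed
    have "(norm (x - a *\<^sub>R (\<mu> + e)))\<^sup>2 / h + (norm e)\<^sup>2 / s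
       = (1 / h) * (y \<bullet> y) - (2 * a / h) * (y \<bullet> e) + (a\<^sup>2 / h + 1 / s) * (e \<bullet> e)"
      unfolding 1 by (simp add: power2_norm_eq_inner add_divide_distrib diff_divide_distrib algebra_simps)
    also have "\<dots> = (norm (x - a *\<^sub>R \<mu>))\<^sup>2 / H + (norm (e - m))\<^sup>2 / r"
      unfolding 2 3 r'[symmetric] c1[symmetric] c2[symmetric]
      by (simp add: add_divide_distrib diff_divide_distrib algebra_simps)
    finally have ex: "(norm (x - a *\<^sub>R (\<mu> + e)))\<^sup>2 / h + (norm e)\<^sup>2 / s = (norm (x - a *\<^sub>R \<mu>))\<^sup>2 / H + (norm (e - m))\<^sup>2 / r" .
    have ex': "exp (- (norm (x - a *\<^sub>R (\<mu> + e)))\<^sup>2 / (2 * h)) * exp (- (norm e)\<^sup>2 / (2 * s))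
        = exp (- (norm (x - a *\<^sub>R \<mu>))\<^sup>2 / (2 * H)) * exp (- (norm (e - m))\<^sup>2 / (2 * r))"
      using arg_cong[OF ex, of "\<lambda>u. exp (- u / 2)"] unfolding exp_add[symmetric]
      by (simp add: add_divide_distrib mult.commute)
    \<comment> \<open>This identity matches the normalising constants of the two
      factorisations.\<close>
    have "h * s = H * r" using H by (simp add: r_def)
    then have hs: "2 * pi * h * (2 * pi * s) = 2 * pi * H * (2 * pi * r)" by simp
    have "(2 * pi * h) powr q * (2 * pi * s) powr q = (2 * pi * H) powr q * (2 * pi * r) powr q" for q
      using h s H r by (simp add: powr_mult[symmetric] hs del: powr_mult)
    note pw = this
    have "gauss (a *\<^sub>R (\<mu> + e)) h x * gauss 0 s e = ((2 * pi * h) powr (- real DIM('a) / 2) * (2 * pi * s) powr (- real DIM('a) / 2)) *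
       (exp (- (norm (x - a *\<^sub>R (\<mu> + e)))\<^sup>2 / (2 * h)) * exp (- (norm e)\<^sup>2 / (2 * s)))"
      by (simp add: gauss_def)
    also have "\<dots> = gauss (a *\<^sub>R \<mu>) H x * gauss m r e"
      unfolding pw ex' by (simp add: gauss_def)
    finally show ?thesis .
  qed
  then have "(\<integral>\<^sup>+e. ennreal (gauss (a *\<^sub>R (\<mu> + e)) h x) * ennreal (gauss 0 s e) \<partial>lborel)
     = (\<integral>\<^sup>+e. ennreal (gauss (a *\<^sub>R \<mu>) H x) * ennreal (gauss m r e) \<partial>lborel)"
    by (simp add: ennreal_mult'[symmetric] gauss_nonneg)
  also have "\<dots> = ennreal (gauss (a *\<^sub>R \<mu>) H x)"
    by (simp add: nn_integral_cmult nn_integral_gauss r)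
  finally show ?thesis by (simp add: H_def)
qed

section \<open>Differentiating Gaussian mixtures\<close>

lemma gderiv_unique:
  assumes "GDERIV f x :> D" "GDERIV f x :> E"
  shows "D = E"
proof -
  have "(\<lambda>h. h \<bullet> D) = (\<lambda>h. h \<bullet> E)"
    using assms unfolding gderiv_def by (rule has_derivative_unique)
  then have "(D - E) \<bullet> D = (D - E) \<bullet> E" by meson
  then have "(D - E) \<bullet> (D - E) = 0" by (simp add: inner_diff_right)
  then show ?thesis by simp
qed

lemma grad_eqI: "GDERIV f x :> D \<Longrightarrow> grad f x = D"
  unfolding grad_def by (blast intro: gderiv_unique)

lemma gderiv_ln:
  assumes "GDERIV f x :> D" "0 < f x"
  shows "GDERIV (\<lambda>x. ln (f x)) x :> (1 / f x) *\<^sub>R D"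
  using GDERIV_DERIV_compose[OF assms(1) DERIV_ln[OF assms(2)]] by (simp add: divide_inverse)

lemma times_exp_minus_le_one: "0 \<le> u \<Longrightarrow> u * exp (- u) \<le> (1::real)"
  using exp_ge_add_one_self[of u] by (simp add: exp_minus divide_simps del: exp_ge_add_one_self)

text \<open>A Taylor bound that is uniform in the mean, so that it can be integrated against any
  mixing measure.\<close>

lemma gauss_taylor:
  fixes \<mu> :: "'a::euclidean_space"
  assumes v: "0 < v"
  shows "\<bar>gauss \<mu> v (x + k) - gauss \<mu> v x - k \<bullet> ((gauss \<mu> v x / v) *\<^sub>R (\<mu> - x))\<bar>
    \<le> (2 * pi * v) powr (- real DIM('a) / 2) * (3 / v) * (norm k)\<^sup>2"
proof -
  define y where "y = x - \<mu>"
  \<comment> \<open>From here on the Gaussian, without its normalising constant, is studied along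
    the segment from \<open>x\<close> to \<open>x + k\<close>.\<close>
  define q where "q s = (norm (y + s *\<^sub>R k))\<^sup>2" for s
  define q' where "q' s = (y + s *\<^sub>R k) \<bullet> k" for s
  define f where "f s = exp (- q s / (2 * v))" for s
  define f' where "f' s = - (q' s / v) * f s" for s
  define f'' where "f'' s = ((q' s / v)\<^sup>2 - (norm k)\<^sup>2 / v) * f s" for s
  have qq: "q s = y \<bullet> y + 2 * s * (y \<bullet> k) + s\<^sup>2 * (k \<bullet> k)" for s
    unfolding q_def power2_norm_eq_inner by (simp add: algebra_simps inner_commute power2_eq_square)
  have dq: "(q has_real_derivative 2 * q' s) (at s)" for s
    unfolding qq[abs_def] q'_def by (auto intro!: derivative_eq_intros simp: algebra_simps)
  have df: "(f has_real_derivative f' s) (at s)" for s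
    unfolding f_def f'_def using v by (auto intro!: derivative_eq_intros dq simp: field_simps)
  have dq': "(q' has_real_derivative (norm k)\<^sup>2) (at s)" for s
    unfolding q'_def power2_norm_eq_inner inner_add_left inner_scaleR_left
    by (auto intro!: derivative_eq_intros)
  have df': "(f' has_real_derivative f'' s) (at s)" for s
    unfolding f'_def f''_def using v
    by (auto intro!: derivative_eq_intros dq' df simp: f'_def field_simps power2_eq_square)
  \<comment> \<open>The quadratic growth in the second derivative is absorbed by the exponential: by
    Cauchy-Schwarz \<open>(q' s / v)^2\<close> is at most \<open>(2 / v) u |k|^2\<close> with
    \<open>u = q s / (2 v)\<close>, and \<open>u exp (- u)\<close> is at most 1. This gives 2 of the
    constant 3; the term \<open>|k|^2 / v\<close> gives the remaining 1.\<close>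
  have bd: "\<bar>f'' s\<bar> \<le> 3 / v * (norm k)\<^sup>2" for s
  proof -
    let ?u = "q s / (2 * v)"
    have u: "0 \<le> ?u" using v by (simp add: q_def)
    have "(q' s)\<^sup>2 \<le> q s * (norm k)\<^sup>2"
      unfolding q'_def q_def using Cauchy_Schwarz_ineq[of "y + s *\<^sub>R k" k]
      by (simp add: power2_norm_eq_inner)
    then have "(q' s / v)\<^sup>2 \<le> (2 / v * ?u) * (norm k)\<^sup>2"
      using v by (simp add: power_divide field_simps power2_eq_square)
    then have "(q' s / v)\<^sup>2 * f s \<le> (2 / v * ?u) * (norm k)\<^sup>2 * f s"
      by (intro mult_right_mono) (auto simp: f_def)
    also have "\<dots> = 2 / v * (norm k)\<^sup>2 * (?u * exp (- ?u))" by (simp add: f_def)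
    also have "\<dots> \<le> 2 / v * (norm k)\<^sup>2 * 1"
      using v by (intro mult_left_mono times_exp_minus_le_one u) auto
    finally have 1: "(q' s / v)\<^sup>2 * f s \<le> 2 / v * (norm k)\<^sup>2" by simp
    have "f s \<le> 1" using u by (simp add: f_def)
    then have 2: "(norm k)\<^sup>2 / v * f s \<le> (norm k)\<^sup>2 / v * 1"
      using v by (intro mult_left_mono) auto
    have 3: "0 \<le> (q' s / v)\<^sup>2 * f s" "0 \<le> (norm k)\<^sup>2 / v * f s" using v by (auto simp: f_def)
    have "f'' s = (q' s / v)\<^sup>2 * f s - (norm k)\<^sup>2 / v * f s" by (simp add: f''_def left_diff_distrib)
    moreover have "3 / v * (norm k)\<^sup>2 = 2 / v * (norm k)\<^sup>2 + (norm k)\<^sup>2 / v * 1" by (simp add: field_simps)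
    moreover have "0 \<le> (norm k)\<^sup>2 / v" using v by simp
    ultimately show ?thesis using 1 2 3 by linarith
  qed
  obtain a where a: "0 < a" "a < 1" "f 1 - f 0 = (1 - 0) * f' a"
    using MVT2[of 0 1 f f'] df by auto
  obtain b where b: "0 < b" "b < a" "f' a - f' 0 = (a - 0) * f'' b"
    using MVT2[of 0 a f' f''] df' a by auto
  have "\<bar>f 1 - f 0 - f' 0\<bar> = a * \<bar>f'' b\<bar>" using a b by (simp add: abs_mult)
  also have "\<dots> \<le> 1 * (3 / v * (norm k)\<^sup>2)" using a bd[of b] by (intro mult_mono) auto
  finally have main: "\<bar>f 1 - f 0 - f' 0\<bar> \<le> 3 / v * (norm k)\<^sup>2" by simp
  let ?C = "(2 * pi * v) powr (- real DIM('a) / 2)"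
  have "gauss \<mu> v (x + k) = ?C * f 1" by (simp add: gauss_def f_def q_def y_def algebra_simps)
  moreover have "gauss \<mu> v x = ?C * f 0" by (simp add: gauss_def f_def q_def y_def)
  moreover have "k \<bullet> ((gauss \<mu> v x / v) *\<^sub>R (\<mu> - x)) = ?C * f' 0"
    using v by (simp add: gauss_def f'_def f_def q_def y_def q'_def inner_diff_left inner_diff_right inner_commute field_simps)
  ultimately have "\<bar>gauss \<mu> v (x + k) - gauss \<mu> v x - k \<bullet> ((gauss \<mu> v x / v) *\<^sub>R (\<mu> - x))\<bar> = ?C * \<bar>f 1 - f 0 - f' 0\<bar>"
    by (simp only: right_diff_distrib[symmetric] abs_mult) simp
  also have "\<dots> \<le> ?C * (3 / v * (norm k)\<^sup>2)" using main by (intro mult_left_mono) auto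
  finally show ?thesis by (simp add: mult.assoc)
qed

text \<open>A bound free of \<open>\<mu>\<close> and \<open>x\<close>, which makes the integrand of
  the gradient integrable against any probability measure. The linear factor is handled by
  \<open>n \<le> (n^2 + 1) / 2\<close>, which leads back to
  \<open>u exp (- u) \<le> 1\<close>.\<close>

lemma gauss_score_bound:
  fixes \<mu> :: "'a::euclidean_space"
  assumes v: "0 < v"
  shows "norm ((gauss \<mu> v x / v) *\<^sub>R (\<mu> - x)) \<le> (2 * pi * v) powr (- real DIM('a) / 2) * (1 + 1 / v)"
proof -
  let ?C = "(2 * pi * v) powr (- real DIM('a) / 2)" and ?e = "exp (- (norm (x - \<mu>))\<^sup>2 / (2 * v))"
  let ?n = "norm (x - \<mu>)"
  have n: "?n \<le> 1 / 2 * (?n\<^sup>2 + 1)" using sum_squares_bound[of ?n 1] by simp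
  have e: "0 \<le> ?e" "?e \<le> 1" using v by auto
  have u: "?n\<^sup>2 / (2 * v) * ?e \<le> 1"
    using times_exp_minus_le_one[of "?n\<^sup>2 / (2 * v)"] v by simp
  have "?n / v * ?e \<le> (1 / 2 * (?n\<^sup>2 + 1)) / v * ?e"
    using v by (intro mult_right_mono divide_right_mono n e) auto
  also have "\<dots> = ?n\<^sup>2 / (2 * v) * ?e + 1 / (2 * v) * ?e" by (simp add: algebra_simps add_divide_distrib)
  also have "\<dots> \<le> 1 + 1 / (2 * v) * 1" using v e by (intro add_mono u mult_left_mono) auto
  also have "\<dots> \<le> 1 + 1 / v" using v by (simp add: field_simps)
  finally have "?n / v * ?e \<le> 1 + 1 / v" .
  then have "?C * (?n / v * ?e) \<le> ?C * (1 + 1 / v)" by (intro mult_left_mono) auto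
  then show ?thesis using v by (simp add: gauss_def norm_minus_commute ac_simps)
qed

text \<open>The mean map \<open>m\<close> is left general so that one calculus serves both the
  latent density, with means \<open>alpha z\<close>, and the ambient one, with means
  \<open>alpha A z\<close>.\<close>

definition gauss_mix :: "'z measure \<Rightarrow> ('z \<Rightarrow> 'a::euclidean_space) \<Rightarrow> real \<Rightarrow> 'a \<Rightarrow> real" where
  "gauss_mix p m v x = (\<integral>z. gauss (m z) v x \<partial>p)"

definition gauss_mix_grad :: "'z measure \<Rightarrow> ('z \<Rightarrow> 'a::euclidean_space) \<Rightarrow> real \<Rightarrow> 'a \<Rightarrow> 'a" where
  "gauss_mix_grad p m v x = (\<integral>z. (gauss (m z) v x / v) *\<^sub>R (m z - x) \<partial>p)"

context prob_space
begin

lemma integrable_gauss: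
  assumes [measurable]: "m \<in> borel_measurable M" and v: "0 < v"
  shows "integrable M (\<lambda>z. gauss (m z) v x)"
  by (rule integrable_const_bound[where B="(2 * pi * v) powr (- real DIM('b) / 2)"])
    (use gauss_le[OF v, where ?'a = 'b] in \<open>auto simp: abs_of_nonneg gauss_nonneg\<close>)

lemma nn_integral_gauss_mix:
  assumes [measurable]: "m \<in> borel_measurable M" and v: "0 < v"
  shows "(\<integral>\<^sup>+z. ennreal (gauss (m z) v x) \<partial>M) = ennreal (gauss_mix M m v x)"
  unfolding gauss_mix_def
  by (intro nn_integral_eq_integral integrable_gauss) (auto simp: gauss_nonneg v)

lemma gauss_mix_pos:
  assumes m[measurable]: "m \<in> borel_measurable M" and v: "0 < v"
  shows "0 < gauss_mix M m v x"
proof -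
  have "gauss_mix M m v x \<noteq> 0"
  proof
    assume "gauss_mix M m v x = 0"
    then have "AE z in M. gauss (m z) v x = 0"
      unfolding gauss_mix_def
      by (subst (asm) integral_nonneg_eq_0_iff_AE) (auto simp: gauss_nonneg integrable_gauss v)
    then have "AE z in M. False" by eventually_elim (use gauss_pos[OF v] in \<open>metis less_irrefl\<close>)
    then show False by simp
  qed
  moreover have "0 \<le> gauss_mix M m v x"
    unfolding gauss_mix_def by (intro integral_nonneg_AE) (auto simp: gauss_nonneg)
  ultimately show ?thesis by simp
qed

lemma gderiv_gauss_mix:
  assumes [measurable]: "m \<in> borel_measurable M" and v: "0 < v"
  shows "GDERIV (gauss_mix M m v) x :> gauss_mix_grad M m v x"
proof -
  let ?d = "\<lambda>z. (gauss (m z) v x / v) *\<^sub>R (m z - x)"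
  define C where "C = (2 * pi * v) powr (- real DIM('b) / 2) * (3 / v)"
  have C: "0 \<le> C" using v by (simp add: C_def)
  have i1: "integrable M (\<lambda>z. gauss (m z) v y)" for y by (intro integrable_gauss v) measurable
  have i2: "integrable M ?d"
    by (rule integrable_const_bound[OF AE_I2]) (use gauss_score_bound[OF v] in auto)
  have bd: "\<bar>gauss_mix M m v (x + k) - gauss_mix M m v x - k \<bullet> gauss_mix_grad M m v x\<bar> \<le> C * (norm k)\<^sup>2" for k
  proof -
    have eq: "gauss_mix M m v (x + k) - gauss_mix M m v x - k \<bullet> gauss_mix_grad M m v x
       = (\<integral>z. gauss (m z) v (x + k) - gauss (m z) v x - k \<bullet> ?d z \<partial>M)"
      unfolding gauss_mix_def gauss_mix_grad_def
      by (simp only: Bochner_Integration.integral_diff integrable_inner_right i1 i2 Bochner_Integration.integrable_diff integral_inner_right)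
    have ii: "integrable M (\<lambda>z. gauss (m z) v (x + k) - gauss (m z) v x - k \<bullet> ?d z)"
      by (intro Bochner_Integration.integrable_diff integrable_inner_right i1 i2)
    have "\<bar>\<integral>z. gauss (m z) v (x + k) - gauss (m z) v x - k \<bullet> ?d z \<partial>M\<bar>
       \<le> (\<integral>z. \<bar>gauss (m z) v (x + k) - gauss (m z) v x - k \<bullet> ?d z\<bar> \<partial>M)"
      by (rule integral_abs_bound)
    also have "\<dots> \<le> (\<integral>z. C * (norm k)\<^sup>2 \<partial>M)"
      unfolding C_def by (intro integral_mono gauss_taylor v integrable_abs ii) simp
    finally show ?thesis by (simp add: eq prob_space)
  qed
  show ?thesis
    unfolding gderiv_def has_derivative_at
  proof (intro conjI)
    show "bounded_linear (\<lambda>h. h \<bullet> gauss_mix_grad M m v x)" by (rule bounded_linear_inner_left)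
    show "(\<lambda>h. norm (gauss_mix M m v (x + h) - gauss_mix M m v x - h \<bullet> gauss_mix_grad M m v x) / norm h) \<midarrow>0\<rightarrow> 0"
    proof (rule Lim_null_comparison)
      show "\<forall>\<^sub>F h in at 0. norm (norm (gauss_mix M m v (x + h) - gauss_mix M m v x - h \<bullet> gauss_mix_grad M m v x) / norm h) \<le> C * norm h"
        unfolding eventually_at_filter using bd
        by (intro always_eventually) (auto simp: divide_simps power2_eq_square mult.assoc)
      show "((\<lambda>h. C * norm h) \<longlongrightarrow> 0) (at (0::'b))"
        by (auto intro!: tendsto_eq_intros)
    qed
  qed
qed

end

section \<open>Scores of the components\<close>

definition latent_law :: "('n::finite, 'd::finite) component \<Rightarrow> (real^'d) measure" where
  "latent_law c = density lborel (\<lambda>z. ennreal (latent c z))"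

lemma sets_latent_law [simp, measurable_cong]: "sets (latent_law c) = sets borel"
  and space_latent_law [simp]: "space (latent_law c) = UNIV"
  by (simp_all add: latent_law_def)

lemma hvar_pos: "0 < t \<Longrightarrow> 0 < hvar t" by (simp add: hvar_def)

locale mixture_component =
  fixes c :: "('n::finite, 'd::finite) component"
  assumes wf: "well_formed_component c"
begin

lemma orthonormal: "orthonormal_columns (basis c)"
  and noise_pos: "0 < noise c"
  and latent_measurable [measurable]: "latent c \<in> borel_measurable borel"
  and latent_nonneg: "0 \<le> latent c z"
  using wf by (auto simp: well_formed_component_def)

sublocale latent: prob_space "latent_law c"
  using wf by (auto simp: well_formed_component_def latent_law_def)

lemma htil_pos: "0 < t \<Longrightarrow> 0 < htil c t"
  using hvar_pos[of t] by (simp add: htil_def add_nonneg_pos)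

lemma hvar_le_htil: "hvar t \<le> htil c t"
  by (simp add: htil_def)

lemma ld_dens_eq_gauss_mix: "ld_dens c t = gauss_mix (latent_law c) (\<lambda>z. alpha t *\<^sub>R z) (htil c t)"
  unfolding ld_dens_def gauss_mix_def latent_law_def fun_eq_iff
  by (subst integral_density) (auto simp: latent_nonneg mult.commute)

text \<open>Integrating out the observation noise first adds its variance, scaled by
  \<open>alpha^2\<close>, to that of the forward kernel. The result has variance
  \<open>htil\<close>, the same as in the latent density, which is what makes the two densities
  comparable.\<close>

lemma fwd_dens_eq_gauss_mix:
  assumes t: "0 < t"
  shows "fwd_dens (data_law c) t = gauss_mix (latent_law c) (\<lambda>z. alpha t *\<^sub>R (basis c *v z)) (htil c t)"
proof
  fix x
  let ?a = "alpha t" and ?h = "hvar t"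
  define N where "N = density lborel (\<lambda>e::real^'n. ennreal (gauss 0 ((noise c)\<^sup>2) e))"
  have [simp, measurable_cong]: "sets N = sets borel" by (simp add: N_def)
  interpret N: prob_space N
    by standard (use noise_pos in \<open>simp add: N_def emeasure_density nn_integral_gauss\<close>)
  interpret P: pair_prob_space "latent_law c" N ..
  have "fwd_dens (data_law c) t x
      = (\<integral>x0. gauss (?a *\<^sub>R x0) ?h x \<partial>distr (latent_law c \<Otimes>\<^sub>M N) borel (\<lambda>(z, e). basis c *v z + e))"
    by (simp add: fwd_dens_def data_law_def latent_law_def N_def)
  also have "\<dots> = (\<integral>w. gauss (?a *\<^sub>R (basis c *v fst w + snd w)) ?h x \<partial>(latent_law c \<Otimes>\<^sub>M N))"
    by (subst integral_distr) (simp_all add: case_prod_beta)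
  also have "\<dots> = enn2real (\<integral>\<^sup>+w. ennreal (gauss (?a *\<^sub>R (basis c *v fst w + snd w)) ?h x) \<partial>(latent_law c \<Otimes>\<^sub>M N))"
    by (intro integral_eq_nn_integral) (auto simp: gauss_nonneg)
  also have "(\<integral>\<^sup>+w. ennreal (gauss (?a *\<^sub>R (basis c *v fst w + snd w)) ?h x) \<partial>(latent_law c \<Otimes>\<^sub>M N))
     = (\<integral>\<^sup>+z. (\<integral>\<^sup>+e. ennreal (gauss (?a *\<^sub>R (basis c *v z + e)) ?h x) \<partial>N) \<partial>latent_law c)"
    by (subst N.nn_integral_fst[symmetric]) (auto simp: case_prod_beta)
  also have "\<dots> = (\<integral>\<^sup>+z. ennreal (gauss (?a *\<^sub>R (basis c *v z)) (htil c t) x) \<partial>latent_law c)"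
  proof (rule nn_integral_cong)
    fix z
    have "(\<integral>\<^sup>+e. ennreal (gauss (?a *\<^sub>R (basis c *v z + e)) ?h x) \<partial>N) =
       (\<integral>\<^sup>+e. ennreal (gauss (?a *\<^sub>R (basis c *v z + e)) ?h x) * ennreal (gauss 0 ((noise c)\<^sup>2) e) \<partial>lborel)"
      unfolding N_def by (subst nn_integral_density) (auto simp: mult.commute)
    also have "\<dots> = ennreal (gauss (?a *\<^sub>R (basis c *v z)) (htil c t) x)"
      unfolding htil_def using noise_pos hvar_pos[OF t] by (intro nn_integral_gauss_convolution) auto
    finally show "(\<integral>\<^sup>+e. ennreal (gauss (?a *\<^sub>R (basis c *v z + e)) ?h x) \<partial>N)
      = ennreal (gauss (?a *\<^sub>R (basis c *v z)) (htil c t) x)" .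
  qed
  also have "\<dots> = ennreal (gauss_mix (latent_law c) (\<lambda>z. ?a *\<^sub>R (basis c *v z)) (htil c t) x)"
    by (intro latent.nn_integral_gauss_mix htil_pos t) measurable
  also have "enn2real \<dots> = gauss_mix (latent_law c) (\<lambda>z. ?a *\<^sub>R (basis c *v z)) (htil c t) x"
    using latent.gauss_mix_pos[OF _ htil_pos[OF t], of "\<lambda>z. ?a *\<^sub>R (basis c *v z)" x] by (simp add: less_imp_le)
  finally show "fwd_dens (data_law c) t x = gauss_mix (latent_law c) (\<lambda>z. ?a *\<^sub>R (basis c *v z)) (htil c t) x" .
qed

lemma fwd_dens_pos: "0 < t \<Longrightarrow> 0 < fwd_dens (data_law c) t x"
  by (simp add: fwd_dens_eq_gauss_mix htil_pos latent.gauss_mix_pos)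

lemma ld_dens_pos: "0 < t \<Longrightarrow> 0 < ld_dens c t y"
  by (simp add: ld_dens_eq_gauss_mix htil_pos latent.gauss_mix_pos)

text \<open>The normalising constant of the Gaussian in the directions orthogonal to the range of
  \<open>A\<close>, as a quotient of those in the ambient and the latent dimension.\<close>

definition "fiber_factor t = (2 * pi * htil c t) powr (- real CARD('n) / 2) / (2 * pi * htil c t) powr (- real CARD('d) / 2)"

text \<open>Pythagoras: \<open>A z\<close> lies in the range of \<open>A\<close>, so
  \<open>|x - alpha A z|^2\<close> is \<open>|x|^2 - |A^T x|^2\<close>, which does not involve
  \<open>z\<close>, plus \<open>|A^T x - alpha z|^2\<close>.\<close>

lemma fwd_dens_factorization:
  assumes t: "0 < t"
  shows "fwd_dens (data_law c) t x = fiber_factor t * ld_dens c t (transpose (basis c) *v x) *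
      exp (- (x \<bullet> x - (transpose (basis c) *v x) \<bullet> (transpose (basis c) *v x)) / (2 * htil c t))"
proof -
  let ?A = "basis c" and ?v = "htil c t"
  let ?y = "transpose ?A *v x"
  let ?e = "exp (- (x \<bullet> x - ?y \<bullet> ?y) / (2 * ?v))"
  have v: "0 < ?v" by (rule htil_pos[OF t])
  have "gauss (alpha t *\<^sub>R (?A *v z)) ?v x = fiber_factor t * ?e * gauss (alpha t *\<^sub>R z) ?v ?y" for z
  proof -
    have 1: "(norm (x - alpha t *\<^sub>R (?A *v z)))\<^sup>2 = (x \<bullet> x - ?y \<bullet> ?y) + (norm (?y - alpha t *\<^sub>R z))\<^sup>2"
    proof -
      have a: "x \<bullet> (?A *v z) = ?y \<bullet> z" "(?A *v z) \<bullet> x = ?y \<bullet> z" "z \<bullet> ?y = ?y \<bullet> z"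
        using inner_transpose_matrix[of ?A x z] by (simp_all add: inner_commute)
      have b: "(?A *v z) \<bullet> (?A *v z) = z \<bullet> z"
        using norm_orthonormal_columns[OF orthonormal, of z] by (simp add: norm_eq_sqrt_inner)
      show ?thesis
        unfolding power2_norm_eq_inner
        by (simp add: inner_diff_left inner_diff_right a b)
    qed
    have "exp (- (norm (x - alpha t *\<^sub>R (?A *v z)))\<^sup>2 / (2 * ?v)) = ?e * exp (- (norm (?y - alpha t *\<^sub>R z))\<^sup>2 / (2 * ?v))"
      unfolding exp_add[symmetric] 1 by (simp add: add_divide_distrib diff_divide_distrib)
    then show ?thesis using v by (simp add: gauss_def fiber_factor_def)
  qed
  then show ?thesis
    by (simp add: fwd_dens_eq_gauss_mix[OF t] ld_dens_eq_gauss_mix gauss_mix_def)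
qed

text \<open>An explicit formula for the logarithmic gradient; measurability can be read off from it,
  unlike from the definite description in \<open>grad\<close>.\<close>

definition latent_score :: "real \<Rightarrow> real^'d \<Rightarrow> real^'d" where
  "latent_score t y = (1 / ld_dens c t y) *\<^sub>R gauss_mix_grad (latent_law c) (\<lambda>z. alpha t *\<^sub>R z) (htil c t) y"

lemma gderiv_ld_dens:
  assumes "0 < t"
  shows "GDERIV (ld_dens c t) y :> ld_dens c t y *\<^sub>R latent_score t y"
proof -
  have "GDERIV (ld_dens c t) y :> gauss_mix_grad (latent_law c) (\<lambda>z. alpha t *\<^sub>R z) (htil c t) y"
    unfolding ld_dens_eq_gauss_mix
    by (intro latent.gderiv_gauss_mix htil_pos assms) measurable
  moreover have "ld_dens c t y \<noteq> 0" using ld_dens_pos[OF assms, of y] by simp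
  ultimately show ?thesis by (simp add: latent_score_def)
qed

lemma grad_ln_ld_dens:
  assumes "0 < t"
  shows "grad (\<lambda>y. ln (ld_dens c t y)) y = latent_score t y"
proof -
  have "ld_dens c t y \<noteq> 0" using ld_dens_pos[OF assms, of y] by simp
  then show ?thesis
    using grad_eqI[OF gderiv_ln[OF gderiv_ld_dens[OF assms] ld_dens_pos[OF assms]], of y] by simp
qed

lemma gfun_eq: "0 < t \<Longrightarrow> gfun c y t = hvar t *\<^sub>R latent_score t y + y"
  by (simp add: gfun_def grad_ln_ld_dens)

text \<open>The product rule on the factorisation gives the logarithmic gradient
  \<open>A S - P^perp x / htil\<close>, with \<open>S\<close> the latent score at
  \<open>A^T x\<close>. Since \<open>rho - 1 = - hvar / htil\<close>, this is
  \<open>(G - x) / hvar\<close>; the choice of \<open>rho\<close> is forced by this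
  computation.\<close>

lemma gderiv_fwd_dens:
  assumes t: "0 < t"
  shows "GDERIV (fwd_dens (data_law c) t) x :> (fwd_dens (data_law c) t x / hvar t) *\<^sub>R (Gfun c t x - x)"
proof -
  let ?A = "basis c" and ?v = "htil c t" and ?p = "fwd_dens (data_law c) t" and ?S = "latent_score t"
  let ?E = "\<lambda>x. exp (- (x \<bullet> x - (transpose ?A *v x) \<bullet> (transpose ?A *v x)) / (2 * ?v))"
  let ?l = "\<lambda>x. ld_dens c t (transpose ?A *v x)"
  have v: "0 < ?v" by (rule htil_pos[OF t])
  have h: "0 < hvar t" by (rule hvar_pos[OF t])
  have bl: "bounded_linear ((*v) (transpose ?A))"
    by (simp add: linear_conv_bounded_linear[symmetric])
  have p: "?p = (\<lambda>x. fiber_factor t * ?l x * ?E x)"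
    using fwd_dens_factorization[OF t] by (simp add: fun_eq_iff)
  have T: "(transpose ?A *v k) \<bullet> w = k \<bullet> (?A *v w)" for k w
    by (rule inner_transpose_matrix)
  have dT: "((\<lambda>x. transpose ?A *v x) has_derivative (\<lambda>k. transpose ?A *v k)) (at x)"
    by (rule bounded_linear_imp_has_derivative[OF bl])
  have dl: "(?l has_derivative (\<lambda>k. (transpose ?A *v k) \<bullet> (?l x *\<^sub>R ?S (transpose ?A *v x)))) (at x)"
    using has_derivative_compose[OF dT gderiv_ld_dens[OF t, of "transpose ?A *v x", unfolded gderiv_def]] .
  have dE: "(?E has_derivative (\<lambda>k. - (?E x / ?v) * (k \<bullet> x - k \<bullet> (?A *v (transpose ?A *v x))))) (at x)"
  proof -
    have c: "(transpose ?A *v x) \<bullet> (transpose ?A *v k) = k \<bullet> (?A *v (transpose ?A *v x))" for k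
      using T[of k "transpose ?A *v x"] by (simp add: inner_commute)
    have d: "((\<lambda>x. x \<bullet> x - (transpose ?A *v x) \<bullet> (transpose ?A *v x)) has_derivative
        (\<lambda>k. 2 * (k \<bullet> x - k \<bullet> (?A *v (transpose ?A *v x))))) (at x)"
      by (rule derivative_eq_intros dT refl)+ (simp add: c T[of _ "transpose ?A *v x"] fun_eq_iff inner_commute)
    have gen: "((\<lambda>x. exp (- q x / (2 * ?v))) has_derivative (\<lambda>k. - (exp (- q x / (2 * ?v)) / ?v) * q' k)) (at x)"
      if "(q has_derivative (\<lambda>k. 2 * q' k)) (at x)" for q q' :: "real^'n \<Rightarrow> real"
      using v by (auto intro!: derivative_eq_intros that simp: field_simps)
    show ?thesis by (rule gen[OF d])
  qed
  have "(?p has_derivative (\<lambda>k. fiber_factor t * (?l x * (- (?E x / ?v) * (k \<bullet> x - k \<bullet> (?A *v (transpose ?A *v x))))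
       + ((transpose ?A *v k) \<bullet> (?l x *\<^sub>R ?S (transpose ?A *v x))) * ?E x))) (at x)"
    unfolding p mult.assoc[of "fiber_factor t"]
    by (rule has_derivative_mult_right[OF has_derivative_mult[OF dl dE]])
  moreover have "(\<lambda>k. fiber_factor t * (?l x * (- (?E x / ?v) * (k \<bullet> x - k \<bullet> (?A *v (transpose ?A *v x))))
       + ((transpose ?A *v k) \<bullet> (?l x *\<^sub>R ?S (transpose ?A *v x))) * ?E x))
      = (\<lambda>k. k \<bullet> ((?p x / hvar t) *\<^sub>R (Gfun c t x - x)))"
  proof
    fix k
    define P where "P = ?A *v (transpose ?A *v x)"
    have perp: "proj_perp ?A *v x = x - P"
      by (simp add: P_def proj_perp_def proj_def matrix_vector_mult_diff_rdistrib matrix_vector_mul_assoc)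
    have "Gfun c t x - x = hvar t *\<^sub>R (?A *v ?S (transpose ?A *v x)) + (rho c t - 1) *\<^sub>R (x - P)"
      by (simp add: Gfun_def gfun_eq[OF t] perp matrix_vector_right_distrib scaleR_vector_matrix_assoc
          matrix_vector_mult_scaleR P_def[symmetric] algebra_simps)
    moreover have "rho c t - 1 = - (hvar t / ?v)"
    proof -
      have "(alpha t)\<^sup>2 * (noise c)\<^sup>2 = ?v - hvar t" by (simp add: htil_def)
      then show ?thesis using v by (simp add: rho_def diff_divide_distrib)
    qed
    ultimately have G: "(1 / hvar t) *\<^sub>R (Gfun c t x - x) = ?A *v ?S (transpose ?A *v x) - (1 / ?v) *\<^sub>R (x - P)"
      using h by (simp add: scaleR_diff_right scaleR_add_right)
    have "k \<bullet> ((?p x / hvar t) *\<^sub>R (Gfun c t x - x)) = ?p x * (k \<bullet> ((1 / hvar t) *\<^sub>R (Gfun c t x - x)))"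
      by simp
    also have "\<dots> = ?p x * (k \<bullet> (?A *v ?S (transpose ?A *v x)) - (1 / ?v) * (k \<bullet> x - k \<bullet> P))"
      unfolding G by (simp add: inner_diff_right)
    also have "\<dots> = fiber_factor t * (?l x * (- (?E x / ?v) * (k \<bullet> x - k \<bullet> (?A *v (transpose ?A *v x))))
       + ((transpose ?A *v k) \<bullet> (?l x *\<^sub>R ?S (transpose ?A *v x))) * ?E x)"
      unfolding T P_def[symmetric] p by (simp add: algebra_simps diff_divide_distrib)
    finally show "fiber_factor t * (?l x * (- (?E x / ?v) * (k \<bullet> x - k \<bullet> (?A *v (transpose ?A *v x))))
       + ((transpose ?A *v k) \<bullet> (?l x *\<^sub>R ?S (transpose ?A *v x))) * ?E x)
      = k \<bullet> ((?p x / hvar t) *\<^sub>R (Gfun c t x - x))" by simp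
  qed
  ultimately show ?thesis unfolding gderiv_def by simp
qed

end

section \<open>The largest eigenvalue of a symmetric matrix\<close>

lemma symmetric_inner:
  fixes M :: "real^'n^'n"
  assumes "transpose M = M"
  shows "x \<bullet> (M *v y) = y \<bullet> (M *v x)"
  using inner_transpose_matrix[of M x y] assms by (simp add: inner_commute)

text \<open>Needed because \<open>lambda_max\<close> is a \<open>Max\<close>, which is meaningful
  only on finite sets. Eigenvectors of a symmetric matrix to distinct eigenvalues are orthogonal,
  hence independent, hence finite in number.\<close>

lemma finite_eigenvalues:
  fixes M :: "real^'n^'n"
  assumes M: "transpose M = M"
  shows "finite {l. \<exists>v. v \<noteq> 0 \<and> M *v v = l *\<^sub>R v}"
proof -
  let ?S = "{l. \<exists>v. v \<noteq> 0 \<and> M *v v = l *\<^sub>R v}"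
  have "\<forall>l\<in>?S. \<exists>v. v \<noteq> 0 \<and> M *v v = l *\<^sub>R v" by simp
  then obtain e where e: "\<And>l. l \<in> ?S \<Longrightarrow> e l \<noteq> 0 \<and> M *v e l = l *\<^sub>R e l"
    unfolding bchoice_iff by blast
  have orth: "e l \<bullet> e m = 0" if "l \<in> ?S" "m \<in> ?S" "l \<noteq> m" for l m
  proof -
    have "m * (e l \<bullet> e m) = l * (e l \<bullet> e m)"
      using symmetric_inner[OF M, of "e l" "e m"] e[OF that(1)] e[OF that(2)] by (simp add: inner_commute)
    then show ?thesis using that(3) by simp
  qed
  have inj: "inj_on e ?S"
  proof (rule inj_onI, rule ccontr)
    fix l m assume lm: "l \<in> ?S" "m \<in> ?S" "e l = e m" "l \<noteq> m"
    then have "e l \<bullet> e l = 0" using orth[of l m] by simp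
    then show False using e[OF lm(1)] by simp
  qed
  have "pairwise orthogonal (e ` ?S)"
    using orth by (auto simp: pairwise_def orthogonal_def)
  moreover have "0 \<notin> e ` ?S" 
  proof (rule notI, erule imageE)
    fix l assume l: "0 = e l" "l \<in> ?S"
    show False using e[OF l(2)] l(1) by simp
  qed
  ultimately have "independent (e ` ?S)" by (rule pairwise_orthogonal_independent)
  then have "finite (e ` ?S)" by (rule independent_imp_finite)
  then show ?thesis using inj by (rule finite_imageD)
qed

text \<open>By compactness the quadratic form attains its maximum on the unit sphere. The maximiser
  is an eigenvector, and every other eigenvalue is a value of the same quotient, so the maximum is
  the largest eigenvalue.\<close>

lemma lambda_max_rayleigh:
  fixes M :: "real^'n^'n"
  assumes M: "transpose M = M"
  obtains v where "norm v = 1" "lambda_max M = v \<bullet> (M *v v)" "\<And>w. w \<bullet> (M *v w) \<le> lambda_max M * (norm w)\<^sup>2"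
proof -
  let ?S = "{l. \<exists>v. v \<noteq> 0 \<and> M *v v = l *\<^sub>R v}"
  have "continuous_on (sphere 0 1) (\<lambda>v. v \<bullet> (M *v v))"
    by (intro continuous_intros linear_continuous_on linear_conv_bounded_linear[THEN iffD1] matrix_vector_mul_linear)
  moreover have "axis undefined 1 \<in> (sphere 0 1 :: (real^'n) set)" by simp
  ultimately obtain v where v: "norm v = 1" "\<And>u. norm u = 1 \<Longrightarrow> u \<bullet> (M *v u) \<le> v \<bullet> (M *v v)"
    using continuous_attains_sup[of "sphere 0 1" "\<lambda>v. v \<bullet> (M *v v)"] by auto
  define l where "l = v \<bullet> (M *v v)"
  have le: "w \<bullet> (M *v w) \<le> l * (norm w)\<^sup>2" for w
  proof (cases "w = 0")
    case False
    have "(w /\<^sub>R norm w) \<bullet> (M *v (w /\<^sub>R norm w)) \<le> l"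
      unfolding l_def using False by (intro v(2)) simp
    then have "(w \<bullet> (M *v w)) / (norm w)\<^sup>2 \<le> l"
      by (simp add: matrix_vector_mult_scaleR divide_inverse power2_eq_square ac_simps)
    then show ?thesis using False by (simp add: divide_simps)
  qed simp
  have eig: "M *v v = l *\<^sub>R v"
  proof -
    \<comment> \<open>The residual of the eigenvector equation. Moving from \<open>v\<close> to
      \<open>v + s d\<close> would gain \<open>2 s |d|^2\<close> to first order against a loss of
      only \<open>s^2 Q\<close>, so maximality of \<open>v\<close> forces
      \<open>d = 0\<close>.\<close>
    define d where "d = M *v v - l *\<^sub>R v"
    define Q where "Q = l * (norm d)\<^sup>2 - d \<bullet> (M *v d)"
    have Q: "0 \<le> Q" using le[of d] by (simp add: Q_def)
    have vd: "v \<bullet> (M *v d) = d \<bullet> (M *v v)" by (rule symmetric_inner[OF M])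
    have dd: "d \<bullet> (M *v v) - l * (v \<bullet> d) = d \<bullet> d"
    proof -
      have "d \<bullet> (M *v v - l *\<^sub>R v) = d \<bullet> d" by (simp add: d_def)
      then show ?thesis by (simp add: inner_diff_right inner_commute)
    qed
    have key: "2 * s * (d \<bullet> d) \<le> s\<^sup>2 * Q" for s
    proof -
      have "(v + s *\<^sub>R d) \<bullet> (M *v (v + s *\<^sub>R d)) = l + 2 * s * (d \<bullet> (M *v v)) + s\<^sup>2 * (d \<bullet> (M *v d))"
        by (simp add: l_def matrix_vector_right_distrib matrix_vector_mult_scaleR inner_add_left inner_add_right
            vd power2_eq_square algebra_simps)
      moreover have "(norm (v + s *\<^sub>R d))\<^sup>2 = 1 + 2 * s * (v \<bullet> d) + s\<^sup>2 * (norm d)\<^sup>2"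
        using v(1) unfolding power2_norm_eq_inner norm_eq_1
        by (simp add: inner_add_left inner_add_right inner_commute power2_eq_square algebra_simps)
      ultimately have "l + 2 * s * (d \<bullet> (M *v v)) + s\<^sup>2 * (d \<bullet> (M *v d)) \<le> l * (1 + 2 * s * (v \<bullet> d) + s\<^sup>2 * (norm d)\<^sup>2)"
        using le[of "v + s *\<^sub>R d"] by simp
      then have "2 * s * (d \<bullet> (M *v v) - l * (v \<bullet> d)) \<le> s\<^sup>2 * Q"
        by (simp add: Q_def algebra_simps)
      then show ?thesis by (simp add: dd)
    qed
    have "d \<bullet> d \<le> 0"
    proof (rule ccontr)
      assume "\<not> d \<bullet> d \<le> 0"
      then have pos: "0 < d \<bullet> d" by linarith
      \<comment> \<open>Small enough that the first order gain wins; the \<open>+ 1\<close> keeps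
        the denominator positive when \<open>Q = 0\<close>.\<close>
      define s where "s = (d \<bullet> d) / (Q + 1)"
      have s: "0 < s" using pos Q by (simp add: s_def)
      have "2 * (d \<bullet> d) \<le> s * Q" using key[of s] s by (simp add: power2_eq_square)
      also have "\<dots> \<le> s * (Q + 1)" using s by simp
      also have "\<dots> = d \<bullet> d" using Q by (simp add: s_def)
      finally show False using pos by simp
    qed
    then have "d = 0" by (metis antisym inner_eq_zero_iff inner_ge_zero)
    then show ?thesis by (simp add: d_def)
  qed
  have "lambda_max M = l"
    unfolding lambda_max_def
  proof (rule Max_eqI[OF finite_eigenvalues[OF M]])
    show "l \<in> ?S" using eig v(1) by (auto intro!: exI[of _ v])
    fix m assume "m \<in> ?S"
    then obtain u where u: "u \<noteq> 0" "M *v u = m *\<^sub>R u" by auto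
    have "m * (norm u)\<^sup>2 \<le> l * (norm u)\<^sup>2" using le[of u] u(2) by (simp add: power2_norm_eq_inner)
    then show "m \<le> l" using u(1) by simp
  qed
  then show thesis using that[of v] v(1) le by (simp add: l_def)
qed

text \<open>The strict inequality \<open>a |d|^2 < d . M d\<close> is an open condition on
  \<open>d\<close>, so a maximising vector can be replaced by one from a countable dense set, and
  the superlevel set becomes a countable union. The homogeneous form spares a normalisation of
  \<open>d\<close>.\<close>

lemma borel_measurable_lambda_max:
  fixes M :: "'a \<Rightarrow> real^'n^'n"
  assumes sym: "\<And>t. transpose (M t) = M t"
    and [measurable]: "\<And>a b. (\<lambda>t. M t $ a $ b) \<in> borel_measurable N"
  shows "(\<lambda>t. lambda_max (M t)) \<in> borel_measurable N"
  unfolding borel_measurable_iff_greater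
proof
  fix a
  obtain D :: "(real^'n) set" where D: "countable D" "\<And>X. open X \<Longrightarrow> X \<noteq> {} \<Longrightarrow> \<exists>d\<in>D. d \<in> X"
    by (rule countable_dense_setE) blast
  have iff: "a < lambda_max (M t) \<longleftrightarrow> (\<exists>d\<in>D. a * (norm d)\<^sup>2 < d \<bullet> (M t *v d))" for t
  proof
    assume a: "a < lambda_max (M t)"
    obtain v where v: "norm v = 1" "lambda_max (M t) = v \<bullet> (M t *v v)"
      using lambda_max_rayleigh[OF sym] by metis
    have "open {d. a * (norm d)\<^sup>2 < d \<bullet> (M t *v d)}"
      by (intro open_Collect_less continuous_intros linear_continuous_on linear_conv_bounded_linear[THEN iffD1] matrix_vector_mul_linear)
    moreover have "v \<in> {d. a * (norm d)\<^sup>2 < d \<bullet> (M t *v d)}" using a v by simp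
    ultimately show "\<exists>d\<in>D. a * (norm d)\<^sup>2 < d \<bullet> (M t *v d)" using D(2) by blast
  next
    assume "\<exists>d\<in>D. a * (norm d)\<^sup>2 < d \<bullet> (M t *v d)"
    then obtain d where d: "a * (norm d)\<^sup>2 < d \<bullet> (M t *v d)" by auto
    also have "\<dots> \<le> lambda_max (M t) * (norm d)\<^sup>2" using lambda_max_rayleigh[OF sym] by metis
    finally show "a < lambda_max (M t)" by (metis mult_right_less_imp_less zero_le_power2)
  qed
  have "{t \<in> space N. a < lambda_max (M t)} = (\<Union>d\<in>D. {t \<in> space N. a * (norm d)\<^sup>2 < d \<bullet> (M t *v d)})"
    by (auto simp: iff)
  also have "\<dots> \<in> sets N"
    by (intro sets.countable_UN' D(1)) (auto simp: inner_vec_def matrix_vector_mult_def)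
  finally show "{w \<in> space N. a < lambda_max (M w)} \<in> sets N" .
qed

section \<open>Complementary projections and traces\<close>

lemma proj_perp_mult: "proj_perp A *v x = x - A *v (transpose A *v x)"
  by (simp add: proj_perp_def proj_def matrix_vector_mult_diff_rdistrib matrix_vector_mul_assoc)

lemma inner_proj_perp: "x \<bullet> (proj_perp A *v y) = (proj_perp A *v x) \<bullet> y"
  by (simp add: proj_perp_mult inner_diff_left inner_diff_right inner_transpose_matrix
      flip: inner_transpose_matrix)

lemma transpose_proj_perp:
  "orthonormal_columns A \<Longrightarrow> transpose A *v (proj_perp A *v x) = 0"
  by (simp add: proj_perp_mult matrix_vector_mult_diff_distrib transpose_orthonormal_columns)

lemma power2_norm_eq_sum_Basis: "(norm x)\<^sup>2 = (\<Sum>b\<in>Basis. (b \<bullet> x)\<^sup>2)" for x :: "'a::euclidean_space"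
  unfolding power2_norm_eq_inner euclidean_inner[of x x] by (simp add: inner_commute power2_eq_square)

lemma trace_eq_sum_Basis: "trace M = (\<Sum>b\<in>Basis. b \<bullet> (M *v b))" for M :: "real^'n^'n"
proof -
  have "(\<Sum>b\<in>Basis. b \<bullet> (M *v b)) = (\<Sum>i\<in>UNIV. axis i 1 \<bullet> (M *v axis i 1))"
    unfolding Basis_vec_def by (simp add: UNION_singleton_eq_range sum.reindex inj_on_def axis_eq_axis)
  also have "\<dots> = trace M"
    by (simp add: trace_def inner_axis' matrix_vector_mul_component inner_axis)
  finally show ?thesis ..
qed

section \<open>Laws of the forward process\<close>

lemma sets_fwd_law [simp, measurable_cong]: "sets (fwd_law p t) = sets borel"
  and space_fwd_law [simp]: "space (fwd_law p t) = UNIV"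
  by (simp_all add: fwd_law_def)

lemma (in prob_space) borel_measurable_gauss_mix:
  fixes m :: "'b \<Rightarrow> 'a \<Rightarrow> 'c::euclidean_space"
  assumes [measurable]: "case_prod m \<in> borel_measurable (N \<Otimes>\<^sub>M M)" "v \<in> borel_measurable N" "f \<in> borel_measurable N"
  shows "(\<lambda>x. gauss_mix M (m x) (v x) (f x)) \<in> borel_measurable N"
    and "(\<lambda>x. gauss_mix_grad M (m x) (v x) (f x)) \<in> borel_measurable N"
  unfolding gauss_mix_def gauss_mix_grad_def by measurable

lemma borel_measurable_alpha [measurable]: "alpha \<in> borel_measurable borel"
  and borel_measurable_hvar [measurable]: "hvar \<in> borel_measurable borel"
  and borel_measurable_htil [measurable]: "htil c \<in> borel_measurable borel"
  unfolding alpha_def[abs_def] hvar_def[abs_def] htil_def[abs_def] by measurable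

context mixture_component
begin

text \<open>The Gaussian mixture formula taken for every real \<open>t\<close>. It equals
  \<open>fwd_dens\<close> for \<open>t > 0\<close> and is jointly measurable in time and space, as
  Tonelli's theorem requires.\<close>

definition dens :: "real \<Rightarrow> real^'n \<Rightarrow> real" where
  "dens t = gauss_mix (latent_law c) (\<lambda>z. alpha t *\<^sub>R (basis c *v z)) (htil c t)"

text \<open>A jointly measurable version of \<open>gfun\<close>, equal to it for
  \<open>t > 0\<close>.\<close>

definition gver :: "real \<Rightarrow> real^'d \<Rightarrow> real^'d" where
  "gver t y = hvar t *\<^sub>R latent_score t y + y"

lemma fwd_dens_eq_dens: "0 < t \<Longrightarrow> fwd_dens (data_law c) t = dens t"
  by (simp add: fwd_dens_eq_gauss_mix dens_def)

lemma dens_pos: "0 < t \<Longrightarrow> 0 < dens t x"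
  using fwd_dens_pos[of t x] by (simp add: fwd_dens_eq_dens)

lemma gfun_eq_gver: "0 < t \<Longrightarrow> gfun c y t = gver t y"
  by (simp add: gfun_eq gver_def)

lemma borel_measurable_dens [measurable]:
  assumes [measurable]: "f \<in> borel_measurable N" "g \<in> borel_measurable N"
  shows "(\<lambda>x. dens (f x) (g x)) \<in> borel_measurable N"
  unfolding dens_def by (intro latent.borel_measurable_gauss_mix) measurable

lemma borel_measurable_gver [measurable]:
  assumes [measurable]: "f \<in> borel_measurable N" "g \<in> borel_measurable N"
  shows "(\<lambda>x. gver (f x) (g x)) \<in> borel_measurable N"
proof -
  have [measurable]: "(\<lambda>x. gauss_mix (latent_law c) (\<lambda>z. alpha (f x) *\<^sub>R z) (htil c (f x)) (g x)) \<in> borel_measurable N"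
     "(\<lambda>x. gauss_mix_grad (latent_law c) (\<lambda>z. alpha (f x) *\<^sub>R z) (htil c (f x)) (g x)) \<in> borel_measurable N"
    by (intro latent.borel_measurable_gauss_mix; measurable)+
  show ?thesis
    unfolding gver_def latent_score_def ld_dens_eq_gauss_mix by measurable
qed

lemma fwd_law_eq: "0 < t \<Longrightarrow> fwd_law (data_law c) t = density lborel (\<lambda>x. ennreal (dens t x))"
  by (simp add: fwd_law_def fwd_dens_eq_dens)

lemma nn_integral_fwd_law:
  assumes "0 < t" and [measurable]: "F \<in> borel_measurable borel"
  shows "(\<integral>\<^sup>+x. F x \<partial>fwd_law (data_law c) t) = (\<integral>\<^sup>+x. ennreal (dens t x) * F x \<partial>lborel)"
  using assms(1) by (simp add: fwd_law_eq nn_integral_density)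

text \<open>Tonelli in the latent variable: given \<open>z\<close> the law is Gaussian, so mass and
  second moments reduce to the explicit integrals above.\<close>

lemma nn_integral_fwd_law_latent:
  assumes t: "0 < t" and [measurable]: "F \<in> borel_measurable borel"
  shows "(\<integral>\<^sup>+x. F x \<partial>fwd_law (data_law c) t) =
    (\<integral>\<^sup>+z. (\<integral>\<^sup>+x. F x * ennreal (gauss (alpha t *\<^sub>R (basis c *v z)) (htil c t) x) \<partial>lborel) \<partial>latent_law c)"
proof -
  let ?g = "\<lambda>z x. ennreal (gauss (alpha t *\<^sub>R (basis c *v z)) (htil c t) x)"
  interpret P: pair_sigma_finite lborel "latent_law c" ..
  have "(\<integral>\<^sup>+x. F x \<partial>fwd_law (data_law c) t) = (\<integral>\<^sup>+x. F x * (\<integral>\<^sup>+z. ?g z x \<partial>latent_law c) \<partial>lborel)"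
    using t by (simp add: nn_integral_fwd_law latent.nn_integral_gauss_mix htil_pos dens_def mult.commute)
  also have "\<dots> = (\<integral>\<^sup>+x. (\<integral>\<^sup>+z. F x * ?g z x \<partial>latent_law c) \<partial>lborel)"
    by (subst nn_integral_cmult) auto
  also have "\<dots> = (\<integral>\<^sup>+z. (\<integral>\<^sup>+x. F x * ?g z x \<partial>lborel) \<partial>latent_law c)"
    by (rule P.Fubini'[symmetric]) measurable
  finally show ?thesis .
qed

lemma prob_space_fwd_law: "0 < t \<Longrightarrow> prob_space (fwd_law (data_law c) t)"
proof
  assume t: "0 < t"
  have "emeasure (fwd_law (data_law c) t) (space (fwd_law (data_law c) t)) = (\<integral>\<^sup>+x. 1 \<partial>fwd_law (data_law c) t)"
    by simp
  also have "\<dots> = 1"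
    using t by (subst nn_integral_fwd_law_latent) (simp_all add: nn_integral_gauss htil_pos latent.emeasure_space_1[simplified])
  finally show "emeasure (fwd_law (data_law c) t) (space (fwd_law (data_law c) t)) = 1" .
qed

lemma nn_integral_fwd_law_inner_squared:
  assumes t: "0 < t"
  shows "(\<integral>\<^sup>+x. ennreal ((u \<bullet> x)\<^sup>2) \<partial>fwd_law (data_law c) t) =
    (\<integral>\<^sup>+z. ennreal (htil c t * (norm u)\<^sup>2 + (alpha t)\<^sup>2 * ((transpose (basis c) *v u) \<bullet> z)\<^sup>2) \<partial>latent_law c)"
  using nn_integral_gauss_inner_squared[OF htil_pos[OF t], of u]
  by (subst nn_integral_fwd_law_latent[OF t])
     (simp_all add: ennreal_mult'[symmetric] gauss_nonneg power_mult_distrib inner_transpose_matrix)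

section \<open>The perpendicular part of the comparator\<close>

text \<open>By the factorisation the density depends on \<open>x\<close> only through
  \<open>A^T x\<close> and \<open>|x|\<close>.\<close>

lemma dens_reflect:
  assumes t: "0 < t" and e: "transpose (basis c) *v x' = transpose (basis c) *v x" "norm x' = norm x"
  shows "dens t x' = dens t x"
proof -
  have "x' \<bullet> x' = x \<bullet> x" using e(2) by (simp add: norm_eq)
  then show ?thesis using fwd_dens_factorization[OF t, of x] fwd_dens_factorization[OF t, of x'] e(1)
    by (simp add: fwd_dens_eq_dens[OF t])
qed

text \<open>The density is invariant under the reflection \<open>2P - I\<close>, which fixes \<open>A\<^sup>Tx\<close> and negates
  \<open>P\<^sup>\<bottom>x\<close>; this removes the cross term without any integrability discussion.\<close>

lemma nn_integral_fwd_law_orthogonal_sum: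
  fixes g :: "real^'d \<Rightarrow> real^'n" and B :: "real^'n^'n"
  assumes t: "0 < t" and [measurable]: "g \<in> borel_measurable borel"
  shows "(\<integral>\<^sup>+x. ennreal ((norm (g (transpose (basis c) *v x) + B *v (proj_perp (basis c) *v x)))\<^sup>2) \<partial>fwd_law (data_law c) t) =
    (\<integral>\<^sup>+x. ennreal ((norm (g (transpose (basis c) *v x)))\<^sup>2) \<partial>fwd_law (data_law c) t) +
    (\<integral>\<^sup>+x. ennreal ((norm (B *v (proj_perp (basis c) *v x)))\<^sup>2) \<partial>fwd_law (data_law c) t)"
proof -
  let ?A = "basis c" and ?L = "fwd_law (data_law c) t"
  let ?a = "\<lambda>x. g (transpose ?A *v x)" and ?b = "\<lambda>x. B *v (proj_perp ?A *v x)"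
  define R where "R = mat 1 - proj_perp ?A - proj_perp ?A"
  have R: "R *v x = x - proj_perp ?A *v x - proj_perp ?A *v x" for x
    by (simp only: R_def matrix_vector_mult_diff_rdistrib matrix_vector_mul_lid)
  have AR: "transpose ?A *v (R *v x) = transpose ?A *v x" for x
    unfolding R matrix_vector_mult_diff_distrib transpose_proj_perp[OF orthonormal] by simp
  have PP: "proj_perp ?A *v (proj_perp ?A *v x) = proj_perp ?A *v x" for x
    by (subst (1) proj_perp_mult) (simp add: transpose_proj_perp[OF orthonormal])
  have PR: "proj_perp ?A *v (R *v x) = - (proj_perp ?A *v x)" for x
    unfolding R matrix_vector_mult_diff_distrib PP by (simp only: diff_self diff_0)
  have nR: "norm (R *v x) = norm x" for x
  proof -
    have "(R *v x) \<bullet> (R *v x) = x \<bullet> x - 4 * (x \<bullet> (proj_perp ?A *v x)) + 4 * ((proj_perp ?A *v x) \<bullet> (proj_perp ?A *v x))"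
      unfolding R by (simp only: inner_diff_left inner_diff_right) (simp add: inner_commute)
    also have "(proj_perp ?A *v x) \<bullet> (proj_perp ?A *v x) = x \<bullet> (proj_perp ?A *v x)"
      by (simp add: PP flip: inner_proj_perp)
    finally show ?thesis by (simp add: norm_eq_sqrt_inner)
  qed
  have oR: "orthogonal_matrix R"
    using nR orthogonal_transformation_matrix[of "(*v) R"] by (simp add: orthogonal_transformation)
  have [measurable]: "?a \<in> borel_measurable borel" by measurable
  have split: "(\<integral>\<^sup>+x. ennreal ((norm (?a x + ?b x))\<^sup>2) \<partial>?L) = (\<integral>\<^sup>+x. ennreal ((norm (?a x - ?b x))\<^sup>2) \<partial>?L)"
  proof -
    have "(\<integral>\<^sup>+x. ennreal ((norm (?a x + ?b x))\<^sup>2) \<partial>?L)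
       = (\<integral>\<^sup>+x. ennreal (dens t (R *v x)) * ennreal ((norm (?a (R *v x) + ?b (R *v x)))\<^sup>2) \<partial>lborel)"
      by (subst nn_integral_fwd_law[OF t], measurable,
          subst nn_integral_orthogonal_matrix[OF oR, symmetric], simp_all)
    also have "\<dots> = (\<integral>\<^sup>+x. ennreal (dens t x) * ennreal ((norm (?a x - ?b x))\<^sup>2) \<partial>lborel)"
    proof -
      have m: "B *v (- y) = - (B *v y)" for y
        using matrix_vector_mult_diff_distrib[of B 0 y] by simp
      show ?thesis by (simp add: AR PR m dens_reflect[OF t AR nR])
    qed
    also have "\<dots> = (\<integral>\<^sup>+x. ennreal ((norm (?a x - ?b x))\<^sup>2) \<partial>?L)"
      by (subst nn_integral_fwd_law[OF t]) auto
    finally show ?thesis .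
  qed
  \<comment> \<open>Parallelogram law: the integrals of \<open>|a + b|^2\<close> and
    \<open>|a - b|^2\<close> agree, and their sum contains only the squares.\<close>
  have par: "ennreal ((norm (a + b))\<^sup>2) + ennreal ((norm (a - b))\<^sup>2) = 2 * (ennreal ((norm a)\<^sup>2) + ennreal ((norm b)\<^sup>2))"
    for a b :: "real^'n"
  proof -
    have "(norm (a + b))\<^sup>2 + (norm (a - b))\<^sup>2 = 2 * ((norm a)\<^sup>2 + (norm b)\<^sup>2)"
      unfolding power2_norm_eq_inner by (simp add: inner_add_left inner_add_right inner_diff_left inner_diff_right)
    then have "ennreal ((norm (a + b))\<^sup>2 + (norm (a - b))\<^sup>2) = ennreal 2 * ennreal ((norm a)\<^sup>2 + (norm b)\<^sup>2)"
      by (subst ennreal_mult[symmetric]) auto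
    then show ?thesis by simp
  qed
  let ?s = "\<integral>\<^sup>+x. ennreal ((norm (?a x + ?b x))\<^sup>2) \<partial>?L"
  have "2 * ?s = ?s + (\<integral>\<^sup>+x. ennreal ((norm (?a x - ?b x))\<^sup>2) \<partial>?L)"
    unfolding split[symmetric] mult_2 ..
  also have "\<dots> = (\<integral>\<^sup>+x. 2 * (ennreal ((norm (?a x))\<^sup>2) + ennreal ((norm (?b x))\<^sup>2)) \<partial>?L)"
    by (subst nn_integral_add[symmetric]) (auto simp: par)
  also have "\<dots> = 2 * ((\<integral>\<^sup>+x. ennreal ((norm (?a x))\<^sup>2) \<partial>?L) + (\<integral>\<^sup>+x. ennreal ((norm (?b x))\<^sup>2) \<partial>?L))"
    by (subst nn_integral_cmult) (auto simp: nn_integral_add)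
  finally show ?thesis unfolding ennreal_mult_cancel_left by simp
qed

text \<open>For \<open>u\<close> orthogonal to the range of \<open>A\<close> the latent variable
  drops out of \<open>u . x\<close>, whose second moment is then just \<open>htil |u|^2\<close>.
  Summing over the images of an orthonormal basis under \<open>P_A^perp P_U^perp\<close> gives the
  squared Frobenius norm of this product; that norm is shared by the adjoint, and idempotence turns
  it into the trace.\<close>

lemma nn_integral_fwd_law_perp:
  fixes U :: "real^'m^'n"
  assumes t: "0 < t" and U: "orthonormal_columns U"
  shows "(\<integral>\<^sup>+x. ennreal ((norm (proj_perp U *v (proj_perp (basis c) *v x)))\<^sup>2) \<partial>fwd_law (data_law c) t)
    = ennreal (htil c t * trace (proj_perp U ** proj_perp (basis c)))"
    and "0 \<le> trace (proj_perp U ** proj_perp (basis c))"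
proof -
  let ?A = "basis c" and ?L = "fwd_law (data_law c) t"
  let ?u = "\<lambda>b. proj_perp ?A *v (proj_perp U *v b)"
  have PP: "proj_perp ?A *v (proj_perp ?A *v x) = proj_perp ?A *v x" for x
    by (subst (1) proj_perp_mult) (simp add: transpose_proj_perp[OF orthonormal])
  have PU: "proj_perp U *v (proj_perp U *v x) = proj_perp U *v x" for x
    by (subst (1) proj_perp_mult) (simp add: transpose_proj_perp[OF U])
  have 1: "(norm (proj_perp U *v (proj_perp ?A *v x)))\<^sup>2 = (\<Sum>b\<in>Basis. (?u b \<bullet> x)\<^sup>2)" for x
    unfolding power2_norm_eq_sum_Basis by (simp add: inner_proj_perp)
  have 2: "(\<integral>\<^sup>+x. ennreal ((?u b \<bullet> x)\<^sup>2) \<partial>?L) = ennreal (htil c t * (norm (?u b))\<^sup>2)" for b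
    unfolding nn_integral_fwd_law_inner_squared[OF t] transpose_proj_perp[OF orthonormal]
    using latent.emeasure_space_1 by simp
  have 3: "(\<Sum>b\<in>Basis. (norm (?u b))\<^sup>2) = trace (proj_perp U ** proj_perp ?A)"
  proof -
    have "(\<Sum>b\<in>Basis. (norm (?u b))\<^sup>2) = (\<Sum>b\<in>(Basis :: (real^'n) set). (norm (proj_perp U *v (proj_perp ?A *v b)))\<^sup>2)"
    proof -
      have "(\<Sum>b\<in>Basis. (norm (?u b))\<^sup>2) = (\<Sum>b\<in>Basis. \<Sum>b'\<in>Basis. (b' \<bullet> ?u b)\<^sup>2)"
        by (simp add: power2_norm_eq_sum_Basis[of "?u _"])
      also have "\<dots> = (\<Sum>b'\<in>Basis. \<Sum>b\<in>Basis. (b' \<bullet> ?u b)\<^sup>2)" by (rule sum.swap)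
      also have "\<dots> = (\<Sum>b'\<in>Basis. \<Sum>b\<in>Basis. (b \<bullet> (proj_perp U *v (proj_perp ?A *v b')))\<^sup>2)"
      proof (intro sum.cong refl)
        fix b b' :: "real^'n"
        have "b' \<bullet> ?u b = (proj_perp U *v (proj_perp ?A *v b')) \<bullet> b"
          by (simp only: inner_proj_perp)
        then show "(b' \<bullet> ?u b)\<^sup>2 = (b \<bullet> (proj_perp U *v (proj_perp ?A *v b')))\<^sup>2"
          by (simp only: inner_commute)
      qed
      finally show ?thesis by (simp add: power2_norm_eq_sum_Basis[of "proj_perp U *v _"])
    qed
    also have "\<dots> = (\<Sum>b\<in>(Basis :: (real^'n) set). (proj_perp ?A *v b) \<bullet> (proj_perp U *v (proj_perp ?A *v b)))"
      by (simp add: power2_norm_eq_inner PU flip: inner_proj_perp)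
    also have "\<dots> = trace (proj_perp ?A ** (proj_perp U ** proj_perp ?A))"
      by (simp add: trace_eq_sum_Basis inner_proj_perp flip: matrix_vector_mul_assoc)
    also have "\<dots> = trace ((proj_perp U ** proj_perp ?A) ** proj_perp ?A)" by (rule trace_mul_sym)
    also have "(proj_perp U ** proj_perp ?A) ** proj_perp ?A = proj_perp U ** proj_perp ?A"
      by (simp add: matrix_eq PP flip: matrix_vector_mul_assoc)
    finally show ?thesis .
  qed
  show "0 \<le> trace (proj_perp U ** proj_perp ?A)" unfolding 3[symmetric] by (intro sum_nonneg) simp
  have "(\<integral>\<^sup>+x. ennreal ((norm (proj_perp U *v (proj_perp ?A *v x)))\<^sup>2) \<partial>?L)
      = (\<integral>\<^sup>+x. (\<Sum>b\<in>Basis. ennreal ((?u b \<bullet> x)\<^sup>2)) \<partial>?L)"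
    by (simp add: 1)
  also have "\<dots> = (\<Sum>b\<in>Basis. ennreal (htil c t * (norm (?u b))\<^sup>2))"
    by (subst nn_integral_sum) (auto simp: 2)
  also have "\<dots> = ennreal (htil c t * trace (proj_perp U ** proj_perp ?A))"
    unfolding 3[symmetric] sum_distrib_left using htil_pos[OF t] by (subst sum_ennreal) auto
  finally show "(\<integral>\<^sup>+x. ennreal ((norm (proj_perp U *v (proj_perp ?A *v x)))\<^sup>2) \<partial>?L)
    = ennreal (htil c t * trace (proj_perp U ** proj_perp ?A))" .
qed

end

section \<open>Second moments of the denoiser\<close>

lemma borel_measurable_vec_nth [measurable]:
  "f \<in> borel_measurable N \<Longrightarrow> (\<lambda>x. (f x :: real^'k) $ i) \<in> borel_measurable N"
  by (rule borel_measurable_continuous_on[OF linear_continuous_on[OF bounded_linear_vec_nth]])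

lemma power2_norm_matrix: "(norm B)\<^sup>2 = (\<Sum>i\<in>UNIV. (norm (B $ i))\<^sup>2)" for B :: "real^'k^'l"
  by (simp add: norm_vec_def L2_set_def sum_nonneg)

context mixture_component
begin

text \<open>Inside the ball of radius \<open>B\<close> the integrand is at most \<open>B^2\<close>
  times a probability density; outside, the tail assumption compares the density with a Gaussian of
  variance \<open>1 / C2\<close>.\<close>

lemma latent_second_moment_finite:
  assumes tail: "latent_smooth_tail c"
  shows "(\<integral>\<^sup>+z. ennreal ((norm z)\<^sup>2) \<partial>latent_law c) < \<infinity>"
proof -
  obtain B C1 C2 where BC: "B > 0" "C1 > 0" "C2 > 0"
    and le: "\<And>z. norm z \<ge> B \<Longrightarrow>
       latent c z \<le> (2 * pi) powr (- real CARD('d) / 2) * C1 * exp (- C2 * (norm z)\<^sup>2 / 2)"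
    using tail unfolding latent_smooth_tail_def by blast
  \<comment> \<open>The quotient of normalising constants turns the tail bound into exactly
    \<open>C * gauss 0 (1 / C2) z\<close>.\<close>
  define C where "C = (2 * pi) powr (- real CARD('d) / 2) * C1 / (2 * pi * (1 / C2)) powr (- real CARD('d) / 2)"
  have C: "0 \<le> C" using BC by (simp add: C_def)
  have "(\<integral>\<^sup>+z. ennreal ((norm z)\<^sup>2) \<partial>latent_law c) = (\<integral>\<^sup>+z. ennreal (latent c z * (norm z)\<^sup>2) \<partial>lborel)"
    unfolding latent_law_def by (subst nn_integral_density) (auto simp: ennreal_mult' latent_nonneg)
  also have "\<dots> \<le> (\<integral>\<^sup>+z. ennreal (B\<^sup>2) * ennreal (latent c z) + ennreal C * (\<Sum>b\<in>Basis. ennreal ((b \<bullet> z)\<^sup>2 * gauss 0 (1 / C2) z)) \<partial>lborel)"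
  proof (rule nn_integral_mono)
    fix z :: "real^'d"
    have s: "(\<Sum>b\<in>Basis. ennreal ((b \<bullet> z)\<^sup>2 * gauss 0 (1 / C2) z)) = ennreal ((norm z)\<^sup>2 * gauss 0 (1 / C2) z)"
      by (simp add: sum_ennreal gauss_nonneg power2_norm_eq_sum_Basis[of z] sum_distrib_right)
    have "latent c z * (norm z)\<^sup>2 \<le> B\<^sup>2 * latent c z + C * ((norm z)\<^sup>2 * gauss 0 (1 / C2) z)"
    proof (cases "norm z \<ge> B")
      case True
      have "C * gauss 0 (1 / C2) z = (2 * pi) powr (- real CARD('d) / 2) * C1 * exp (- C2 * (norm z)\<^sup>2 / 2)"
        using BC by (simp add: C_def gauss_def)
      then have "latent c z * (norm z)\<^sup>2 \<le> (C * gauss 0 (1 / C2) z) * (norm z)\<^sup>2"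
        using le[OF True] by (intro mult_right_mono) auto
      moreover have "0 \<le> B\<^sup>2 * latent c z" by (simp add: latent_nonneg)
      ultimately show ?thesis by (simp add: mult_ac)
    next
      case False
      then have "(norm z)\<^sup>2 \<le> B\<^sup>2" by (intro power_mono) auto
      then have "latent c z * (norm z)\<^sup>2 \<le> latent c z * B\<^sup>2" by (intro mult_left_mono) (auto simp: latent_nonneg)
      moreover have "0 \<le> C * ((norm z)\<^sup>2 * gauss 0 (1 / C2) z)" using C by (simp add: gauss_nonneg)
      ultimately show ?thesis by (simp add: mult_ac)
    qed
    then show "ennreal (latent c z * (norm z)\<^sup>2) \<le> ennreal (B\<^sup>2) * ennreal (latent c z) + ennreal C * (\<Sum>b\<in>Basis. ennreal ((b \<bullet> z)\<^sup>2 * gauss 0 (1 / C2) z))"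
      unfolding s using C latent_nonneg[of z]
      by (simp add: ennreal_mult'[symmetric] ennreal_plus[symmetric] gauss_nonneg del: ennreal_plus)
  qed
  also have "\<dots> = ennreal (B\<^sup>2) * (\<integral>\<^sup>+z. ennreal (latent c z) \<partial>lborel) + ennreal C * (\<Sum>b\<in>(Basis :: (real^'d) set). ennreal (1 / C2 * (norm b)\<^sup>2))"
    using BC by (simp add: nn_integral_add nn_integral_cmult nn_integral_sum nn_integral_gauss_inner_squared_centered del: sum_ennreal)
  also have "(\<integral>\<^sup>+z. ennreal (latent c z) \<partial>lborel) = 1"
    using latent.emeasure_space_1 by (simp add: latent_law_def emeasure_density)
  also have "ennreal (B\<^sup>2) * 1 + ennreal C * (\<Sum>b\<in>(Basis :: (real^'d) set). ennreal (1 / C2 * (norm b)\<^sup>2)) < \<infinity>"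
    using BC by (simp add: ennreal_mult_less_top of_nat_less_top)
  finally show ?thesis .
qed

lemma nn_integral_fwd_law_latent_norm_squared:
  assumes t: "0 < t"
  shows "(\<integral>\<^sup>+x. ennreal ((norm (transpose (basis c) *v x))\<^sup>2) \<partial>fwd_law (data_law c) t)
    = ennreal (real CARD('d) * htil c t) + ennreal ((alpha t)\<^sup>2) * (\<integral>\<^sup>+z. ennreal ((norm z)\<^sup>2) \<partial>latent_law c)"
proof -
  let ?A = "basis c" and ?L = "fwd_law (data_law c) t"
  have "(norm (transpose ?A *v x))\<^sup>2 = (\<Sum>b\<in>Basis. ((?A *v b) \<bullet> x)\<^sup>2)" for x
    unfolding power2_norm_eq_sum_Basis
    by (intro sum.cong refl arg_cong[where f="\<lambda>u. u\<^sup>2"]) (metis inner_commute inner_transpose_matrix)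
  then have "(\<integral>\<^sup>+x. ennreal ((norm (transpose ?A *v x))\<^sup>2) \<partial>?L) = (\<integral>\<^sup>+x. (\<Sum>b\<in>Basis. ennreal (((?A *v b) \<bullet> x)\<^sup>2)) \<partial>?L)"
    by simp
  also have "\<dots> = (\<Sum>b\<in>Basis. \<integral>\<^sup>+z. ennreal (htil c t + (alpha t)\<^sup>2 * (b \<bullet> z)\<^sup>2) \<partial>latent_law c)"
    by (subst nn_integral_sum)
      (simp_all add: nn_integral_fwd_law_inner_squared[OF t] norm_orthonormal_columns[OF orthonormal]
        transpose_orthonormal_columns[OF orthonormal])
  also have "\<dots> = (\<integral>\<^sup>+z. (\<Sum>b\<in>Basis. ennreal (htil c t + (alpha t)\<^sup>2 * (b \<bullet> z)\<^sup>2)) \<partial>latent_law c)"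
    by (subst nn_integral_sum) auto
  also have "\<dots> = (\<integral>\<^sup>+z. ennreal (real CARD('d) * htil c t) + ennreal ((alpha t)\<^sup>2) * ennreal ((norm z)\<^sup>2) \<partial>latent_law c)"
  proof (rule nn_integral_cong)
    fix z :: "real^'d"
    have "(\<Sum>b\<in>Basis. ennreal (htil c t + (alpha t)\<^sup>2 * (b \<bullet> z)\<^sup>2)) = ennreal (\<Sum>b\<in>Basis. htil c t + (alpha t)\<^sup>2 * (b \<bullet> z)\<^sup>2)"
      using htil_pos[OF t] by (intro sum_ennreal) auto
    also have "(\<Sum>b\<in>Basis. htil c t + (alpha t)\<^sup>2 * (b \<bullet> z)\<^sup>2) = real CARD('d) * htil c t + (alpha t)\<^sup>2 * (norm z)\<^sup>2"
      by (simp add: sum.distrib power2_norm_eq_sum_Basis[of z] sum_distrib_left)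
    finally show "(\<Sum>b\<in>Basis. ennreal (htil c t + (alpha t)\<^sup>2 * (b \<bullet> z)\<^sup>2))
       = ennreal (real CARD('d) * htil c t) + ennreal ((alpha t)\<^sup>2) * ennreal ((norm z)\<^sup>2)"
      using htil_pos[OF t] by (simp add: ennreal_mult)
  qed
  also have "\<dots> = ennreal (real CARD('d) * htil c t) + ennreal ((alpha t)\<^sup>2) * (\<integral>\<^sup>+z. ennreal ((norm z)\<^sup>2) \<partial>latent_law c)"
    using latent.emeasure_space_1 by (simp add: nn_integral_add nn_integral_cmult)
  finally show ?thesis .
qed

text \<open>Both \<open>g\<close> and \<open>f*\<close> are affine in the same score, so
  \<open>g\<close> is \<open>(hvar / htil) (f* - id) + id\<close> with a ratio of at most 1. The two
  identity terms account for the 2 added to \<open>\<beta>\<close>.\<close>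

lemma gver_lipschitz:
  assumes t: "0 < t" and lip: "\<beta>-lipschitz_on UNIV (\<lambda>z. fstar c z t)"
  shows "norm (gver t y - gver t y') \<le> (\<beta> + 2) * norm (y - y')"
proof -
  have h: "0 < hvar t" "0 < htil c t" "hvar t / htil c t \<le> 1"
    using hvar_pos[OF t] htil_pos[OF t] hvar_le_htil by auto
  have g: "gver t z = (hvar t / htil c t) *\<^sub>R (fstar c z t - z) + z" for z
    using h by (simp add: gver_def fstar_def grad_ln_ld_dens[OF t])
  have f: "norm (fstar c y t - fstar c y' t) \<le> \<beta> * norm (y - y')"
    using lipschitz_onD[OF lip, of y y'] by (simp add: dist_norm)
  have "gver t y - gver t y' = (hvar t / htil c t) *\<^sub>R ((fstar c y t - fstar c y' t) - (y - y')) + (y - y')"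
    unfolding g by (simp add: scaleR_diff_right)
  then have "norm (gver t y - gver t y') \<le> norm ((hvar t / htil c t) *\<^sub>R ((fstar c y t - fstar c y' t) - (y - y'))) + norm (y - y')"
    by (metis norm_triangle_ineq)
  also have "norm ((hvar t / htil c t) *\<^sub>R ((fstar c y t - fstar c y' t) - (y - y')))
     = hvar t / htil c t * norm ((fstar c y t - fstar c y' t) - (y - y'))"
    using h by simp
  also have "\<dots> \<le> 1 * norm ((fstar c y t - fstar c y' t) - (y - y'))"
    using h by (intro mult_right_mono) auto
  also have "\<dots> \<le> \<beta> * norm (y - y') + norm (y - y')"
    using norm_triangle_ineq4[of "fstar c y t - fstar c y' t" "y - y'"] f by simp
  finally show ?thesis by (simp add: algebra_simps)
qed

text \<open>The only place where the regularity hypotheses enter: they bound the second moment of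
  \<open>g\<close> uniformly in time.\<close>

lemma gver_moment_bound:
  assumes t0: "0 < t0" and lip: "latent_lipschitz T \<beta> c" and tail: "latent_smooth_tail c"
    and reg: "gfun_time_regular t0 T c"
  obtains K where "\<And>t. t \<in> {t0..T} \<Longrightarrow>
    (\<integral>\<^sup>+x. ennreal ((norm (gver t (transpose (basis c) *v x)))\<^sup>2) \<partial>fwd_law (data_law c) t) \<le> ennreal K"
proof -
  obtain G where G: "\<And>t. t \<in> {t0..T} \<Longrightarrow> norm (gfun c 0 t) \<le> G"
  proof -
    have "bdd_above ((\<lambda>t. norm (gfun c 0 t)) ` {t0..T})"
      using reg by (simp add: gfun_time_regular_def)
    then obtain G where "\<forall>x\<in>(\<lambda>t. norm (gfun c 0 t)) ` {t0..T}. x \<le> G"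
      unfolding bdd_above_def by blast
    then show thesis by (intro that[of G]) blast
  qed
  obtain M where M: "(\<integral>\<^sup>+z. ennreal ((norm z)\<^sup>2) \<partial>latent_law c) = ennreal M" "0 \<le> M"
    using latent_second_moment_finite[OF tail] by (cases "\<integral>\<^sup>+z. ennreal ((norm z)\<^sup>2) \<partial>latent_law c") auto
  \<comment> \<open>Obtained from \<open>|g y|^2 \<le> 2 G^2 + 2 (\<beta> + 2)^2 |y|^2\<close> and
    from \<open>E |A^T X|^2 = d htil + alpha^2 M\<close>, using that \<open>alpha^2\<close> and
    \<open>hvar\<close> are at most 1.\<close>
  define K where "K = 2 * G\<^sup>2 + 2 * (\<beta> + 2)\<^sup>2 * (real CARD('d) * ((noise c)\<^sup>2 + 1) + M)"
  show thesis
  proof (rule that[of K])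
    fix t assume t: "t \<in> {t0..T}"
    then have tp: "0 < t" using t0 by simp
    interpret L: prob_space "fwd_law (data_law c) t" by (rule prob_space_fwd_law[OF tp])
    let ?A = "basis c" and ?L = "fwd_law (data_law c) t"
    have lt: "\<beta>-lipschitz_on UNIV (\<lambda>z. fstar c z t)"
      using lip t tp by (auto simp: latent_lipschitz_def)
    have bd: "(norm (gver t y))\<^sup>2 \<le> 2 * G\<^sup>2 + 2 * (\<beta> + 2)\<^sup>2 * (norm y)\<^sup>2" for y
    proof -
      have "norm (gver t y) \<le> norm (gver t 0) + norm (gver t y - gver t 0)"
        using norm_triangle_ineq[of "gver t 0" "gver t y - gver t 0"] by simp
      also have "\<dots> \<le> G + (\<beta> + 2) * norm y"
        using G[OF t] gver_lipschitz[OF tp lt, of y 0] by (simp add: gfun_eq_gver[OF tp] add_mono)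
      finally have "(norm (gver t y))\<^sup>2 \<le> (G + (\<beta> + 2) * norm y)\<^sup>2" by (intro power_mono) auto
      also have "\<dots> \<le> 2 * G\<^sup>2 + 2 * ((\<beta> + 2) * norm y)\<^sup>2"
        using sum_squares_bound[of G "(\<beta> + 2) * norm y"] by (simp add: power2_sum)
      finally show ?thesis by (simp add: power_mult_distrib)
    qed
    have a: "(alpha t)\<^sup>2 \<le> 1" "hvar t \<le> 1" using tp by (simp_all add: alpha_def hvar_def power_le_one)
    then have ht: "htil c t \<le> (noise c)\<^sup>2 + 1"
      unfolding htil_def by (intro add_mono mult_left_le_one_le) auto
    have "(\<integral>\<^sup>+x. ennreal ((norm (gver t (transpose ?A *v x)))\<^sup>2) \<partial>?L)
      \<le> (\<integral>\<^sup>+x. ennreal (2 * G\<^sup>2) + ennreal (2 * (\<beta> + 2)\<^sup>2) * ennreal ((norm (transpose ?A *v x))\<^sup>2) \<partial>?L)"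
      using bd by (intro nn_integral_mono) (simp add: ennreal_mult[symmetric] ennreal_plus[symmetric] del: ennreal_plus)
    also have "\<dots> = ennreal (2 * G\<^sup>2) + ennreal (2 * (\<beta> + 2)\<^sup>2) * (ennreal (real CARD('d) * htil c t) + ennreal ((alpha t)\<^sup>2) * ennreal M)"
      using L.emeasure_space_1
      by (simp add: nn_integral_add nn_integral_cmult nn_integral_fwd_law_latent_norm_squared[OF tp] M)
    also have "\<dots> = ennreal (2 * G\<^sup>2 + 2 * (\<beta> + 2)\<^sup>2 * (real CARD('d) * htil c t + (alpha t)\<^sup>2 * M))"
      using M htil_pos[OF tp] by (simp add: ennreal_mult)
    also have "\<dots> \<le> ennreal K"
      unfolding K_def using ht a M by (intro ennreal_leI add_mono mult_left_mono mult_left_le_one_le order_refl) auto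
    finally show "(\<integral>\<^sup>+x. ennreal ((norm (gver t (transpose ?A *v x)))\<^sup>2) \<partial>?L) \<le> ennreal K" .
  qed
qed

text \<open>Written over Lebesgue measure, which does not vary with \<open>t\<close>, and with a
  jointly measurable integrand, so that the entries are measurable in \<open>t\<close>.\<close>

definition Mver :: "real \<Rightarrow> real^'d^'d" where
  "Mver t = (\<chi> a b. \<integral>x. dens t x * (gver t (transpose (basis c) *v x) $ a * gver t (transpose (basis c) *v x) $ b) \<partial>lborel)"

lemma second_moment_g_eq: "0 < t \<Longrightarrow> second_moment_g c t = Mver t"
  unfolding second_moment_g_def Mver_def fwd_law_eq
  using dens_pos[of t] by (subst integral_density) (auto simp: gfun_eq_gver less_imp_le)

lemma transpose_Mver: "transpose (Mver t) = Mver t"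
  by (simp add: Mver_def transpose_def vec_eq_iff mult.commute)

lemma borel_measurable_lambda_max_Mver [measurable]: "(\<lambda>t. lambda_max (Mver t)) \<in> borel_measurable borel"
proof (rule borel_measurable_lambda_max)
  fix a b
  show "(\<lambda>t. Mver t $ a $ b) \<in> borel_measurable borel"
    unfolding Mver_def vec_lambda_beta
    by (rule lborel.borel_measurable_lebesgue_integral) measurable
qed (rule transpose_Mver)

text \<open>The entries are Bochner integrals, so finiteness of the moment is what excludes the
  default value 0: every product of two coordinates of \<open>g\<close> is dominated by
  \<open>|g|^2\<close>, and the quadratic form is then a genuine expectation.\<close>

lemma Mver_quadratic_form:
  assumes t: "0 < t" and fin: "(\<integral>\<^sup>+x. ennreal ((norm (gver t (transpose (basis c) *v x)))\<^sup>2) \<partial>fwd_law (data_law c) t) < \<infinity>"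
  shows "(\<integral>\<^sup>+x. ennreal ((r \<bullet> gver t (transpose (basis c) *v x))\<^sup>2) \<partial>fwd_law (data_law c) t) = ennreal (r \<bullet> (Mver t *v r))"
    and "0 \<le> r \<bullet> (Mver t *v r)"
proof -
  let ?L = "fwd_law (data_law c) t" and ?g = "\<lambda>x. gver t (transpose (basis c) *v x)"
  have i0: "integrable ?L (\<lambda>x. (norm (?g x))\<^sup>2)"
    using fin by (intro integrableI_bounded) (auto simp: fwd_law_def)
  have i1: "integrable ?L (\<lambda>x. ?g x $ a * ?g x $ b)" for a b
  proof (rule Bochner_Integration.integrable_bound[OF i0])
    show "AE x in ?L. norm (?g x $ a * ?g x $ b) \<le> norm ((norm (?g x))\<^sup>2)"
      by (auto simp: abs_mult power2_eq_square intro!: mult_mono component_le_norm_cart)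
  qed (auto simp: fwd_law_def)
  have i2: "integrable ?L (\<lambda>x. r $ a * (?g x $ a * ?g x $ b * r $ b))" for a b
    using i1[of a b] by simp
  have eq: "(r \<bullet> ?g x)\<^sup>2 = (\<Sum>a\<in>UNIV. \<Sum>b\<in>UNIV. r $ a * (?g x $ a * ?g x $ b * r $ b))" for x
    by (simp add: inner_vec_def power2_eq_square sum_product mult_ac)
  have M: "Mver t $ a $ b = (\<integral>x. ?g x $ a * ?g x $ b \<partial>?L)" for a b
    unfolding second_moment_g_eq[OF t, symmetric] second_moment_g_def by (simp add: gfun_eq_gver[OF t])
  have "r \<bullet> (Mver t *v r) = (\<Sum>a\<in>UNIV. \<Sum>b\<in>UNIV. r $ a * ((\<integral>x. ?g x $ a * ?g x $ b \<partial>?L) * r $ b))"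
    by (simp add: inner_vec_def matrix_vector_mult_def M sum_distrib_left)
  also have "\<dots> = (\<integral>x. (r \<bullet> ?g x)\<^sup>2 \<partial>?L)"
    unfolding eq using i2 by (simp add: Bochner_Integration.integral_sum)
  finally have q: "r \<bullet> (Mver t *v r) = (\<integral>x. (r \<bullet> ?g x)\<^sup>2 \<partial>?L)" .
  have "integrable ?L (\<lambda>x. (r \<bullet> ?g x)\<^sup>2)"
    unfolding eq using i2 by (intro Bochner_Integration.integrable_sum)
  then show "(\<integral>\<^sup>+x. ennreal ((r \<bullet> ?g x)\<^sup>2) \<partial>?L) = ennreal (r \<bullet> (Mver t *v r))"
    unfolding q by (intro nn_integral_eq_integral) auto
  show "0 \<le> r \<bullet> (Mver t *v r)" unfolding q by (intro integral_nonneg_AE) auto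
qed

text \<open>Row by row: the expectation of the squared \<open>i\<close>-th coordinate is the
  quadratic form at the row \<open>B $ i\<close>, at most the top eigenvalue times the squared
  length of that row; these lengths add up to the squared Frobenius norm.\<close>

lemma nn_integral_fwd_law_gver_le:
  fixes B :: "real^'d^'k"
  assumes t: "0 < t" and fin: "(\<integral>\<^sup>+x. ennreal ((norm (gver t (transpose (basis c) *v x)))\<^sup>2) \<partial>fwd_law (data_law c) t) < \<infinity>"
  shows "(\<integral>\<^sup>+x. ennreal ((norm (B *v gver t (transpose (basis c) *v x)))\<^sup>2) \<partial>fwd_law (data_law c) t)
    \<le> ennreal (lambda_max (Mver t) * (norm B)\<^sup>2)"
proof -
  let ?L = "fwd_law (data_law c) t" and ?g = "\<lambda>x. gver t (transpose (basis c) *v x)"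
  have le: "r \<bullet> (Mver t *v r) \<le> lambda_max (Mver t) * (norm r)\<^sup>2" for r
    using lambda_max_rayleigh[OF transpose_Mver] by metis
  have "(norm (B *v ?g x))\<^sup>2 = (\<Sum>i\<in>UNIV. (B $ i \<bullet> ?g x)\<^sup>2)" for x
    by (simp add: norm_vec_def L2_set_def sum_nonneg matrix_vector_mul_component)
  then have "(\<integral>\<^sup>+x. ennreal ((norm (B *v ?g x))\<^sup>2) \<partial>?L) = (\<integral>\<^sup>+x. (\<Sum>i\<in>UNIV. ennreal ((B $ i \<bullet> ?g x)\<^sup>2)) \<partial>?L)"
    by simp
  also have "\<dots> = (\<Sum>i\<in>UNIV. ennreal (B $ i \<bullet> (Mver t *v (B $ i))))"
    by (subst nn_integral_sum) (auto simp: fwd_law_def Mver_quadratic_form[OF t fin, unfolded fwd_law_def])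
  also have "\<dots> = ennreal (\<Sum>i\<in>UNIV. B $ i \<bullet> (Mver t *v (B $ i)))"
    by (intro sum_ennreal Mver_quadratic_form(2)[OF t fin])
  also have "\<dots> \<le> ennreal (\<Sum>i\<in>UNIV. lambda_max (Mver t) * (norm (B $ i))\<^sup>2)"
    by (intro ennreal_leI sum_mono le)
  finally show ?thesis by (simp add: power2_norm_matrix sum_distrib_left)
qed

text \<open>At a unit vector \<open>v\<close> attaining the Rayleigh quotient the eigenvalue is the
  expectation of \<open>(v . g)^2\<close>, which lies between 0 and that of \<open>|g|^2\<close>.
  The maximum with 0 is there because \<open>ennreal\<close> reads a negative \<open>K\<close> as
  0.\<close>

lemma lambda_max_Mver_bounds:
  assumes t: "0 < t" and K: "(\<integral>\<^sup>+x. ennreal ((norm (gver t (transpose (basis c) *v x)))\<^sup>2) \<partial>fwd_law (data_law c) t) \<le> ennreal K"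
  shows "0 \<le> lambda_max (Mver t)" "lambda_max (Mver t) \<le> max 0 K"
proof -
  let ?L = "fwd_law (data_law c) t" and ?g = "\<lambda>x. gver t (transpose (basis c) *v x)"
  have fin: "(\<integral>\<^sup>+x. ennreal ((norm (?g x))\<^sup>2) \<partial>?L) < \<infinity>"
    using K by (rule le_less_trans) simp
  obtain v where v: "norm v = 1" "lambda_max (Mver t) = v \<bullet> (Mver t *v v)"
    using lambda_max_rayleigh[OF transpose_Mver] by metis
  show "0 \<le> lambda_max (Mver t)" unfolding v(2) by (rule Mver_quadratic_form(2)[OF t fin])
  have "(v \<bullet> y)\<^sup>2 \<le> (norm y)\<^sup>2" for y
    using Cauchy_Schwarz_ineq2[of v y] v(1) by (simp add: abs_le_square_iff[symmetric])
  then have "ennreal (lambda_max (Mver t)) \<le> (\<integral>\<^sup>+x. ennreal ((norm (?g x))\<^sup>2) \<partial>?L)"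
    unfolding v(2) Mver_quadratic_form(1)[OF t fin, symmetric] by (intro nn_integral_mono ennreal_leI)
  also have "\<dots> \<le> ennreal (max 0 K)" using K by (rule order_trans) (simp add: ennreal_leI)
  finally show "lambda_max (Mver t) \<le> max 0 K" by (subst (asm) ennreal_le_iff) auto
qed

lemma nn_integral_fwd_law_Gfun_le:
  fixes U :: "real^'m^'n"
  assumes t: "0 < t" and fin: "(\<integral>\<^sup>+x. ennreal ((norm (gver t (transpose (basis c) *v x)))\<^sup>2) \<partial>fwd_law (data_law c) t) < \<infinity>"
    and U: "orthonormal_columns U"
  shows "(\<integral>\<^sup>+x. ennreal ((norm (proj_perp U *v Gfun c t x))\<^sup>2) \<partial>fwd_law (data_law c) t)
    \<le> ennreal (lambda_max (second_moment_g c t) * (norm (proj_perp U ** basis c))\<^sup>2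
        + (alpha t) ^ 4 * (noise c) ^ 4 / htil c t * trace (proj_perp U ** proj_perp (basis c)))"
proof -
  let ?A = "basis c" and ?L = "fwd_law (data_law c) t"
  let ?B = "rho c t *\<^sub>R proj_perp U" and ?g = "\<lambda>y. (proj_perp U ** ?A) *v gver t y"
  note tr = nn_integral_fwd_law_perp[OF t U]
  have v: "0 < htil c t" by (rule htil_pos[OF t])
  have "proj_perp U *v Gfun c t x = ?g (transpose ?A *v x) + ?B *v (proj_perp ?A *v x)" for x
    by (simp add: Gfun_def gfun_eq_gver[OF t] matrix_vector_right_distrib matrix_vector_mult_scaleR
        flip: scaleR_matrix_vector_assoc matrix_vector_mul_assoc)
  then have "(\<integral>\<^sup>+x. ennreal ((norm (proj_perp U *v Gfun c t x))\<^sup>2) \<partial>?L)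
     = (\<integral>\<^sup>+x. ennreal ((norm (?g (transpose ?A *v x) + ?B *v (proj_perp ?A *v x)))\<^sup>2) \<partial>?L)"
    by simp
  also have "\<dots> = (\<integral>\<^sup>+x. ennreal ((norm (?g (transpose ?A *v x)))\<^sup>2) \<partial>?L)
      + (\<integral>\<^sup>+x. ennreal ((norm (?B *v (proj_perp ?A *v x)))\<^sup>2) \<partial>?L)"
    by (rule nn_integral_fwd_law_orthogonal_sum[OF t]) measurable
  also have "(\<integral>\<^sup>+x. ennreal ((norm (?B *v (proj_perp ?A *v x)))\<^sup>2) \<partial>?L)
      = (\<integral>\<^sup>+x. ennreal ((rho c t)\<^sup>2) * ennreal ((norm (proj_perp U *v (proj_perp ?A *v x)))\<^sup>2) \<partial>?L)"
    by (simp add: scaleR_matrix_vector_assoc[symmetric] power_mult_distrib ennreal_mult')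
  also have "\<dots> = ennreal ((rho c t)\<^sup>2) * ennreal (htil c t * trace (proj_perp U ** proj_perp ?A))"
    unfolding tr(1)[symmetric] by (subst nn_integral_cmult) (auto simp: fwd_law_def)
  also have "\<dots> = ennreal ((alpha t) ^ 4 * (noise c) ^ 4 / htil c t * trace (proj_perp U ** proj_perp ?A))"
  proof -
    \<comment> \<open>Up to division by \<open>hvar^2\<close> this is the integrand of
      \<open>nbar\<close>.\<close>
    have "(rho c t)\<^sup>2 * htil c t = (alpha t) ^ 4 * (noise c) ^ 4 / htil c t"
      using v by (simp add: rho_def power_divide power_mult_distrib power2_eq_square eval_nat_numeral)
    then show ?thesis by (simp add: ennreal_mult'[symmetric] mult.assoc[symmetric])
  qed
  also have "(\<integral>\<^sup>+x. ennreal ((norm (?g (transpose ?A *v x)))\<^sup>2) \<partial>?L) + \<dots> \<le>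
     ennreal (lambda_max (Mver t) * (norm (proj_perp U ** ?A))\<^sup>2) + \<dots>"
    by (intro add_right_mono nn_integral_fwd_law_gver_le[OF t fin])
  also have "\<dots> = ennreal (lambda_max (second_moment_g c t) * (norm (proj_perp U ** ?A))\<^sup>2
        + (alpha t) ^ 4 * (noise c) ^ 4 / htil c t * trace (proj_perp U ** proj_perp ?A))"
    using v tr(2) lambda_max_Mver_bounds(1)[OF t, of "enn2real (\<integral>\<^sup>+x. ennreal ((norm (gver t (transpose (basis c) *v x)))\<^sup>2) \<partial>fwd_law (data_law c) t)"] fin
    by (subst ennreal_plus) (simp_all add: second_moment_g_eq[OF t])
  finally show ?thesis .
qed

text \<open>On the interval \<open>hvar\<close> is at least \<open>hvar t0 > 0\<close>, so a bounded
  eigenvalue gives a bounded integrand; the cut-off \<open>t0\<close> keeps the singularity at time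
  0 away.\<close>

lemma set_integrable_cbar:
  assumes t0: "0 < t0" and K: "\<And>t. t \<in> {t0..T} \<Longrightarrow>
    (\<integral>\<^sup>+x. ennreal ((norm (gver t (transpose (basis c) *v x)))\<^sup>2) \<partial>fwd_law (data_law c) t) \<le> ennreal K"
  shows "set_integrable lborel {t0..T} (\<lambda>t. lambda_max (second_moment_g c t) / (hvar t)\<^sup>2)"
proof -
  have h0: "0 < hvar t0" by (rule hvar_pos[OF t0])
  have "set_integrable lborel {t0..T} (\<lambda>t. lambda_max (Mver t) / (hvar t)\<^sup>2)"
    unfolding set_integrable_def
  proof (rule integrableI_bounded_set_indicator)
    show "AE t in lborel. t \<in> {t0..T} \<longrightarrow> norm (lambda_max (Mver t) / (hvar t)\<^sup>2) \<le> max 0 K / (hvar t0)\<^sup>2"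
    proof (rule AE_I2, rule impI)
      fix t assume t: "t \<in> {t0..T}"
      then have tp: "0 < t" using t0 by simp
      have "hvar t0 \<le> hvar t" using t by (simp add: hvar_def)
      then have "(hvar t0)\<^sup>2 \<le> (hvar t)\<^sup>2" using h0 by (intro power_mono) auto
      then show "norm (lambda_max (Mver t) / (hvar t)\<^sup>2) \<le> max 0 K / (hvar t0)\<^sup>2"
        using lambda_max_Mver_bounds[OF tp K[OF t]] h0 hvar_pos[OF tp] by (simp add: frac_le)
    qed
  qed (auto simp: emeasure_lborel_Icc_eq)
  also have "?this \<longleftrightarrow> ?thesis"
    using t0 by (intro set_integrable_cong) (auto simp: second_moment_g_eq)
  finally show ?thesis .
qed

lemma set_integrable_nbar:
  assumes t0: "0 < t0"
  shows "set_integrable lborel {t0..T} (\<lambda>t. (alpha t) ^ 4 * (noise c) ^ 4 / ((hvar t)\<^sup>2 * htil c t))"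
proof (rule borel_integrable_atLeastAtMost')
  have "hvar t \<noteq> 0" "htil c t \<noteq> 0" if "t \<in> {t0..T}" for t
    using that t0 hvar_pos[of t] htil_pos[of t] by auto
  then show "continuous_on {t0..T} (\<lambda>t. (alpha t) ^ 4 * (noise c) ^ 4 / ((hvar t)\<^sup>2 * htil c t))"
    unfolding alpha_def[abs_def] hvar_def[abs_def] htil_def[abs_def] by (auto intro!: continuous_intros)
qed

end

section \<open>The projected process\<close>

context mixture_component
begin

text \<open>\<open>qdens\<close> chooses a version of the density separately at each time, so it need not be jointly
  measurable in time and space; \<open>qmass\<close> is a version that is.\<close>

definition qmass :: "real^'m^'n \<Rightarrow> real \<Rightarrow> real^'m \<Rightarrow> ennreal" where
  "qmass U t w = (\<integral>\<^sup>+x. ennreal (dens t (proj_perp U *v x + U *v w)) * ennreal (gauss 0 1 (w - transpose U *v x)) \<partial>lborel)"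

lemma borel_measurable_qmass [measurable]:
  assumes [measurable]: "f \<in> borel_measurable N" "g \<in> borel_measurable N"
  shows "(\<lambda>x. qmass U (f x) (g x)) \<in> borel_measurable N"
  unfolding qmass_def by (rule lborel.borel_measurable_nn_integral) measurable

text \<open>The adjoint identity for Lebesgue integrals, applied to indicator functions, identifies
  \<open>qmass\<close> as a density of the projected process.\<close>

lemma distr_fwd_law:
  assumes t: "0 < t" and U: "orthonormal_columns U"
  shows "distr (fwd_law (data_law c) t) borel ((*v) (transpose U)) = density lborel (qmass U t)"
proof (rule measure_eqI)
  fix A assume "A \<in> sets (distr (fwd_law (data_law c) t) borel ((*v) (transpose U)))"
  then have [measurable]: "A \<in> sets borel" by simp
  have m: "(*v) (transpose U) \<in> measurable (fwd_law (data_law c) t) borel"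
    using borel_measurable_matrix_vector_mult[of "\<lambda>x. x"] by simp
  have "emeasure (distr (fwd_law (data_law c) t) borel ((*v) (transpose U))) A
     = (\<integral>\<^sup>+x. indicator A x \<partial>distr (fwd_law (data_law c) t) borel ((*v) (transpose U)))"
    by simp
  also have "\<dots> = (\<integral>\<^sup>+x. indicator A (transpose U *v x) \<partial>fwd_law (data_law c) t)"
    by (rule nn_integral_distr[OF m]) measurable
  also have "\<dots> = (\<integral>\<^sup>+x. ennreal (dens t x) * indicator A (transpose U *v x) \<partial>lborel)"
    by (subst nn_integral_fwd_law[OF t]) auto
  also have "\<dots> = (\<integral>\<^sup>+w. indicator A w * qmass U t w \<partial>lborel)"
    unfolding qmass_def by (rule nn_integral_isometry_adjoint[OF U]) measurable
  also have "\<dots> = emeasure (density lborel (qmass U t)) A"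
    by (subst emeasure_density) (auto simp: mult.commute)
  finally show "emeasure (distr (fwd_law (data_law c) t) borel ((*v) (transpose U))) A
      = emeasure (density lborel (qmass U t)) A" .
qed simp

text \<open>Uniqueness of the Radon-Nikodym derivative holds up to Lebesgue null sets of
  \<open>w\<close>. These are null for the law of \<open>U^T X\<close>, hence their preimages are
  null for the law of \<open>X\<close>, and therefore Lebesgue null since the density of
  \<open>X\<close> is positive everywhere.\<close>

lemma AE_qdens:
  assumes t: "0 < t" and U: "orthonormal_columns U"
  shows "AE x in lborel. qdens c U t (transpose U *v x) = enn2real (qmass U t (transpose U *v x)) \<and>
     0 < qdens c U t (transpose U *v x)"
proof -
  let ?L = "fwd_law (data_law c) t" and ?P = "\<lambda>w. qdens c U t w = enn2real (qmass U t w) \<and> 0 < qdens c U t w"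
  have m [measurable]: "(*v) (transpose U) \<in> measurable ?L borel"
    using borel_measurable_matrix_vector_mult[of "\<lambda>x. x" ?L] by (simp add: fwd_law_def)
  interpret L: prob_space ?L by (rule prob_space_fwd_law[OF t])
  interpret D: prob_space "distr ?L borel ((*v) (transpose U))" by (rule L.prob_space_distr[OF m])
  have 1: "AE w in lborel. qmass U t w = RN_deriv lborel (distr ?L borel ((*v) (transpose U))) w"
    by (intro sigma_finite_measure.RN_deriv_unique sigma_finite_lborel distr_fwd_law[OF t U, symmetric]) measurable
  have "(\<integral>\<^sup>+w. qmass U t w \<partial>lborel) = 1"
    using D.emeasure_space_1 unfolding distr_fwd_law[OF t U] by (simp add: emeasure_density)
  then have 2: "AE w in lborel. qmass U t w \<noteq> \<infinity>"
    by (intro nn_integral_PInf_AE) auto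
  \<comment> \<open>Points where the density vanishes may form a set of positive Lebesgue measure,
    but the projected law does not charge it.\<close>
  have "AE w in lborel. 0 < qmass U t w \<longrightarrow> ?P w"
    using 1 2 by eventually_elim (auto simp: qdens_def enn2real_positive_iff less_top)
  then have "AE w in distr ?L borel ((*v) (transpose U)). ?P w"
    unfolding distr_fwd_law[OF t U] by (subst AE_density) auto
  then have "AE x in ?L. ?P (transpose U *v x)"
    by (rule AE_distrD[OF m])
  then have "AE x in lborel. 0 < ennreal (dens t x) \<longrightarrow> ?P (transpose U *v x)"
    unfolding fwd_law_eq[OF t] by (subst (asm) AE_density) auto
  then show ?thesis by (simp add: dens_pos[OF t])
qed

lemma borel_measurable_qdens [measurable]: "qdens c U t \<in> borel_measurable borel"
  unfolding qdens_def[abs_def] by measurable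

lemma psi_eq: "0 < t \<Longrightarrow> psi c U z t
    = (transpose U ** basis c) *v gver t (pinv (transpose U ** basis c) *v z)"
  by (simp add: psi_def Let_def gfun_eq_gver)

lemma Gfun_eq: "0 < t \<Longrightarrow> Gfun c t x = basis c *v gver t (transpose (basis c) *v x) + rho c t *\<^sub>R (proj_perp (basis c) *v x)"
  by (simp add: Gfun_def gfun_eq_gver)

lemma prob_space_data_law: "prob_space (data_law c)"
proof -
  have "prob_space (density lborel (\<lambda>e::real^'n. ennreal (gauss 0 ((noise c)\<^sup>2) e)))"
    by standard (use noise_pos in \<open>simp add: emeasure_density nn_integral_gauss\<close>)
  then interpret N: prob_space "density lborel (\<lambda>e::real^'n. ennreal (gauss 0 ((noise c)\<^sup>2) e))" .
  interpret P: pair_prob_space "latent_law c" "density lborel (\<lambda>e::real^'n. ennreal (gauss 0 ((noise c)\<^sup>2) e))" ..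
  show ?thesis
    unfolding data_law_def latent_law_def[symmetric]
    by (rule P.prob_space_distr) measurable
qed

lemma sets_data_law [simp]: "sets (data_law c) = sets borel"
  by (simp add: data_law_def)

end

section \<open>Pointwise decomposition of the risk\<close>

lemma young_norm:
  fixes a b :: "'a::real_inner"
  assumes "0 < \<eta>"
  shows "(norm (a + b))\<^sup>2 \<le> (1 + 1 / \<eta>) * (norm a)\<^sup>2 + (1 + \<eta>) * (norm b)\<^sup>2"
proof -
  have "0 \<le> (norm ((1 / sqrt \<eta>) *\<^sub>R a - sqrt \<eta> *\<^sub>R b))\<^sup>2" by simp
  also have "\<dots> = 1 / \<eta> * (a \<bullet> a) + \<eta> * (b \<bullet> b) - 2 * (a \<bullet> b)"
    using assms unfolding power2_norm_eq_inner
    by (simp add: inner_diff_left inner_diff_right inner_commute flip: mult.assoc)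
  finally show ?thesis
    unfolding power2_norm_eq_inner by (simp add: inner_add_left inner_add_right inner_commute algebra_simps)
qed

lemma convex_norm_squared:
  fixes a b :: "'a::real_inner"
  assumes "0 \<le> p" "0 \<le> q" "p + q = 1"
  shows "(norm (p *\<^sub>R a + q *\<^sub>R b))\<^sup>2 \<le> p * (norm a)\<^sup>2 + q * (norm b)\<^sup>2"
proof -
  have q: "q = 1 - p" using assms by simp
  have "p * (norm a)\<^sup>2 + q * (norm b)\<^sup>2 - (norm (p *\<^sub>R a + q *\<^sub>R b))\<^sup>2 = p * q * (norm (a - b))\<^sup>2"
    unfolding power2_norm_eq_inner q
    by (simp add: inner_add_left inner_add_right inner_diff_left inner_diff_right inner_commute algebra_simps)
  also have "\<dots> \<ge> 0" using assms by simp
  finally show ?thesis by simp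
qed

lemma norm_squared_isometry_split:
  assumes U: "orthonormal_columns U"
  shows "(norm (U *v f - G))\<^sup>2 = (norm (f - transpose U *v G))\<^sup>2 + (norm (proj_perp U *v G))\<^sup>2"
proof -
  let ?u = "f - transpose U *v G" and ?g = "proj_perp U *v G"
  have "U *v f - G = U *v ?u - ?g"
    by (simp add: proj_perp_mult matrix_vector_mult_diff_distrib)
  moreover have "(U *v ?u) \<bullet> ?g = 0"
    using inner_transpose_matrix[of U ?g ?u] transpose_proj_perp[OF U, of G]
    by (simp add: inner_commute)
  moreover have "(U *v ?u) \<bullet> (U *v ?u) = ?u \<bullet> ?u"
    using norm_orthonormal_columns[OF U, of ?u] by (simp add: norm_eq_sqrt_inner)
  ultimately show ?thesis
    unfolding power2_norm_eq_inner by (simp add: inner_diff_left inner_diff_right inner_commute)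
qed

lemma risk_decomposition:
  fixes U :: "real^'m^'n" and f a1 a2 :: "real^'m" and G1 G2 :: "real^'n"
  assumes U: "orthonormal_columns U" and \<eta>: "0 < \<eta>" and p: "0 \<le> p1" "0 \<le> p2" "p1 + p2 = 1" and q: "q1 + q2 = 1"
  shows "(norm (U *v f - (p1 *\<^sub>R G1 + p2 *\<^sub>R G2)))\<^sup>2 \<le>
     (1 + 1 / \<eta>) * (norm (f - (q1 *\<^sub>R a1 + q2 *\<^sub>R a2)))\<^sup>2
     + (1 + \<eta>) * ((p1 * (norm (proj_perp U *v G1))\<^sup>2 + p2 * (norm (proj_perp U *v G2))\<^sup>2)
        + 2 * (p1 * (norm (a1 - transpose U *v G1))\<^sup>2 + p2 * (norm (a2 - transpose U *v G2))\<^sup>2)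
        + 2 * ((q1 - p1)\<^sup>2 * (norm (a1 - a2))\<^sup>2))"
proof -
  let ?G = "p1 *\<^sub>R G1 + p2 *\<^sub>R G2" and ?c = "q1 *\<^sub>R a1 + q2 *\<^sub>R a2"
  let ?e = "p1 *\<^sub>R (a1 - transpose U *v G1) + p2 *\<^sub>R (a2 - transpose U *v G2)"
  let ?d = "(q1 - p1) *\<^sub>R (a1 - a2)"
  have p2: "p2 = 1 - p1" and q2: "q2 = 1 - q1" using p q by auto
  have B: "?c - transpose U *v ?G = ?e + ?d"
    unfolding p2 q2 by (simp add: matrix_vector_right_distrib matrix_vector_mult_scaleR algebra_simps)
  have 1: "(norm (f - transpose U *v ?G))\<^sup>2 \<le> (1 + 1 / \<eta>) * (norm (f - ?c))\<^sup>2 + (1 + \<eta>) * (norm (?e + ?d))\<^sup>2"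
    using young_norm[OF \<eta>, of "f - ?c" "?e + ?d"] unfolding B[symmetric] by simp
  have 2: "(norm (?e + ?d))\<^sup>2 \<le> 2 * (norm ?e)\<^sup>2 + 2 * (norm ?d)\<^sup>2"
    using young_norm[of 1 ?e ?d] by simp
  have 3: "(norm ?e)\<^sup>2 \<le> p1 * (norm (a1 - transpose U *v G1))\<^sup>2 + p2 * (norm (a2 - transpose U *v G2))\<^sup>2"
    by (rule convex_norm_squared[OF p])
  have 4: "(norm ?d)\<^sup>2 = (q1 - p1)\<^sup>2 * (norm (a1 - a2))\<^sup>2" by (simp add: power_mult_distrib)
  have 5: "(norm (proj_perp U *v ?G))\<^sup>2 \<le> p1 * (norm (proj_perp U *v G1))\<^sup>2 + p2 * (norm (proj_perp U *v G2))\<^sup>2"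
    using convex_norm_squared[OF p] by (simp add: matrix_vector_right_distrib matrix_vector_mult_scaleR)
  \<comment> \<open>The part outside the range carries no factor from Young's inequality; it is
    enlarged by \<open>1 + \<eta>\<close> so that it fits into the common bracket.\<close>
  have 6: "(norm (proj_perp U *v ?G))\<^sup>2 \<le> (1 + \<eta>) * (norm (proj_perp U *v ?G))\<^sup>2"
    using \<eta> by (simp add: mult_le_cancel_right1 mult_right_le_one_le)
  have "(1 + \<eta>) * (norm (?e + ?d))\<^sup>2 + (1 + \<eta>) * (norm (proj_perp U *v ?G))\<^sup>2
     \<le> (1 + \<eta>) * ((p1 * (norm (proj_perp U *v G1))\<^sup>2 + p2 * (norm (proj_perp U *v G2))\<^sup>2)
        + 2 * (p1 * (norm (a1 - transpose U *v G1))\<^sup>2 + p2 * (norm (a2 - transpose U *v G2))\<^sup>2)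
        + 2 * ((q1 - p1)\<^sup>2 * (norm (a1 - a2))\<^sup>2))"
    unfolding distrib_left[symmetric] using \<eta> 2 3 5 unfolding 4 by (intro mult_left_mono) auto
  then show ?thesis
    unfolding norm_squared_isometry_split[OF U] using 1 6 by linarith
qed

section \<open>Averages over time\<close>

text \<open>Only the restriction to the interval is asked to be measurable, because the integrands
  agree with their measurable versions only at positive times.\<close>

definition time_measurable :: "real \<Rightarrow> real \<Rightarrow> (real \<Rightarrow> ennreal) \<Rightarrow> bool" where
  "time_measurable t0 T F \<longleftrightarrow> (\<lambda>t. F t * indicator {t0..T} t) \<in> borel_measurable lborel"

lemma time_measurable_cong:
  assumes "\<And>t. t \<in> {t0..T} \<Longrightarrow> F t = G t" and [measurable]: "G \<in> borel_measurable borel"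
  shows "time_measurable t0 T F"
proof -
  have "(\<lambda>t. F t * indicator {t0..T} t) = (\<lambda>t. G t * indicator {t0..T} t)"
    using assms(1) by (auto simp: fun_eq_iff indicator_def)
  then show ?thesis by (simp add: time_measurable_def)
qed

lemma time_measurable_add:
  "time_measurable t0 T F \<Longrightarrow> time_measurable t0 T G \<Longrightarrow> time_measurable t0 T (\<lambda>t. F t + G t)"
  unfolding time_measurable_def by (simp add: distrib_right)

lemma time_measurable_cmult:
  "time_measurable t0 T F \<Longrightarrow> time_measurable t0 T (\<lambda>t. k * F t)"
  unfolding time_measurable_def by (simp add: mult.assoc)

lemma time_avg_add:
  "time_measurable t0 T F \<Longrightarrow> time_measurable t0 T G \<Longrightarrow>
    time_avg t0 T (\<lambda>t. F t + G t) = time_avg t0 T F + time_avg t0 T G"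
  unfolding time_measurable_def time_avg_def by (simp add: distrib_right nn_integral_add distrib_left)

lemma time_avg_cmult:
  "time_measurable t0 T F \<Longrightarrow> time_avg t0 T (\<lambda>t. k * F t) = k * time_avg t0 T F"
  unfolding time_measurable_def time_avg_def by (simp add: mult.assoc nn_integral_cmult) (simp add: mult.left_commute)

lemma time_avg_mono:
  "(\<And>t. t \<in> {t0..T} \<Longrightarrow> F t \<le> G t) \<Longrightarrow> time_avg t0 T F \<le> time_avg t0 T G"
  unfolding time_avg_def by (intro mult_left_mono nn_integral_mono) (auto simp: indicator_def)

text \<open>The bridge from the real Bochner integrals in \<open>cbar\<close> and
  \<open>nbar\<close> to the \<open>ennreal\<close> averages of the error terms.\<close>

lemma time_avg_ennreal:
  assumes t: "t0 < T" and i: "set_integrable lborel {t0..T} e" and nn: "\<And>t. t \<in> {t0..T} \<Longrightarrow> 0 \<le> e t"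
  shows "time_avg t0 T (\<lambda>t. ennreal (e t)) = ennreal (1 / (T - t0) * (LINT t:{t0..T}|lborel. e t))"
    and "time_measurable t0 T (\<lambda>t. ennreal (e t))"
proof -
  have eq: "(\<lambda>t. ennreal (e t) * indicator {t0..T} t) = (\<lambda>t. ennreal (indicator {t0..T} t *\<^sub>R e t))"
    by (auto simp: fun_eq_iff indicator_def)
  have "(\<integral>\<^sup>+t. ennreal (indicator {t0..T} t *\<^sub>R e t) \<partial>lborel) = ennreal (LINT t:{t0..T}|lborel. e t)"
    unfolding set_lebesgue_integral_def
    by (intro nn_integral_eq_integral i[unfolded set_integrable_def]) (auto simp: nn indicator_def)
  then show "time_avg t0 T (\<lambda>t. ennreal (e t)) = ennreal (1 / (T - t0) * (LINT t:{t0..T}|lborel. e t))"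
    unfolding time_avg_def eq using t by (simp add: ennreal_mult'[symmetric] mult.commute)
  show "time_measurable t0 T (\<lambda>t. ennreal (e t))"
    unfolding time_measurable_def eq using i[unfolded set_integrable_def] by measurable
qed

section \<open>Measurability of ReLU networks\<close>

lemma borel_measurable_vec_lambda:
  fixes f :: "'a \<Rightarrow> real^'k"
  assumes "\<And>i. (\<lambda>x. f x $ i) \<in> borel_measurable N"
  shows "f \<in> borel_measurable N"
  unfolding borel_measurable_euclidean_space[of f]
  using assms by (auto simp: Basis_vec_def inner_axis)

lemma borel_measurable_relu_net:
  fixes z :: "'a \<Rightarrow> real^'m"
  assumes [measurable]: "z \<in> borel_measurable N" "t \<in> borel_measurable N"
  shows "(\<lambda>x. relu_net L n W b (z x) (t x)) \<in> borel_measurable N"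
proof -
  have aff: "(\<lambda>x. affine_layer n W b l (y x) j) \<in> borel_measurable N"
    if "\<And>k. (\<lambda>x. y x k) \<in> borel_measurable N" for y :: "'a \<Rightarrow> nat \<Rightarrow> real" and l j
    unfolding affine_layer_def using that by measurable
  have "(\<lambda>x. hidden n W b l (net_input (z x) (t x)) j) \<in> borel_measurable N" for l j
  proof (induction l arbitrary: j)
    case 0
    show ?case unfolding hidden.simps net_input_def
      by (cases "j < CARD('m)") (auto intro: borel_measurable_vec_nth)
  next
    case (Suc l)
    show ?case unfolding hidden.simps
      by (intro borel_measurable_max borel_measurable_const aff Suc)
  qed
  then show ?thesis
    unfolding relu_net_def by (intro borel_measurable_vec_lambda) (simp add: aff)
qed

lemma borel_measurable_relu_class:
  assumes "f \<in> relu_class T L M J K \<kappa> \<gamma> \<gamma>\<^sub>t"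
  shows "case_prod f \<in> borel_measurable (borel \<Otimes>\<^sub>M borel)"
proof -
  obtain n W b where f: "f = relu_net L n W b"
    using assms unfolding relu_class_def by blast
  show ?thesis
    unfolding f case_prod_beta' by (rule borel_measurable_relu_net) measurable
qed

section \<open>The mixture\<close>

text \<open>The expression has the shape of the pointwise risk bound after Bayes' rule, so that its
  passage to \<open>ennreal\<close> is a single rewriting under the integral.\<close>

lemma ennreal_risk_combination:
  assumes "0 \<le> k1" "0 \<le> k2" "0 \<le> k" "0 \<le> w1" "0 \<le> w2" "0 \<le> a" "0 \<le> e1" "0 \<le> e2" "0 \<le> r1" "0 \<le> r2" "0 \<le> p"
  shows "ennreal (k1 * (k * a) + k2 * (k * (w1 * e1 + w2 * e2) + 2 * (w1 * (k * r1) + w2 * (k * r2)) + 2 * (k * p)))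
    = ennreal k1 * (ennreal k * ennreal a) + ennreal k2 * (ennreal k * (ennreal w1 * ennreal e1 + ennreal w2 * ennreal e2)
       + 2 * (ennreal w1 * (ennreal k * ennreal r1) + ennreal w2 * (ennreal k * ennreal r2)) + 2 * (ennreal k * ennreal p))"
  using assms by (simp add: ennreal_mult)

text \<open>Read \<open>m\<close> as the mixture density, \<open>q1\<close>, \<open>q2\<close> as
  the posteriors and \<open>d1\<close>, \<open>d2\<close> as the component densities: the hypotheses
  are Bayes' rule, and multiplication by \<open>m\<close> turns posterior averages into averages
  over the components.\<close>

lemma bayes_rearrange:
  fixes m k :: real
  assumes b1: "m * q1 = w1 * d1" and b2: "m * q2 = w2 * d2"
  shows "m * (k * (A * a + E * ((q1 * e1 + q2 * e2) + 2 * (q1 * r1 + q2 * r2) + 2 * p)))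
    = A * (k * (m * a)) + E * (k * (w1 * (d1 * e1) + w2 * (d2 * e2)) + 2 * (w1 * (k * (d1 * r1)) + w2 * (k * (d2 * r2))) + 2 * (k * (m * p)))"
proof -
  have w: "w1 * (d1 * u) = m * q1 * u" "w2 * (d2 * u) = m * q2 * u"
    "w1 * (k * (d1 * u)) = k * (m * q1 * u)" "w2 * (k * (d2 * u)) = k * (m * q2 * u)" for u
    by (simp_all add: b1 b2)
  show ?thesis unfolding w by (simp add: algebra_simps)
qed

text \<open>For finite \<open>C\<close> the number \<open>(B - C) / k\<close> is a lower bound of
  all \<open>A f\<close>. The argument also covers an empty family, whose infimum is
  \<open>top\<close>; for \<open>C = top\<close>, where subtraction is useless, the claim is
  trivial.\<close>

lemma ennreal_le_add_mult_INF:
  fixes B C :: ennreal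
  assumes k: "0 < k" and le: "\<And>f. f \<in> F \<Longrightarrow> B \<le> C + ennreal k * A f"
  shows "B \<le> C + ennreal k * (INF f\<in>F. A f)"
proof (cases "C = top")
  case False
  have kk: "ennreal (1 / k) * ennreal k = 1" using k by (simp add: ennreal_mult[symmetric])
  have "ennreal (1 / k) * (B - C) \<le> (INF f\<in>F. A f)"
  proof (rule INF_greatest)
    fix f assume "f \<in> F"
    then have "B - C \<le> ennreal k * A f" using le[of f] False by (simp add: ennreal_minus_le_iff)
    then have "ennreal (1 / k) * (B - C) \<le> ennreal (1 / k) * (ennreal k * A f)" by (rule mult_left_mono) simp
    then show "ennreal (1 / k) * (B - C) \<le> A f" by (simp add: mult.assoc[symmetric] kk)
  qed
  then have "ennreal k * (ennreal (1 / k) * (B - C)) \<le> ennreal k * (INF f\<in>F. A f)" by (rule mult_left_mono) simp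
  then have "B - C \<le> ennreal k * (INF f\<in>F. A f)" by (simp add: mult.assoc[symmetric] kk mult.commute[of "ennreal k"])
  then show ?thesis using False by (simp add: ennreal_minus_le_iff)
qed simp

lemma borel_measurable_rho [measurable]: "rho c \<in> borel_measurable borel"
  unfolding rho_def[abs_def] by measurable

lemma (in mixture_component) time_measurable_R_integrand:
  fixes U :: "real^'m^'n"
  assumes t0: "0 < t0"
  shows "time_measurable t0 T (\<lambda>t. ennreal (1 / (hvar t)\<^sup>2) *
     (\<integral>\<^sup>+x. ennreal ((norm (psi c U (transpose U *v x) t - transpose U *v Gfun c t x))\<^sup>2) \<partial>fwd_law (data_law c) t))"
proof (rule time_measurable_cong)
  let ?H = "transpose U ** basis c"
  let ?F = "\<lambda>t x. ennreal ((norm (?H *v gver t (pinv ?H *v (transpose U *v x)) -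
       transpose U *v (basis c *v gver t (transpose (basis c) *v x) + rho c t *\<^sub>R (proj_perp (basis c) *v x))))\<^sup>2)"
  let ?G = "\<lambda>t. ennreal (1 / (hvar t)\<^sup>2) * (\<integral>\<^sup>+x. ennreal (dens t x) * ?F t x \<partial>lborel)"
  fix t assume "t \<in> {t0..T}"
  then have t: "0 < t" using t0 by simp
  show "ennreal (1 / (hvar t)\<^sup>2) *
     (\<integral>\<^sup>+x. ennreal ((norm (psi c U (transpose U *v x) t - transpose U *v Gfun c t x))\<^sup>2) \<partial>fwd_law (data_law c) t) = ?G t"
    unfolding psi_eq[OF t] Gfun_eq[OF t] by (subst nn_integral_fwd_law[OF t]) auto
next
  show "(\<lambda>t. ennreal (1 / (hvar t)\<^sup>2) * (\<integral>\<^sup>+x. ennreal (dens t x) * ennreal ((norm ((transpose U ** basis c) *v gver t (pinv (transpose U ** basis c) *v (transpose U *v x)) -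
       transpose U *v (basis c *v gver t (transpose (basis c) *v x) + rho c t *\<^sub>R (proj_perp (basis c) *v x))))\<^sup>2) \<partial>lborel)) \<in> borel_measurable borel"
    by measurable
qed

section \<open>Density, posteriors and score of the mixture\<close>

locale two_components =
  C1: mixture_component c1 + C2: mixture_component c2
  for c1 :: "('n::finite, 'd1::finite) component" and c2 :: "('n, 'd2::finite) component" +
  fixes w1 w2 :: real
  assumes w1: "0 < w1" and w2: "0 < w2" and w_sum: "w1 + w2 = 1"
begin

definition pmix :: "real \<Rightarrow> real^'n \<Rightarrow> real" where
  "pmix t x = w1 * C1.dens t x + w2 * C2.dens t x"

lemma borel_measurable_pmix [measurable]:
  assumes [measurable]: "f \<in> borel_measurable N" "g \<in> borel_measurable N"
  shows "(\<lambda>x. pmix (f x) (g x)) \<in> borel_measurable N"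
  unfolding pmix_def by measurable

lemma pmix_pos: "0 < t \<Longrightarrow> 0 < pmix t x"
  using C1.dens_pos C2.dens_pos w1 w2 by (simp add: pmix_def add_pos_pos)

lemma fwd_dens_mix: "0 < t \<Longrightarrow> fwd_dens (mix_law w1 w2 c1 c2) t = pmix t"
  using w1 w2 unfolding mix_law_def fun_eq_iff
  by (simp add: fwd_dens_mixture C1.prob_space_data_law C2.prob_space_data_law pmix_def
      C1.fwd_dens_eq_dens C2.fwd_dens_eq_dens)

lemma nn_integral_fwd_law_mix:
  assumes "0 < t" and [measurable]: "F \<in> borel_measurable borel"
  shows "(\<integral>\<^sup>+x. F x \<partial>fwd_law (mix_law w1 w2 c1 c2) t) = (\<integral>\<^sup>+x. ennreal (pmix t x) * F x \<partial>lborel)"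
  using assms(1) by (simp add: fwd_law_def fwd_dens_mix nn_integral_density)

definition post1 :: "real \<Rightarrow> real^'n \<Rightarrow> real" where "post1 t x = w1 * C1.dens t x / pmix t x"
definition post2 :: "real \<Rightarrow> real^'n \<Rightarrow> real" where "post2 t x = w2 * C2.dens t x / pmix t x"

lemma post_props:
  assumes t: "0 < t"
  shows "0 \<le> post1 t x" "0 \<le> post2 t x" "post1 t x + post2 t x = 1"
    "pmix t x * post1 t x = w1 * C1.dens t x" "pmix t x * post2 t x = w2 * C2.dens t x"
    "pi_fst w1 w2 c1 c2 x t = post1 t x"
proof -
  have p: "0 < pmix t x" "0 < C1.dens t x" "0 < C2.dens t x" using t by (auto simp: pmix_pos C1.dens_pos C2.dens_pos)
  show "0 \<le> post1 t x" "0 \<le> post2 t x" "pmix t x * post1 t x = w1 * C1.dens t x" "pmix t x * post2 t x = w2 * C2.dens t x"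
    using p w1 w2 by (simp_all add: post1_def post2_def)
  show "post1 t x + post2 t x = 1"
    using p by (simp add: post1_def post2_def add_divide_distrib[symmetric]) (simp add: pmix_def)
  show "pi_fst w1 w2 c1 c2 x t = post1 t x"
    using t by (simp add: pi_fst_def fwd_dens_mix C1.fwd_dens_eq_dens post1_def)
qed

text \<open>The score is the posterior average of the component scores
  \<open>(G_i - x) / hvar\<close>; as the posteriors sum to 1, the common \<open>- x\<close> comes
  out of the average.\<close>

lemma score_mix:
  assumes t: "0 < t"
  shows "grad (\<lambda>x. ln (fwd_dens (mix_law w1 w2 c1 c2) t x)) x =
    (1 / hvar t) *\<^sub>R ((post1 t x *\<^sub>R Gfun c1 t x + post2 t x *\<^sub>R Gfun c2 t x) - x)"
proof -
  have h: "0 < hvar t" by (rule hvar_pos[OF t])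
  have p: "0 < pmix t x" by (rule pmix_pos[OF t])
  have d: "GDERIV (pmix t) x :> w1 *\<^sub>R ((C1.dens t x / hvar t) *\<^sub>R (Gfun c1 t x - x)) + w2 *\<^sub>R ((C2.dens t x / hvar t) *\<^sub>R (Gfun c2 t x - x))"
    using GDERIV_add[OF GDERIV_mult[OF GDERIV_const[of w1] C1.gderiv_fwd_dens[OF t]] GDERIV_mult[OF GDERIV_const[of w2] C2.gderiv_fwd_dens[OF t]]]
    by (simp add: pmix_def[abs_def] C1.fwd_dens_eq_dens[OF t] C2.fwd_dens_eq_dens[OF t])
  have "(1 / pmix t x) *\<^sub>R (w1 *\<^sub>R ((C1.dens t x / hvar t) *\<^sub>R (Gfun c1 t x - x)) + w2 *\<^sub>R ((C2.dens t x / hvar t) *\<^sub>R (Gfun c2 t x - x)))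
     = (1 / hvar t) *\<^sub>R (post1 t x *\<^sub>R (Gfun c1 t x - x) + post2 t x *\<^sub>R (Gfun c2 t x - x))"
    by (simp add: post1_def post2_def scaleR_add_right mult_ac)
  also have "post1 t x *\<^sub>R (Gfun c1 t x - x) + post2 t x *\<^sub>R (Gfun c2 t x - x)
     = (post1 t x *\<^sub>R Gfun c1 t x + post2 t x *\<^sub>R Gfun c2 t x) - (post1 t x + post2 t x) *\<^sub>R x"
    by (simp add: algebra_simps)
  finally show ?thesis
    using grad_eqI[OF gderiv_ln[OF d p]] by (simp add: fwd_dens_mix[OF t] post_props(3)[OF t])
qed

text \<open>A version of the projected posterior built on \<open>qmass\<close>, and hence jointly
  measurable in time and space.\<close>

definition projpost1 :: "real^'m^'n \<Rightarrow> real \<Rightarrow> real^'m \<Rightarrow> real" where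
  "projpost1 U t z = w1 * enn2real (C1.qmass U t z) / (w1 * enn2real (C1.qmass U t z) + w2 * enn2real (C2.qmass U t z))"
definition projpost2 :: "real^'m^'n \<Rightarrow> real \<Rightarrow> real^'m \<Rightarrow> real" where
  "projpost2 U t z = w2 * enn2real (C2.qmass U t z) / (w1 * enn2real (C1.qmass U t z) + w2 * enn2real (C2.qmass U t z))"

text \<open>Positivity of the projected densities matters here: where both vanish the quotients are
  0 by convention, and the weights would not sum to 1.\<close>

lemma AE_projpost:
  assumes t: "0 < t" and U: "orthonormal_columns U"
  shows "AE x in lborel. piU_fst w1 w2 c1 c2 U (transpose U *v x) t = projpost1 U t (transpose U *v x) \<and>
     piU_snd w1 w2 c1 c2 U (transpose U *v x) t = projpost2 U t (transpose U *v x) \<and>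
     piU_fst w1 w2 c1 c2 U (transpose U *v x) t + piU_snd w1 w2 c1 c2 U (transpose U *v x) t = 1"
  using C1.AE_qdens[OF t U] C2.AE_qdens[OF t U]
proof eventually_elim
  case (elim x)
  let ?q1 = "qdens c1 U t (transpose U *v x)" and ?q2 = "qdens c2 U t (transpose U *v x)"
  have "0 < w1 * ?q1 + w2 * ?q2" using elim w1 w2 by (simp add: add_pos_pos)
  then have "w1 * ?q1 / (w1 * ?q1 + w2 * ?q2) + w2 * ?q2 / (w1 * ?q1 + w2 * ?q2) = 1"
    by (simp add: add_divide_distrib[symmetric])
  then show ?case using elim by (simp add: piU_fst_def piU_snd_def projpost1_def projpost2_def)
qed

lemma borel_measurable_piU [measurable]:
  "(\<lambda>z. piU_fst w1 w2 c1 c2 U z t) \<in> borel_measurable borel"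
  "(\<lambda>z. piU_snd w1 w2 c1 c2 U z t) \<in> borel_measurable borel"
  unfolding piU_fst_def piU_snd_def by measurable

section \<open>The risk at a fixed time\<close>

lemma risk_at_time:
  fixes U :: "real^'m^'n" and f :: "real^'m \<Rightarrow> real \<Rightarrow> real^'m"
  assumes t: "0 < t" and U: "orthonormal_columns U" and \<eta>: "0 < \<eta>"
    and f [measurable]: "(\<lambda>z. f z t) \<in> borel_measurable borel"
  shows "(\<integral>\<^sup>+x. ennreal ((norm (((1 / hvar t) *\<^sub>R (U *v f (transpose U *v x) t) - (1 / hvar t) *\<^sub>R x)
        - grad (\<lambda>x. ln (fwd_dens (mix_law w1 w2 c1 c2) t x)) x))\<^sup>2) \<partial>fwd_law (mix_law w1 w2 c1 c2) t)
    \<le> ennreal (1 + 1 / \<eta>) * (ennreal (1 / (hvar t)\<^sup>2) *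
        (\<integral>\<^sup>+x. ennreal ((norm (f (transpose U *v x) t - f_comp w1 w2 c1 c2 U (transpose U *v x) t))\<^sup>2) \<partial>fwd_law (mix_law w1 w2 c1 c2) t))
     + ennreal (1 + \<eta>) * (ennreal (1 / (hvar t)\<^sup>2) *
         (ennreal w1 * (\<integral>\<^sup>+x. ennreal ((norm (proj_perp U *v Gfun c1 t x))\<^sup>2) \<partial>fwd_law (data_law c1) t)
        + ennreal w2 * (\<integral>\<^sup>+x. ennreal ((norm (proj_perp U *v Gfun c2 t x))\<^sup>2) \<partial>fwd_law (data_law c2) t))
       + 2 * (ennreal w1 * (ennreal (1 / (hvar t)\<^sup>2) *
          (\<integral>\<^sup>+x. ennreal ((norm (psi c1 U (transpose U *v x) t - transpose U *v Gfun c1 t x))\<^sup>2) \<partial>fwd_law (data_law c1) t))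
        + ennreal w2 * (ennreal (1 / (hvar t)\<^sup>2) *
          (\<integral>\<^sup>+x. ennreal ((norm (psi c2 U (transpose U *v x) t - transpose U *v Gfun c2 t x))\<^sup>2) \<partial>fwd_law (data_law c2) t)))
       + 2 * (ennreal (1 / (hvar t)\<^sup>2) *
          (\<integral>\<^sup>+x. ennreal ((piU_fst w1 w2 c1 c2 U (transpose U *v x) t - pi_fst w1 w2 c1 c2 x t)\<^sup>2 *
            (norm (psi c1 U (transpose U *v x) t - psi c2 U (transpose U *v x) t))\<^sup>2) \<partial>fwd_law (mix_law w1 w2 c1 c2) t)))"
    (is "?lhs \<le> ?rhs")
proof -
  let ?k = "1 / (hvar t)\<^sup>2" and ?z = "\<lambda>x. transpose U *v x"
  define s where "s x = (norm (((1 / hvar t) *\<^sub>R (U *v f (?z x) t) - (1 / hvar t) *\<^sub>R x)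
        - grad (\<lambda>x. ln (fwd_dens (mix_law w1 w2 c1 c2) t x)) x))\<^sup>2" for x
  define a where "a x = (norm (f (?z x) t - f_comp w1 w2 c1 c2 U (?z x) t))\<^sup>2" for x
  define e1 where "e1 x = (norm (proj_perp U *v Gfun c1 t x))\<^sup>2" for x
  define e2 where "e2 x = (norm (proj_perp U *v Gfun c2 t x))\<^sup>2" for x
  define r1 where "r1 x = (norm (psi c1 U (?z x) t - transpose U *v Gfun c1 t x))\<^sup>2" for x
  define r2 where "r2 x = (norm (psi c2 U (?z x) t - transpose U *v Gfun c2 t x))\<^sup>2" for x
  define p where "p x = (piU_fst w1 w2 c1 c2 U (?z x) t - pi_fst w1 w2 c1 c2 x t)\<^sup>2 *
            (norm (psi c1 U (?z x) t - psi c2 U (?z x) t))\<^sup>2" for x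
  note defs = s_def a_def e1_def e2_def r1_def r2_def p_def
  have nn: "0 \<le> s x" "0 \<le> a x" "0 \<le> e1 x" "0 \<le> e2 x" "0 \<le> r1 x" "0 \<le> r2 x" "0 \<le> p x" for x
    by (simp_all add: defs)
  have [measurable]: "s \<in> borel_measurable borel" "a \<in> borel_measurable borel" "e1 \<in> borel_measurable borel"
    "e2 \<in> borel_measurable borel" "r1 \<in> borel_measurable borel" "r2 \<in> borel_measurable borel" "p \<in> borel_measurable borel"
    unfolding defs[abs_def] f_comp_def C1.psi_eq[OF t] C2.psi_eq[OF t] C1.Gfun_eq[OF t] C2.Gfun_eq[OF t]
      score_mix[OF t] post_props(6)[OF t] post1_def post2_def
    by measurable
  let ?d1 = "C1.dens t" and ?d2 = "C2.dens t" and ?m = "pmix t"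
  have pos: "0 \<le> ?m x" "0 \<le> ?d1 x" "0 \<le> ?d2 x" for x
    using pmix_pos[OF t, of x] C1.dens_pos[OF t, of x] C2.dens_pos[OF t, of x] by auto
  have k: "0 \<le> ?k" "0 \<le> 1 + 1 / \<eta>" "0 \<le> 1 + \<eta>" "0 \<le> w1" "0 \<le> w2" using \<eta> w1 w2 by auto
  \<comment> \<open>Multiplying by the mixture density before integrating refers the three laws
    involved to Lebesgue measure, where they can be compared pointwise. The bound holds almost
    everywhere because the projected posteriors are known to sum to 1 only off a null set.\<close>
  have pt: "AE x in lborel. ?m x * s x \<le> (1 + 1 / \<eta>) * (?k * (?m x * a x)) + (1 + \<eta>) * (?k * (w1 * (?d1 x * e1 x) + w2 * (?d2 x * e2 x))
      + 2 * (w1 * (?k * (?d1 x * r1 x)) + w2 * (?k * (?d2 x * r2 x))) + 2 * (?k * (?m x * p x)))"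
    using AE_projpost[OF t U]
  proof eventually_elim
    case (elim x)
    let ?G = "post1 t x *\<^sub>R Gfun c1 t x + post2 t x *\<^sub>R Gfun c2 t x"
    note pp = post_props[OF t, of x]
    have "((1 / hvar t) *\<^sub>R (U *v f (?z x) t) - (1 / hvar t) *\<^sub>R x) - grad (\<lambda>x. ln (fwd_dens (mix_law w1 w2 c1 c2) t x)) x
       = (1 / hvar t) *\<^sub>R (U *v f (?z x) t - ?G)"
      unfolding score_mix[OF t] by (simp add: algebra_simps)
    then have s: "s x = ?k * (norm (U *v f (?z x) t - ?G))\<^sup>2"
      unfolding s_def by (simp add: power_divide)
    have "(norm (U *v f (?z x) t - ?G))\<^sup>2 \<le> (1 + 1 / \<eta>) * a x + (1 + \<eta>) * ((post1 t x * e1 x + post2 t x * e2 x)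
        + 2 * (post1 t x * r1 x + post2 t x * r2 x) + 2 * p x)"
      unfolding a_def e1_def e2_def r1_def r2_def p_def f_comp_def pp(6)
      using elim by (intro risk_decomposition[OF U \<eta> pp(1-3)]) simp
    then have "?m x * s x \<le> ?m x * (?k * ((1 + 1 / \<eta>) * a x + (1 + \<eta>) * ((post1 t x * e1 x + post2 t x * e2 x)
        + 2 * (post1 t x * r1 x + post2 t x * r2 x) + 2 * p x)))"
      unfolding s using pos k by (intro mult_left_mono)
    also have "\<dots> = (1 + 1 / \<eta>) * (?k * (?m x * a x)) + (1 + \<eta>) * (?k * (w1 * (?d1 x * e1 x) + w2 * (?d2 x * e2 x))
      + 2 * (w1 * (?k * (?d1 x * r1 x)) + w2 * (?k * (?d2 x * r2 x))) + 2 * (?k * (?m x * p x)))"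
      by (rule bayes_rearrange[OF pp(4,5)])
    finally show ?case .
  qed
  have "?lhs = (\<integral>\<^sup>+x. ennreal (?m x * s x) \<partial>lborel)"
    unfolding s_def[symmetric] by (subst nn_integral_fwd_law_mix[OF t]) (simp_all add: ennreal_mult pos nn)
  also have "\<dots> \<le> (\<integral>\<^sup>+x. ennreal ((1 + 1 / \<eta>) * (?k * (?m x * a x)) + (1 + \<eta>) * (?k * (w1 * (?d1 x * e1 x) + w2 * (?d2 x * e2 x))
      + 2 * (w1 * (?k * (?d1 x * r1 x)) + w2 * (?k * (?d2 x * r2 x))) + 2 * (?k * (?m x * p x)))) \<partial>lborel)"
    using pt by (intro nn_integral_mono_AE) (auto elim!: eventually_mono intro!: ennreal_leI)
  also have "\<dots> = (\<integral>\<^sup>+x. ennreal (1 + 1 / \<eta>) * (ennreal ?k * ennreal (?m x * a x)) + ennreal (1 + \<eta>) * (ennreal ?k * (ennreal w1 * ennreal (?d1 x * e1 x) + ennreal w2 * ennreal (?d2 x * e2 x))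
      + 2 * (ennreal w1 * (ennreal ?k * ennreal (?d1 x * r1 x)) + ennreal w2 * (ennreal ?k * ennreal (?d2 x * r2 x))) + 2 * (ennreal ?k * ennreal (?m x * p x))) \<partial>lborel)"
    using k pos nn by (intro nn_integral_cong ennreal_risk_combination mult_nonneg_nonneg) auto
  also have "\<dots> = ennreal (1 + 1 / \<eta>) * (ennreal ?k * (\<integral>\<^sup>+x. ennreal (?m x * a x) \<partial>lborel)) +
     ennreal (1 + \<eta>) * (ennreal ?k * (ennreal w1 * (\<integral>\<^sup>+x. ennreal (?d1 x * e1 x) \<partial>lborel) + ennreal w2 * (\<integral>\<^sup>+x. ennreal (?d2 x * e2 x) \<partial>lborel))
      + 2 * (ennreal w1 * (ennreal ?k * (\<integral>\<^sup>+x. ennreal (?d1 x * r1 x) \<partial>lborel)) + ennreal w2 * (ennreal ?k * (\<integral>\<^sup>+x. ennreal (?d2 x * r2 x) \<partial>lborel)))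
      + 2 * (ennreal ?k * (\<integral>\<^sup>+x. ennreal (?m x * p x) \<partial>lborel)))"
    by (simp add: nn_integral_add nn_integral_cmult)
  also have "\<dots> = ?rhs"
    unfolding a_def[symmetric] e1_def[symmetric] e2_def[symmetric] r1_def[symmetric] r2_def[symmetric] p_def[symmetric]
    by (simp add: nn_integral_fwd_law_mix[OF t] C1.nn_integral_fwd_law[OF t] C2.nn_integral_fwd_law[OF t] ennreal_mult pos nn)
  finally show ?thesis .
qed

section \<open>Measurability in time of the error integrands\<close>

lemma time_measurable_A_integrand:
  fixes U :: "real^'m^'n"
  assumes t0: "0 < t0" and U: "orthonormal_columns U"
    and f: "case_prod f \<in> borel_measurable (borel \<Otimes>\<^sub>M borel)"
  shows "time_measurable t0 T (\<lambda>t. ennreal (1 / (hvar t)\<^sup>2) *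
     (\<integral>\<^sup>+x. ennreal ((norm (f (transpose U *v x) t - f_comp w1 w2 c1 c2 U (transpose U *v x) t))\<^sup>2)
        \<partial>fwd_law (mix_law w1 w2 c1 c2) t))"
proof -
  have [measurable]: "(\<lambda>x. f (g x) (h x)) \<in> borel_measurable N"
    if "g \<in> borel_measurable N" "h \<in> borel_measurable N" for g h and N :: "'b measure"
    using measurable_compose[OF measurable_Pair[OF that] f] by simp
  let ?z = "\<lambda>x. transpose U *v x"
  let ?H1 = "transpose U ** basis c1" and ?H2 = "transpose U ** basis c2"
  \<comment> \<open>At each fixed time the comparator equals this jointly measurable expression for
    almost every \<open>x\<close>, so the inner integral is unchanged and Tonelli gives
    measurability in \<open>t\<close>.\<close>
  define F where "F t x = ennreal ((norm (f (?z x) t -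
     (projpost1 U t (?z x) *\<^sub>R (?H1 *v C1.gver t (pinv ?H1 *v ?z x)) + projpost2 U t (?z x) *\<^sub>R (?H2 *v C2.gver t (pinv ?H2 *v ?z x)))))\<^sup>2)" for t x
  have [measurable]: "case_prod F \<in> borel_measurable (borel \<Otimes>\<^sub>M borel)"
    unfolding F_def[abs_def] projpost1_def projpost2_def by measurable
  have [measurable]: "F t \<in> borel_measurable borel" for t by measurable
  show ?thesis
  proof (rule time_measurable_cong)
    fix t assume "t \<in> {t0..T}"
    then have t: "0 < t" using t0 by simp
    have "AE x in lborel. ennreal ((norm (f (?z x) t - f_comp w1 w2 c1 c2 U (?z x) t))\<^sup>2) = F t x"
      using AE_projpost[OF t U] by eventually_elim (simp add: F_def f_comp_def C1.psi_eq[OF t] C2.psi_eq[OF t])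
    then have "AE x in fwd_law (mix_law w1 w2 c1 c2) t. ennreal ((norm (f (?z x) t - f_comp w1 w2 c1 c2 U (?z x) t))\<^sup>2) = F t x"
      unfolding fwd_law_def fwd_dens_mix[OF t] by (subst AE_density) (auto elim: eventually_mono)
    then have "(\<integral>\<^sup>+x. ennreal ((norm (f (?z x) t - f_comp w1 w2 c1 c2 U (?z x) t))\<^sup>2) \<partial>fwd_law (mix_law w1 w2 c1 c2) t)
      = (\<integral>\<^sup>+x. F t x \<partial>fwd_law (mix_law w1 w2 c1 c2) t)"
      by (rule nn_integral_cong_AE)
    then show "ennreal (1 / (hvar t)\<^sup>2) * (\<integral>\<^sup>+x. ennreal ((norm (f (?z x) t - f_comp w1 w2 c1 c2 U (?z x) t))\<^sup>2) \<partial>fwd_law (mix_law w1 w2 c1 c2) t)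
      = ennreal (1 / (hvar t)\<^sup>2) * (\<integral>\<^sup>+x. ennreal (pmix t x) * F t x \<partial>lborel)"
      by (simp add: nn_integral_fwd_law_mix[OF t])
  next
    show "(\<lambda>t. ennreal (1 / (hvar t)\<^sup>2) * (\<integral>\<^sup>+x. ennreal (pmix t x) * F t x \<partial>lborel)) \<in> borel_measurable borel"
      by measurable
  qed
qed

lemma time_measurable_P_integrand:
  fixes U :: "real^'m^'n"
  assumes t0: "0 < t0" and U: "orthonormal_columns U"
  shows "time_measurable t0 T (\<lambda>t. ennreal (1 / (hvar t)\<^sup>2) *
     (\<integral>\<^sup>+x. ennreal ((piU_fst w1 w2 c1 c2 U (transpose U *v x) t - pi_fst w1 w2 c1 c2 x t)\<^sup>2 *
            (norm (psi c1 U (transpose U *v x) t - psi c2 U (transpose U *v x) t))\<^sup>2) \<partial>fwd_law (mix_law w1 w2 c1 c2) t))"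
proof -
  let ?z = "\<lambda>x. transpose U *v x"
  let ?H1 = "transpose U ** basis c1" and ?H2 = "transpose U ** basis c2"
  define F where "F t x = ennreal ((projpost1 U t (?z x) - post1 t x)\<^sup>2 *
     (norm (?H1 *v C1.gver t (pinv ?H1 *v ?z x) - ?H2 *v C2.gver t (pinv ?H2 *v ?z x)))\<^sup>2)" for t x
  have [measurable]: "case_prod F \<in> borel_measurable (borel \<Otimes>\<^sub>M borel)"
    unfolding F_def[abs_def] projpost1_def post1_def by measurable
  have [measurable]: "F t \<in> borel_measurable borel" for t by measurable
  let ?P = "\<lambda>t x. ennreal ((piU_fst w1 w2 c1 c2 U (?z x) t - pi_fst w1 w2 c1 c2 x t)\<^sup>2 *
            (norm (psi c1 U (?z x) t - psi c2 U (?z x) t))\<^sup>2)"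
  show ?thesis
  proof (rule time_measurable_cong)
    fix t assume "t \<in> {t0..T}"
    then have t: "0 < t" using t0 by simp
    have "AE x in lborel. ?P t x = F t x"
      using AE_projpost[OF t U]
      by eventually_elim (simp add: F_def post_props(6)[OF t] C1.psi_eq[OF t] C2.psi_eq[OF t])
    then have "AE x in fwd_law (mix_law w1 w2 c1 c2) t. ?P t x = F t x"
      unfolding fwd_law_def fwd_dens_mix[OF t] by (subst AE_density) (auto elim: eventually_mono)
    then have "(\<integral>\<^sup>+x. ?P t x \<partial>fwd_law (mix_law w1 w2 c1 c2) t) = (\<integral>\<^sup>+x. F t x \<partial>fwd_law (mix_law w1 w2 c1 c2) t)"
      by (rule nn_integral_cong_AE)
    then show "ennreal (1 / (hvar t)\<^sup>2) * (\<integral>\<^sup>+x. ?P t x \<partial>fwd_law (mix_law w1 w2 c1 c2) t)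
      = ennreal (1 / (hvar t)\<^sup>2) * (\<integral>\<^sup>+x. ennreal (pmix t x) * F t x \<partial>lborel)"
      by (simp add: nn_integral_fwd_law_mix[OF t])
  next
    show "(\<lambda>t. ennreal (1 / (hvar t)\<^sup>2) * (\<integral>\<^sup>+x. ennreal (pmix t x) * F t x \<partial>lborel)) \<in> borel_measurable borel"
      by measurable
  qed
qed

section \<open>Integration over time\<close>

lemma oracle_risk_bound:
  fixes U :: "real^'m^'n" and \<F> :: "(real^'m \<Rightarrow> real \<Rightarrow> real^'m) set"
  assumes t0: "0 < t0" and T: "t0 < T" and U: "orthonormal_columns U" and \<eta>: "0 < \<eta>"
    and lip: "latent_lipschitz T \<beta>1 c1" "latent_lipschitz T \<beta>2 c2"
    and tail: "latent_smooth_tail c1" "latent_smooth_tail c2"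
    and reg: "gfun_time_regular t0 T c1" "gfun_time_regular t0 T c2"
    and \<F>: "\<And>f. f \<in> \<F> \<Longrightarrow> case_prod f \<in> borel_measurable (borel \<Otimes>\<^sub>M borel)"
  shows "B_mix t0 T w1 w2 c1 c2 \<F> U \<le> ennreal (1 + \<eta>) *
          (ennreal (Gamma_term t0 T w1 w2 c1 c2 U
             + (w1 * nbar t0 T c1 * trace (proj_perp U ** proj_perp (basis c1))
                + w2 * nbar t0 T c2 * trace (proj_perp U ** proj_perp (basis c2))))
           + 2 * (ennreal w1 * R_term t0 T c1 U + ennreal w2 * R_term t0 T c2 U)
           + 2 * P_term t0 T w1 w2 c1 c2 U)
        + ennreal (1 + 1 / \<eta>) * (INF f\<in>\<F>. A_mix t0 T w1 w2 c1 c2 f U)"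
proof -
  let ?N1 = "(norm (proj_perp U ** basis c1))\<^sup>2" and ?N2 = "(norm (proj_perp U ** basis c2))\<^sup>2"
  let ?T1 = "trace (proj_perp U ** proj_perp (basis c1))" and ?T2 = "trace (proj_perp U ** proj_perp (basis c2))"
  let ?l1 = "\<lambda>t. lambda_max (second_moment_g c1 t) / (hvar t)\<^sup>2" and ?l2 = "\<lambda>t. lambda_max (second_moment_g c2 t) / (hvar t)\<^sup>2"
  let ?n1 = "\<lambda>t. (alpha t) ^ 4 * (noise c1) ^ 4 / ((hvar t)\<^sup>2 * htil c1 t)" and ?n2 = "\<lambda>t. (alpha t) ^ 4 * (noise c2) ^ 4 / ((hvar t)\<^sup>2 * htil c2 t)"
  obtain K1 where K1: "\<And>t. t \<in> {t0..T} \<Longrightarrow>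
    (\<integral>\<^sup>+x. ennreal ((norm (C1.gver t (transpose (basis c1) *v x)))\<^sup>2) \<partial>fwd_law (data_law c1) t) \<le> ennreal K1"
    using C1.gver_moment_bound[OF t0 lip(1) tail(1) reg(1)] by blast
  obtain K2 where K2: "\<And>t. t \<in> {t0..T} \<Longrightarrow>
    (\<integral>\<^sup>+x. ennreal ((norm (C2.gver t (transpose (basis c2) *v x)))\<^sup>2) \<partial>fwd_law (data_law c2) t) \<le> ennreal K2"
    using C2.gver_moment_bound[OF t0 lip(2) tail(2) reg(2)] by blast
  have i: "set_integrable lborel {t0..T} ?l1" "set_integrable lborel {t0..T} ?l2"
      "set_integrable lborel {t0..T} ?n1" "set_integrable lborel {t0..T} ?n2"
    by (rule C1.set_integrable_cbar[OF t0 K1] C2.set_integrable_cbar[OF t0 K2]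
        C1.set_integrable_nbar[OF t0] C2.set_integrable_nbar[OF t0]; assumption)+
  have tr: "0 \<le> ?T1" "0 \<le> ?T2"
    using C1.nn_integral_fwd_law_perp(2)[OF t0 U] C2.nn_integral_fwd_law_perp(2)[OF t0 U] by auto
  have nonneg: "0 \<le> ?l1 t" "0 \<le> ?l2 t" "0 \<le> ?n1 t" "0 \<le> ?n2 t" if "t \<in> {t0..T}" for t
  proof -
    have t: "0 < t" using that t0 by simp
    show "0 \<le> ?l1 t" "0 \<le> ?l2 t"
      using C1.lambda_max_Mver_bounds(1)[OF t K1[OF that]] C2.lambda_max_Mver_bounds(1)[OF t K2[OF that]]
      by (simp_all add: C1.second_moment_g_eq[OF t] C2.second_moment_g_eq[OF t])
    show "0 \<le> ?n1 t" "0 \<le> ?n2 t" using C1.htil_pos[OF t] C2.htil_pos[OF t] by simp_all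
  qed
  \<comment> \<open>The real integrand whose time average is the sum of the
    \<open>Gamma_term\<close> and the trace terms. It is nonnegative on the interval, so
    \<open>ennreal\<close> does not truncate it.\<close>
  define e where "e t = (w1 * ?N1) * ?l1 t + (w2 * ?N2) * ?l2 t + ((w1 * ?T1) * ?n1 t + (w2 * ?T2) * ?n2 t)" for t
  have ei: "set_integrable lborel {t0..T} e"
    unfolding e_def[abs_def] by (intro set_integral_add set_integrable_mult_right i impI)
  have enn: "0 \<le> e t" if "t \<in> {t0..T}" for t
    unfolding e_def using nonneg[OF that] tr w1 w2 by (intro add_nonneg_nonneg mult_nonneg_nonneg) auto
  have eint: "1 / (T - t0) * (LINT t:{t0..T}|lborel. e t) = Gamma_term t0 T w1 w2 c1 c2 U
             + (w1 * nbar t0 T c1 * ?T1 + w2 * nbar t0 T c2 * ?T2)"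
  proof -
    have "(LINT t:{t0..T}|lborel. e t) = ((w1 * ?N1) * (LINT t:{t0..T}|lborel. ?l1 t) + (w2 * ?N2) * (LINT t:{t0..T}|lborel. ?l2 t))
        + ((w1 * ?T1) * (LINT t:{t0..T}|lborel. ?n1 t) + (w2 * ?T2) * (LINT t:{t0..T}|lborel. ?n2 t))"
      unfolding e_def by (simp only: set_integral_add(2) set_integral_add(1) set_integrable_mult_right i set_integral_mult_right)
    then show ?thesis
      by (simp add: Gamma_term_def cbar_def nbar_def distrib_left mult_ac)
  qed
  have e_avg: "time_avg t0 T (\<lambda>t. ennreal (e t)) = ennreal (Gamma_term t0 T w1 w2 c1 c2 U
             + (w1 * nbar t0 T c1 * ?T1 + w2 * nbar t0 T c2 * ?T2))"
    "time_measurable t0 T (\<lambda>t. ennreal (e t))"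
    using time_avg_ennreal[of t0 T e, OF T ei] enn unfolding eint by auto
  define R1 where "R1 t = ennreal (1 / (hvar t)\<^sup>2) *
     (\<integral>\<^sup>+x. ennreal ((norm (psi c1 U (transpose U *v x) t - transpose U *v Gfun c1 t x))\<^sup>2) \<partial>fwd_law (data_law c1) t)" for t
  define R2 where "R2 t = ennreal (1 / (hvar t)\<^sup>2) *
     (\<integral>\<^sup>+x. ennreal ((norm (psi c2 U (transpose U *v x) t - transpose U *v Gfun c2 t x))\<^sup>2) \<partial>fwd_law (data_law c2) t)" for t
  define P where "P t = ennreal (1 / (hvar t)\<^sup>2) *
     (\<integral>\<^sup>+x. ennreal ((piU_fst w1 w2 c1 c2 U (transpose U *v x) t - pi_fst w1 w2 c1 c2 x t)\<^sup>2 *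
            (norm (psi c1 U (transpose U *v x) t - psi c2 U (transpose U *v x) t))\<^sup>2) \<partial>fwd_law (mix_law w1 w2 c1 c2) t)" for t
  define A where "A f t = ennreal (1 / (hvar t)\<^sup>2) *
     (\<integral>\<^sup>+x. ennreal ((norm (f (transpose U *v x) t - f_comp w1 w2 c1 c2 U (transpose U *v x) t))\<^sup>2)
        \<partial>fwd_law (mix_law w1 w2 c1 c2) t)" for f :: "real^'m \<Rightarrow> real \<Rightarrow> real^'m" and t
  have mR1: "time_measurable t0 T R1" and mR2: "time_measurable t0 T R2" and mP: "time_measurable t0 T P"
    unfolding R1_def[abs_def] R2_def[abs_def] P_def[abs_def]
    by (rule C1.time_measurable_R_integrand[OF t0] C2.time_measurable_R_integrand[OF t0] time_measurable_P_integrand[OF t0 U])+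
  have perp: "ennreal (1 / (hvar t)\<^sup>2) *
         (ennreal w1 * (\<integral>\<^sup>+x. ennreal ((norm (proj_perp U *v Gfun c1 t x))\<^sup>2) \<partial>fwd_law (data_law c1) t)
        + ennreal w2 * (\<integral>\<^sup>+x. ennreal ((norm (proj_perp U *v Gfun c2 t x))\<^sup>2) \<partial>fwd_law (data_law c2) t)) \<le> ennreal (e t)"
    if tt: "t \<in> {t0..T}" for t
  proof -
    have t: "0 < t" using tt t0 by simp
    have h: "hvar t \<noteq> 0" using hvar_pos[OF t] by simp
    let ?b1 = "lambda_max (second_moment_g c1 t) * ?N1 + (alpha t) ^ 4 * (noise c1) ^ 4 / htil c1 t * ?T1"
    let ?b2 = "lambda_max (second_moment_g c2 t) * ?N2 + (alpha t) ^ 4 * (noise c2) ^ 4 / htil c2 t * ?T2"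
    have b: "0 \<le> ?b1" "0 \<le> ?b2"
      using C1.lambda_max_Mver_bounds(1)[OF t K1[OF tt]] C2.lambda_max_Mver_bounds(1)[OF t K2[OF tt]] tr
        C1.htil_pos[OF t] C2.htil_pos[OF t]
      by (simp_all add: C1.second_moment_g_eq[OF t] C2.second_moment_g_eq[OF t])
    have fin: "(\<integral>\<^sup>+x. ennreal ((norm (C1.gver t (transpose (basis c1) *v x)))\<^sup>2) \<partial>fwd_law (data_law c1) t) < \<infinity>"
      "(\<integral>\<^sup>+x. ennreal ((norm (C2.gver t (transpose (basis c2) *v x)))\<^sup>2) \<partial>fwd_law (data_law c2) t) < \<infinity>"
      using K1[OF tt] K2[OF tt] by (auto intro: le_less_trans)
    have "ennreal (1 / (hvar t)\<^sup>2) *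
         (ennreal w1 * (\<integral>\<^sup>+x. ennreal ((norm (proj_perp U *v Gfun c1 t x))\<^sup>2) \<partial>fwd_law (data_law c1) t)
        + ennreal w2 * (\<integral>\<^sup>+x. ennreal ((norm (proj_perp U *v Gfun c2 t x))\<^sup>2) \<partial>fwd_law (data_law c2) t))
      \<le> ennreal (1 / (hvar t)\<^sup>2) * (ennreal w1 * ennreal ?b1 + ennreal w2 * ennreal ?b2)"
      by (intro mult_left_mono add_mono C1.nn_integral_fwd_law_Gfun_le[OF t fin(1) U] C2.nn_integral_fwd_law_Gfun_le[OF t fin(2) U]) auto
    also have "\<dots> = ennreal (1 / (hvar t)\<^sup>2 * (w1 * ?b1 + w2 * ?b2))"
    proof -
      have "0 \<le> w1 * ?b1" "0 \<le> w2 * ?b2" using w1 w2 b by simp_all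
      then show ?thesis
        using w1 w2 b by (simp only: ennreal_mult[symmetric] ennreal_plus[symmetric] less_imp_le add_nonneg_nonneg
            zero_le_divide_iff zero_le_power2 zero_le_one simp_thms)
    qed
    also have "1 / (hvar t)\<^sup>2 * (w1 * ?b1 + w2 * ?b2) = e t"
      unfolding e_def using h by (simp add: distrib_left mult_ac)
    finally show ?thesis .
  qed
  have main: "L_mix t0 T w1 w2 c1 c2 (\<lambda>x t. (1 / hvar t) *\<^sub>R (U *v f (transpose U *v x) t) - (1 / hvar t) *\<^sub>R x)
    \<le> ennreal (1 + \<eta>) * (time_avg t0 T (\<lambda>t. ennreal (e t)) + 2 * (ennreal w1 * time_avg t0 T R1 + ennreal w2 * time_avg t0 T R2) + 2 * time_avg t0 T P)
      + ennreal (1 + 1 / \<eta>) * time_avg t0 T (A f)" if f: "f \<in> \<F>" for f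
  proof -
    have mA: "time_measurable t0 T (A f)"
      unfolding A_def[abs_def] by (rule time_measurable_A_integrand[OF t0 U \<F>[OF f]])
    \<comment> \<open>Monotonicity comes before any splitting: only the upper bound is broken into
      summands, and each of these is known to be measurable in time.\<close>
    have "L_mix t0 T w1 w2 c1 c2 (\<lambda>x t. (1 / hvar t) *\<^sub>R (U *v f (transpose U *v x) t) - (1 / hvar t) *\<^sub>R x)
      \<le> time_avg t0 T (\<lambda>t. ennreal (1 + \<eta>) * (ennreal (e t) + 2 * (ennreal w1 * R1 t + ennreal w2 * R2 t) + 2 * P t)
           + ennreal (1 + 1 / \<eta>) * A f t)"
      unfolding L_mix_def
    proof (rule time_avg_mono)
      fix t assume tt: "t \<in> {t0..T}"
      then have t: "0 < t" using t0 by simp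
      have fm: "(\<lambda>z. f z t) \<in> borel_measurable borel"
        using measurable_compose[OF measurable_Pair[OF measurable_ident_sets[OF refl] measurable_const] \<F>[OF f], of t] by simp
      show "(\<integral>\<^sup>+x. ennreal ((norm (((1 / hvar t) *\<^sub>R (U *v f (transpose U *v x) t) - (1 / hvar t) *\<^sub>R x)
          - grad (\<lambda>x. ln (fwd_dens (mix_law w1 w2 c1 c2) t x)) x))\<^sup>2) \<partial>fwd_law (mix_law w1 w2 c1 c2) t)
        \<le> ennreal (1 + \<eta>) * (ennreal (e t) + 2 * (ennreal w1 * R1 t + ennreal w2 * R2 t) + 2 * P t)
           + ennreal (1 + 1 / \<eta>) * A f t"
        by (rule order_trans[OF risk_at_time[of t U \<eta> f, OF t U \<eta> fm]])
          (unfold R1_def[symmetric] R2_def[symmetric] P_def[symmetric] A_def[symmetric],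
            subst add.commute, intro add_mono mult_left_mono perp[OF tt] order_refl zero_le)
    qed
    also have "\<dots> = ennreal (1 + \<eta>) * (time_avg t0 T (\<lambda>t. ennreal (e t)) + 2 * (ennreal w1 * time_avg t0 T R1 + ennreal w2 * time_avg t0 T R2) + 2 * time_avg t0 T P)
      + ennreal (1 + 1 / \<eta>) * time_avg t0 T (A f)"
      by (simp only: time_avg_add time_avg_cmult time_measurable_add time_measurable_cmult mR1 mR2 mP mA e_avg(2))
    finally show ?thesis .
  qed
  let ?C = "ennreal (1 + \<eta>) * (time_avg t0 T (\<lambda>t. ennreal (e t)) + 2 * (ennreal w1 * time_avg t0 T R1 + ennreal w2 * time_avg t0 T R2) + 2 * time_avg t0 T P)"
  \<comment> \<open>Each \<open>f\<close> bounds the oracle risk through its own score; only the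
    approximation error depends on \<open>f\<close>, so the infimum passes to that term
    alone.\<close>
  have "B_mix t0 T w1 w2 c1 c2 \<F> U \<le> ?C + ennreal (1 + 1 / \<eta>) * (INF f\<in>\<F>. time_avg t0 T (A f))"
  proof (rule ennreal_le_add_mult_INF)
    show "0 < 1 + 1 / \<eta>" using \<eta> by (simp add: add_pos_pos)
    fix f assume f: "f \<in> \<F>"
    have "B_mix t0 T w1 w2 c1 c2 \<F> U \<le> L_mix t0 T w1 w2 c1 c2 (\<lambda>x t. (1 / hvar t) *\<^sub>R (U *v f (transpose U *v x) t) - (1 / hvar t) *\<^sub>R x)"
      unfolding B_mix_def score_class_def by (rule INF_lower) (use f in blast)
    then show "B_mix t0 T w1 w2 c1 c2 \<F> U \<le> ?C + ennreal (1 + 1 / \<eta>) * time_avg t0 T (A f)"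
      using main[OF f] by (rule order_trans)
  qed
  then show ?thesis
    unfolding e_avg(1) R_term_def P_term_def A_mix_def R1_def P_def R2_def A_def .
qed

end

theorem theorem7:
  fixes t0 T :: real
    and c1 :: "('n::finite, 'd1::finite) component"
    and c2 :: "('n, 'd2::finite) component"
    and \<beta>1 \<beta>2 w1 w2 \<eta> :: real
    and V1 :: "real^'d1^'n"
    and W :: "real^'k^'n"
    and L M J :: nat
    and K \<kappa> \<gamma> \<gamma>\<^sub>t :: real
  assumes "0 < t0" and "t0 < T"
    and "well_formed_component c1" and "well_formed_component c2"
    and "latent_lipschitz T \<beta>1 c1" and "latent_lipschitz T \<beta>2 c2"
    and "latent_smooth_tail c1" and "latent_smooth_tail c2"
    and "gfun_time_regular t0 T c1" and "gfun_time_regular t0 T c2"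
    and "w1 > 0" and "w2 > 0" and "w1 + w2 = 1"
    and "orthonormal_columns V1"
    and "max CARD('d1) CARD('d2) \<le> CARD('k)" and "CARD('k) \<le> CARD('n)"
    and "orthonormal_columns W"
    and "top_eigenspace CARD('k) (M_mix t0 T w1 w2 c1 c2) (span (columns W))"
    and "\<eta> > 0"
  shows "B_mix t0 T w1 w2 c1 c2 (relu_class T L M J K \<kappa> \<gamma> \<gamma>\<^sub>t) V1
      \<le> ennreal (1 + \<eta>) *
          (ennreal (Gamma_term t0 T w1 w2 c1 c2 V1
             + (w1 * nbar t0 T c1 * trace (proj_perp V1 ** proj_perp (basis c1))
                + w2 * nbar t0 T c2 * trace (proj_perp V1 ** proj_perp (basis c2))))
           + 2 * (ennreal w1 * R_term t0 T c1 V1 + ennreal w2 * R_term t0 T c2 V1)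
           + 2 * P_term t0 T w1 w2 c1 c2 V1)
        + ennreal (1 + 1 / \<eta>) *
          (INF f\<in>relu_class T L M J K \<kappa> \<gamma> \<gamma>\<^sub>t. A_mix t0 T w1 w2 c1 c2 f V1)
    \<and> B_mix t0 T w1 w2 c1 c2 (relu_class T L M J K \<kappa> \<gamma> \<gamma>\<^sub>t) W
      \<le> ennreal (1 + \<eta>) *
          (ennreal (Gamma_term t0 T w1 w2 c1 c2 W
             + (w1 * nbar t0 T c1 * trace (proj_perp W ** proj_perp (basis c1))
                + w2 * nbar t0 T c2 * trace (proj_perp W ** proj_perp (basis c2))))
           + 2 * (ennreal w1 * R_term t0 T c1 W + ennreal w2 * R_term t0 T c2 W)
           + 2 * P_term t0 T w1 w2 c1 c2 W)
        + ennreal (1 + 1 / \<eta>) *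
          (INF f\<in>relu_class T L M J K \<kappa> \<gamma> \<gamma>\<^sub>t. A_mix t0 T w1 w2 c1 c2 f W)"
proof -
  interpret two_components c1 c2 w1 w2
    using assms by unfold_locales auto
  show ?thesis
    using assms
    by (intro conjI oracle_risk_bound[of t0 T _ \<eta> \<beta>1 \<beta>2] borel_measurable_relu_class)
qed

end
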